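(* For $t>1$ and $R>0$ let $$\mathbf{Q}^*(\mathbf{r})=\sqrt{\tfrac32}\,h^*(r)\left(\frac{\mathbf{r}\otimes\mathbf{r}}{r^2}-\frac13\mathbf{I}\right),\quad r=|\mathbf{r}|,$$ where $h^*$ is a global minimizer of $I$ in $\mathcal{A}_h$. Then, for all sufficiently large values of $R$ and $t$, $\mathbf{Q}^*$ is not the global minimizer of $\tilde{\mathcal I}_{LG}$ in the admissible space $$\mathcal{A}_{\mathbf{Q}}=\left\{\mathbf{Q}\in W^{1,2}(B(0,R);\bar S):\ \mathbf{Q}=\sqrt{\tfrac32}\left(\frac{\mathbf{r}}{r}\otimes\frac{\mathbf{r}}{r}-\frac{\mathbf{I}}{3}\right)\text{ on }\partial B(0,R)\right\}.$$ In particular, for $t=200$, $\sigma=10$ and $R$ sufficiently large, the biaxial state $$\hat{\mathbf{Q}}(\mathbf{r})=\begin{cases}\mathbf{Q}^*(\mathbf{r})+\dfrac{1}{(r^2+12)^2}\left(1-\dfrac r\sigma\right)\left(\mathbf{z}\otimes\mathbf{z}-\dfrac{\mathbf{I}}{3}\right),&0\le r\le\sigma,\\[2mm]\mathbf{Q}^*(\mathbf{r}),&\sigma\le r\le R,\end{cases}\qquad \mathbf{z}=(0,0,1),$$ has lower free energy than the radial-hedgehog solution, i.e. $\tilde{\mathcal I}_{LG}[\hat{\mathbf{Q}}]<\tilde{\mathcal I}_{LG}[\mathbf{Q}^*]$.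
   Context: $h_+=\frac{3+\sqrt{9+8t}}{4}$, $B(0,R)=\{\mathbf{r}\in\mathbb{R}^3:|\mathbf{r}|\le R\}$, $\bar S$ is the space of symmetric, traceless real $3\times3$ matrices, $\mathbf I$ the identity matrix. The class is $\mathcal{A}_h=\{h\in W^{1,2}([0,R],\mathbb{R}):h(R)=1\}$ and $$I[h]=\int_0^R r^2\left(\frac12\left(\frac{dh}{dr}\right)^2+\frac{3h^2}{r^2}+f(h)\right)dr,\qquad f(h)=-\frac{h^2}{2}-\frac{h_+}{t}h^3+\frac{h_+^2}{2t}h^4+C(t),$$ where the constant $C(t)$ is chosen so that $f\ge0$ and $f(1)=0$. The (dimensionless) Landau-de Gennes energy is $$\tilde{\mathcal I}_{LG}[\mathbf{Q}]=\int_{B(0,R)}\frac12|\nabla\mathbf{Q}|^2-\frac12\mathrm{tr}\,\mathbf{Q}^2-\frac{\sqrt6h_+}{t}\mathrm{tr}\,\mathbf{Q}^3+\frac{h_+^2}{2t}(\mathrm{tr}\,\mathbf{Q}^2)^2+C(t)\,dV,\qquad |\nabla\mathbf{Q}|^2=\sum_{i,j,k}\left(\frac{\partial \mathbf{Q}_{ij}}{\partial x_k}\right)^2 .$$ *)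

theory Defs
  imports "HOL-Analysis.Analysis"
begin

section \<open>The Sobolev space of square integrable functions with square integrable gradient\<close>

definition C1c :: "'a::euclidean_space set \<Rightarrow> ('a \<Rightarrow> 'b::real_normed_vector) set" where
  "C1c \<Omega> = {\<phi>. (\<forall>x. \<phi> differentiable (at x)) \<and>
                (\<forall>b\<in>Basis. continuous_on UNIV (\<lambda>x. frechet_derivative \<phi> (at x) b)) \<and>
                compact (closure {x. \<phi> x \<noteq> 0}) \<and> closure {x. \<phi> x \<noteq> 0} \<subseteq> \<Omega>}"

definition L2_on :: "'a::euclidean_space set \<Rightarrow> ('a \<Rightarrow> 'b::euclidean_space) \<Rightarrow> bool" where
  "L2_on \<Omega> u \<longleftrightarrow> u \<in> borel_measurable (lebesgue_on \<Omega>) \<and>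
                 integrable (lebesgue_on \<Omega>) (\<lambda>x. (norm (u x))\<^sup>2)"

text \<open>
  Only meant for locally integrable \<open>u\<close> and \<open>v\<close>; below it is always guarded by \<open>L2_on\<close>.
  Test functions are of class \<open>C\<^sup>1\<close> with compact support, as in Brezis' textbook; by mollification
  smooth test functions give the same notion.
\<close>
definition is_weak_partial ::
    "'a::euclidean_space set \<Rightarrow> ('a \<Rightarrow> 'b::euclidean_space) \<Rightarrow> 'a \<Rightarrow> ('a \<Rightarrow> 'b) \<Rightarrow> bool" where
  "is_weak_partial \<Omega> u b v \<longleftrightarrow>
     (\<forall>\<phi>\<in>C1c \<Omega>. (LINT x|lebesgue_on \<Omega>. frechet_derivative \<phi> (at x) b *\<^sub>R u x)
               = - (LINT x|lebesgue_on \<Omega>. (\<phi> x :: real) *\<^sub>R v x))"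

definition W12 :: "'a::euclidean_space set \<Rightarrow> ('a \<Rightarrow> 'b::euclidean_space) set" where
  "W12 \<Omega> = {u. L2_on \<Omega> u \<and> (\<forall>b\<in>Basis. \<exists>v. L2_on \<Omega> v \<and> is_weak_partial \<Omega> u b v)}"

text \<open>
  For open \<open>\<Omega>\<close> and \<open>u \<in> W12 \<Omega>\<close> the weak derivative is determined up to a null set, so that integrals
  involving it do not depend on the choice.
\<close>
definition weak_partial ::
    "'a::euclidean_space set \<Rightarrow> ('a \<Rightarrow> 'b::euclidean_space) \<Rightarrow> 'a \<Rightarrow> ('a \<Rightarrow> 'b)" where
  "weak_partial \<Omega> u b = (SOME v. L2_on \<Omega> v \<and> is_weak_partial \<Omega> u b v)"

text \<open>The closure of the compactly supported \<open>C\<^sup>1\<close> functions in the norm of \<open>W12 \<Omega>\<close>.\<close>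
definition W12_0 :: "'a::euclidean_space set \<Rightarrow> ('a \<Rightarrow> 'b::euclidean_space) set" where
  "W12_0 \<Omega> = {u \<in> W12 \<Omega>. \<exists>\<phi>. (\<forall>n::nat. \<phi> n \<in> C1c \<Omega>) \<and>
      (\<lambda>n. LINT x|lebesgue_on \<Omega>. (norm (u x - \<phi> n x))\<^sup>2) \<longlonglongrightarrow> 0 \<and>
      (\<forall>b\<in>Basis. (\<lambda>n. LINT x|lebesgue_on \<Omega>.
          (norm (weak_partial \<Omega> u b x - frechet_derivative (\<phi> n) (at x) b))\<^sup>2) \<longlonglongrightarrow> 0)}"


section \<open>The radial functional\<close>

definition h_plus :: "real \<Rightarrow> real" where
  "h_plus t = (3 + sqrt (9 + 8 * t)) / 4"

text \<open>
  The value forced by \<open>bulk t 1 = 0\<close>; that it also makes \<open>bulk t\<close> nonnegative is \<open>bulk_nonneg\<close>.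
\<close>
definition C_const :: "real \<Rightarrow> real" where
  "C_const t = 1 / 2 + h_plus t / t - (h_plus t)\<^sup>2 / (2 * t)"

definition bulk :: "real \<Rightarrow> real \<Rightarrow> real" where
  "bulk t h = - h\<^sup>2 / 2 - h_plus t / t * h ^ 3 + (h_plus t)\<^sup>2 / (2 * t) * h ^ 4 + C_const t"

lemma bulk_one: "bulk t 1 = 0"
  by (simp add: bulk_def C_const_def)

lemma bulk_nonneg:
  assumes "t > 1"
  shows "bulk t h \<ge> 0"
proof -
  define p where "p = h_plus t"
  define a where "a = p / t"
  define b where "b = p\<^sup>2 / (2 * t)"
  have s: "(sqrt (9 + 8 * t))\<^sup>2 = 9 + 8 * t" using assms by simp
  have p2: "2 * p\<^sup>2 = 3 * p + t"
    unfolding p_def h_plus_def using s by (simp add: power2_eq_square field_simps)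
  have "sqrt (9 + 8 * t) \<ge> 1" using assms by simp
  hence p1: "p \<ge> 1" unfolding p_def h_plus_def by simp
  have b4: "4 * b = 3 * a + 1"
    unfolding a_def b_def using p2 assms by (simp add: field_simps)
  have a0: "a \<ge> 0" unfolding a_def using p1 assms by simp
  have "2 * b = a * p" unfolding a_def b_def using assms by (simp add: power2_eq_square)
  hence ab: "a \<le> 2 * b" using a0 p1 mult_left_mono[of 1 p a] by simp
  have b0: "b > 0" using b4 a0 by simp
  have eq: "bulk t h = (h - 1)\<^sup>2 * (b * h\<^sup>2 + (2 * b - a) * h + (b - a / 2))"
  proof -
    have "bulk t h = - h\<^sup>2 / 2 - a * h ^ 3 + b * h ^ 4 + (1 / 2 + a - b)"
      unfolding bulk_def C_const_def a_def b_def p_def by simp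
    also have "\<dots> = - (4 * b - 3 * a) * h\<^sup>2 / 2 - a * h ^ 3 + b * h ^ 4 + ((4 * b - 3 * a) / 2 + a - b)"
      using b4 by simp
    also have "\<dots> = (h - 1)\<^sup>2 * (b * h\<^sup>2 + (2 * b - a) * h + (b - a / 2))"
      by (simp add: field_simps power2_eq_square power3_eq_cube power4_eq_xxxx)
    finally show ?thesis .
  qed
  have "4 * b * (b * h\<^sup>2 + (2 * b - a) * h + (b - a / 2))
      = (2 * b * h + (2 * b - a))\<^sup>2 + a * (2 * b - a)"
    by (simp add: field_simps power2_eq_square)
  also have "\<dots> \<ge> 0" using a0 ab by simp
  finally have "b * h\<^sup>2 + (2 * b - a) * h + (b - a / 2) \<ge> 0"
    using b0 by (simp add: zero_le_mult_iff)
  thus ?thesis unfolding eq by simp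
qed

definition radial_energy :: "real \<Rightarrow> real \<Rightarrow> (real \<Rightarrow> real) \<Rightarrow> real" where
  "radial_energy R t h = (LINT r|lebesgue_on {0<..<R}.
     r\<^sup>2 * (1 / 2 * (weak_partial {0<..<R} h 1 r)\<^sup>2 + 3 * (h r)\<^sup>2 / r\<^sup>2 + bulk t (h r)))"

text \<open>
  Every class in one-dimensional \<open>W12\<close> has a unique continuous representative on the closed
  interval; the elements of the class are these, so that the value at \<open>R\<close> is meaningful.
\<close>
definition radial_class :: "real \<Rightarrow> (real \<Rightarrow> real) set" where
  "radial_class R = {h \<in> W12 {0<..<R}. continuous_on {0..R} h \<and> h R = 1}"


section \<open>The Landau--de Gennes energy\<close>

definition sym_traceless :: "(real^3^3) set" where
  "sym_traceless = {Q. transpose Q = Q \<and> trace Q = 0}"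

text \<open>
  The open ball stands for the closed one: they differ by a null set. On \<open>Q_class\<close> the integrand is
  integrable, by the embedding of \<open>W12\<close> into \<open>L\<^sup>6\<close> in dimension three.
\<close>
definition LdG_energy :: "real \<Rightarrow> real \<Rightarrow> (real^3 \<Rightarrow> real^3^3) \<Rightarrow> real" where
  "LdG_energy R t Q = (LINT x|lebesgue_on (ball 0 R).
       1 / 2 * (\<Sum>i\<in>UNIV. \<Sum>j\<in>UNIV. \<Sum>k\<in>UNIV. (weak_partial (ball 0 R) Q (axis k 1) x $ i $ j)\<^sup>2)
     - 1 / 2 * trace (Q x ** Q x)
     - sqrt 6 * h_plus t / t * trace (Q x ** Q x ** Q x)
     + (h_plus t)\<^sup>2 / (2 * t) * (trace (Q x ** Q x))\<^sup>2
     + C_const t)"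

definition outer :: "real^3 \<Rightarrow> real^3 \<Rightarrow> real^3^3" where
  "outer x y = (\<chi> i j. x $ i * y $ j)"

text \<open>At the origin the value of \<open>hedgehog\<close> is a meaningless artefact of division by zero.\<close>
definition hedgehog :: "(real \<Rightarrow> real) \<Rightarrow> real^3 \<Rightarrow> real^3^3" where
  "hedgehog h x = (sqrt (3 / 2) * h (norm x)) *\<^sub>R
     ((1 / (norm x)\<^sup>2) *\<^sub>R outer x x - (1 / 3) *\<^sub>R mat 1)"

text \<open>
  The Dirichlet condition is imposed in the usual \<open>W12\<close> sense. The boundary datum, given on the
  sphere by \<open>hedgehog (\<lambda>_. 1)\<close>, is extended to the ball by the same formula; this extension is in
  \<open>W12\<close> as its gradient is of order \<open>1 / r\<close>.
\<close>
definition Q_class :: "real \<Rightarrow> (real^3 \<Rightarrow> real^3^3) set" where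
  "Q_class R = {Q \<in> W12 (ball 0 R).
      (AE x in lebesgue_on (ball 0 R). Q x \<in> sym_traceless) \<and>
      (\<lambda>x. Q x - hedgehog (\<lambda>_. 1) x) \<in> W12_0 (ball 0 R)}"

definition z_axis :: "real^3" where
  "z_axis = vector [0, 0, 1]"

definition Q_hat :: "real \<Rightarrow> (real \<Rightarrow> real) \<Rightarrow> real^3 \<Rightarrow> real^3^3" where
  "Q_hat \<sigma> h x = (if norm x \<le> \<sigma>
     then hedgehog h x + (1 / ((norm x)\<^sup>2 + 12)\<^sup>2 * (1 - norm x / \<sigma>)) *\<^sub>R
            (outer z_axis z_axis - (1 / 3) *\<^sub>R mat 1)
     else hedgehog h x)"

end

(*
  Write the perturbed map as Q* + g(r) (z (x) z - I/3). Every contribution that is odd in g, and the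
  gradient cross term, carries the factor (x_3/r)^2 - 1/3, whose mean over spheres is 0. Hence, with
  a = h_+/t and b = h_+^2/(2t), the energy difference is exactly 4 pi times the integral of
    r^2 (g'^2/3 - g^2/3 - (2 sqrt 6/9) a g^3 + b (28/15 h^2 g^2 + 4/9 g^4)),
  and its sign only depends on an upper bound of h^2 on [0,10], where g lives. Comparison with the
  constant 1 gives |h| <= 1; comparison with the supersolution U, U^2 = 1.05 r^4/(r^4 + 6 r^2 + 36),
  which exceeds 1 at r = 12, gives h^2 <= U^2 on [0,12]. U is a supersolution for all t >= 200 at once,
  so R >= 12 and t >= 200 suffice. After inserting the bound, the integrand is smaller than the
  derivative of an explicit rational function that vanishes at 0 and at 10.
*)
theory Submission
  imports Defs
begin

section \<open>Square integrable functions\<close>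

text \<open>The perturbation wins in the core of the defect. As t grows, b tends to 1/4, and the
  coefficient of g^2 tends to - 1/3 + 7/15 h^2: positive where h is close to 1, negative where h is
  small. Since h is not explicit, it must be shown to stay small far enough from the origin. A
  supersolution U supplies the upper bound, minimality entering through comparison with one
  competitor at a time. The shape of U imitates the radial equation: U is of order r^2 at 0, as the
  angular part contributes the factor 6, and U^2 / 1.05 = 1 - 6 / r^2 + ... at infinity is the
  formal expansion of h^2 for a = 0, b = 1/4. The other obstacle is analytic: the hedgehog is
  singular at the origin, and \<open>weak_partial\<close> is given by choice. Profiles are therefore
  approximated by C^1 functions that are cut off near 0. The derivative of the cutoff is bounded by
  4 / r, which is square integrable in dimension three, and tends to 0 pointwise, so dominated
  convergence yields explicit weak derivatives and, for profiles vanishing at R, membership in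
  \<open>W12_0\<close>.\<close>

lemma integrable_mult_L2:
  fixes f g :: "'a \<Rightarrow> real"
  assumes "f \<in> borel_measurable M" "g \<in> borel_measurable M"
    "integrable M (\<lambda>x. (f x)\<^sup>2)" "integrable M (\<lambda>x. (g x)\<^sup>2)"
  shows "integrable M (\<lambda>x. f x * g x)"
proof (rule Bochner_Integration.integrable_bound)
  show "integrable M (\<lambda>x. (f x)\<^sup>2 + (g x)\<^sup>2)" using assms by simp
  have "\<bar>f x * g x\<bar> \<le> (f x)\<^sup>2 + (g x)\<^sup>2" for x
  proof -
    have "0 \<le> \<bar>f x * g x\<bar>" "2 * \<bar>f x * g x\<bar> \<le> (f x)\<^sup>2 + (g x)\<^sup>2"
      using sum_squares_bound[of "\<bar>f x\<bar>" "\<bar>g x\<bar>"] by (simp_all add: abs_mult)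
    then show ?thesis by linarith
  qed
  then show "AE x in M. norm (f x * g x) \<le> norm ((f x)\<^sup>2 + (g x)\<^sup>2)" by simp
qed (use assms in measurable)

text \<open>The integral of the square of \<open>s * f + t * g\<close> is a nonnegative quadratic
  form in \<open>s\<close> and \<open>t\<close>; its discriminant gives the bound.\<close>

lemma Cauchy_Schwarz_integral:
  fixes f g :: "'a \<Rightarrow> real"
  assumes "f \<in> borel_measurable M" "g \<in> borel_measurable M"
    "integrable M (\<lambda>x. (f x)\<^sup>2)" "integrable M (\<lambda>x. (g x)\<^sup>2)"
  shows "\<bar>LINT x|M. f x * g x\<bar> \<le> sqrt (LINT x|M. (f x)\<^sup>2) * sqrt (LINT x|M. (g x)\<^sup>2)"
proof -
  define A B C where "A = (LINT x|M. (f x)\<^sup>2)" and "B = (LINT x|M. (g x)\<^sup>2)"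
    and "C = (LINT x|M. f x * g x)"
  have fg: "integrable M (\<lambda>x. f x * g x)" by (rule integrable_mult_L2[OF assms])
  have nn: "0 \<le> s\<^sup>2 * A + 2 * s * t * C + t\<^sup>2 * B" for s t
  proof -
    have "0 \<le> (LINT x|M. (s * f x + t * g x)\<^sup>2)" by simp
    also have "\<dots> = (LINT x|M. s\<^sup>2 * (f x)\<^sup>2 + 2 * s * t * (f x * g x) + t\<^sup>2 * (g x)\<^sup>2)"
      by (rule Bochner_Integration.integral_cong) (auto simp: power2_eq_square algebra_simps)
    also have "\<dots> = s\<^sup>2 * A + 2 * s * t * C + t\<^sup>2 * B"
      using assms fg by (simp add: A_def B_def C_def)
    finally show ?thesis .
  qed
  have A0: "A \<ge> 0" and B0: "B \<ge> 0" by (simp_all add: A_def B_def)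
  have "C\<^sup>2 \<le> A * B"
  proof (cases "B = 0")
    case True
    show ?thesis
    proof (rule ccontr)
      assume "\<not> ?thesis"
      then have C: "C \<noteq> 0" using True by auto
      \<comment> \<open>For \<open>B = 0\<close> the form is affine in \<open>t\<close>, and this
        choice of \<open>t\<close> gives it the value - 1.\<close>
      have "0 \<le> A + 2 * (- (A + 1) / (2 * C)) * C" using nn[of 1 "- (A + 1) / (2 * C)"] True by simp
      then show False using C by (simp add: field_simps)
    qed
  next
    case False
    then have B: "B > 0" using B0 by simp
    have "0 \<le> B\<^sup>2 * A - 2 * B * C * C + C\<^sup>2 * B" using nn[of B "- C"] by simp
    then have "0 \<le> B * (A * B - C\<^sup>2)" by (simp add: power2_eq_square algebra_simps)
    then show ?thesis using B by (simp add: zero_le_mult_iff)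
  qed
  then have "sqrt (C\<^sup>2) \<le> sqrt (A * B)" by (rule real_sqrt_le_mono)
  then show ?thesis by (simp add: real_sqrt_mult A_def B_def C_def)
qed

lemma borel_measurable_of_L2_on [measurable_dest]:
  "L2_on S u \<Longrightarrow> u \<in> borel_measurable (lebesgue_on S)"
  by (simp add: L2_on_def)

lemma integrable_of_L2_on: "L2_on S u \<Longrightarrow> integrable (lebesgue_on S) (\<lambda>x. (norm (u x))\<^sup>2)"
  by (simp add: L2_on_def)

lemma L2_on_bound:
  fixes u :: "'a::euclidean_space \<Rightarrow> 'b::euclidean_space" and w :: "'a \<Rightarrow> 'c::euclidean_space"
  assumes "u \<in> borel_measurable (lebesgue_on S)" "L2_on S w"
    "AE x in lebesgue_on S. norm (u x) \<le> C * norm (w x)"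
  shows "L2_on S u"
  unfolding L2_on_def
proof
  show "u \<in> borel_measurable (lebesgue_on S)" by fact
  show "integrable (lebesgue_on S) (\<lambda>x. (norm (u x))\<^sup>2)"
  proof (rule Bochner_Integration.integrable_bound)
    show "integrable (lebesgue_on S) (\<lambda>x. C\<^sup>2 * (norm (w x))\<^sup>2)"
      using assms(2) by (simp add: L2_on_def)
    show "AE x in lebesgue_on S. norm ((norm (u x))\<^sup>2) \<le> norm (C\<^sup>2 * (norm (w x))\<^sup>2)"
      using assms(3)
      by eventually_elim (simp add: power_mult_distrib[symmetric] power_mono)
  qed (use assms(1) in measurable)
qed

lemma L2_on_const:
  assumes "S \<in> lmeasurable" shows "L2_on S (\<lambda>x. c)"
  using finite_measure.integrable_const[OF finite_measure_lebesgue_on[OF assms]]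
  by (auto simp: L2_on_def)

lemma L2_on_bounded:
  fixes u :: "'a::euclidean_space \<Rightarrow> 'b::euclidean_space"
  assumes "S \<in> lmeasurable" "u \<in> borel_measurable (lebesgue_on S)"
    "\<And>x. x \<in> S \<Longrightarrow> norm (u x) \<le> C"
  shows "L2_on S u"
proof (rule L2_on_bound[OF assms(2) L2_on_const[OF assms(1), of "1::real"]])
  show "AE x in lebesgue_on S. norm (u x) \<le> C * norm (1::real)"
    using assms(3) by (intro AE_I2) (auto simp: space_restrict_space)
qed

lemma L2_on_add:
  assumes "L2_on S u" "L2_on S v" shows "L2_on S (\<lambda>x. u x + v x)"
  unfolding L2_on_def
proof
  note [measurable] = borel_measurable_of_L2_on[OF assms(1)] borel_measurable_of_L2_on[OF assms(2)]
  show "(\<lambda>x. u x + v x) \<in> borel_measurable (lebesgue_on S)" by measurable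
  show "integrable (lebesgue_on S) (\<lambda>x. (norm (u x + v x))\<^sup>2)"
  proof (rule Bochner_Integration.integrable_bound)
    show "integrable (lebesgue_on S) (\<lambda>x. 2 * (norm (u x))\<^sup>2 + 2 * (norm (v x))\<^sup>2)"
      using assms by (simp add: L2_on_def)
    have "(norm (u x + v x))\<^sup>2 \<le> 2 * (norm (u x))\<^sup>2 + 2 * (norm (v x))\<^sup>2" for x
      using power_mono[OF norm_triangle_ineq[of "u x" "v x"], of 2]
        sum_squares_bound[of "norm (u x)" "norm (v x)"] by (simp add: power2_sum)
    then show "AE x in lebesgue_on S. norm ((norm (u x + v x))\<^sup>2)
        \<le> norm (2 * (norm (u x))\<^sup>2 + 2 * (norm (v x))\<^sup>2)" by simp
  qed measurable
qed

lemma L2_on_scaleR: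
  fixes u :: "'a::euclidean_space \<Rightarrow> 'b::euclidean_space"
  assumes "L2_on S u" shows "L2_on S (\<lambda>x. c *\<^sub>R u x)"
  using borel_measurable_of_L2_on[OF assms]
  by (intro L2_on_bound[OF _ assms, where C="\<bar>c\<bar>"]) auto

lemma L2_on_diff:
  assumes "L2_on S u" "L2_on S v" shows "L2_on S (\<lambda>x. u x - v x)"
  using L2_on_add[OF assms(1) L2_on_scaleR[OF assms(2), of "-1"]] by simp

lemma L2_on_inner:
  fixes u :: "'a::euclidean_space \<Rightarrow> 'b::euclidean_space"
  assumes "L2_on S u" shows "L2_on S (\<lambda>x. u x \<bullet> e)"
  using borel_measurable_of_L2_on[OF assms]
  by (intro L2_on_bound[OF _ assms, where C="norm e"])
    (auto simp: Cauchy_Schwarz_ineq2 mult.commute[of "norm e"])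

lemma integrable_scaleR_L2:
  fixes f :: "'a::euclidean_space \<Rightarrow> real" and u :: "'a::euclidean_space \<Rightarrow> 'b::euclidean_space"
  assumes "L2_on S f" "L2_on S u"
  shows "integrable (lebesgue_on S) (\<lambda>x. f x *\<^sub>R u x)"
proof (rule Bochner_Integration.integrable_bound)
  note [measurable] = borel_measurable_of_L2_on[OF assms(1)] borel_measurable_of_L2_on[OF assms(2)]
  show "integrable (lebesgue_on S) (\<lambda>x. \<bar>f x\<bar> * norm (u x))"
    using assms by (intro integrable_mult_L2) (auto simp: L2_on_def)
  show "(\<lambda>x. f x *\<^sub>R u x) \<in> borel_measurable (lebesgue_on S)" by measurable
qed auto

section \<open>Convergence in mean square\<close>

text \<open>Membership of all functions in \<open>L2_on\<close> is built in: a non-integrable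
  function has Bochner integral 0, so the limit alone would not express convergence.\<close>

definition L2_lim ::
  "'a::euclidean_space set \<Rightarrow> (nat \<Rightarrow> 'a \<Rightarrow> 'b::euclidean_space) \<Rightarrow> ('a \<Rightarrow> 'b) \<Rightarrow> bool" where
  "L2_lim S f u \<longleftrightarrow> (\<forall>n. L2_on S (f n)) \<and> L2_on S u \<and>
     (\<lambda>n. LINT x|lebesgue_on S. (norm (f n x - u x))\<^sup>2) \<longlonglongrightarrow> 0"

lemma L2_limD:
  assumes "L2_lim S f u"
  shows "L2_on S (f n)" "L2_on S u"
    "(\<lambda>n. LINT x|lebesgue_on S. (norm (f n x - u x))\<^sup>2) \<longlonglongrightarrow> 0"
  using assms by (auto simp: L2_lim_def)

lemma L2_lim_add:
  assumes "L2_lim S f u" "L2_lim S g v"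
  shows "L2_lim S (\<lambda>n x. f n x + g n x) (\<lambda>x. u x + v x)"
proof -
  note L = L2_limD[OF assms(1)] L2_limD[OF assms(2)]
  have 1: "L2_on S (\<lambda>x. f n x - u x)" "L2_on S (\<lambda>x. g n x - v x)" for n
    using L by (auto intro: L2_on_diff)
  have 2: "L2_on S (\<lambda>x. (f n x + g n x) - (u x + v x))" for n
    using L by (intro L2_on_diff L2_on_add)
  have "(\<lambda>n. LINT x|lebesgue_on S. (norm ((f n x + g n x) - (u x + v x)))\<^sup>2) \<longlonglongrightarrow> 0"
  proof (rule tendsto_sandwich[OF _ _ tendsto_const])
    show "(\<lambda>n. 2 * (LINT x|lebesgue_on S. (norm (f n x - u x))\<^sup>2) +
        2 * (LINT x|lebesgue_on S. (norm (g n x - v x))\<^sup>2)) \<longlonglongrightarrow> 0"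
      using tendsto_add[OF tendsto_mult_left[OF L(3), of 2] tendsto_mult_left[OF L(6), of 2]] by simp
    have "(LINT x|lebesgue_on S. (norm ((f n x + g n x) - (u x + v x)))\<^sup>2)
        \<le> 2 * (LINT x|lebesgue_on S. (norm (f n x - u x))\<^sup>2) +
        2 * (LINT x|lebesgue_on S. (norm (g n x - v x))\<^sup>2)" for n
    proof -
      have "(norm ((f n x + g n x) - (u x + v x)))\<^sup>2
          \<le> 2 * (norm (f n x - u x))\<^sup>2 + 2 * (norm (g n x - v x))\<^sup>2" for x
        using power_mono[OF norm_triangle_ineq[of "f n x - u x" "g n x - v x"], of 2]
          sum_squares_bound[of "norm (f n x - u x)" "norm (g n x - v x)"]
        by (simp add: power2_sum algebra_simps)
      then have "(LINT x|lebesgue_on S. (norm ((f n x + g n x) - (u x + v x)))\<^sup>2)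
         \<le> (LINT x|lebesgue_on S. 2 * (norm (f n x - u x))\<^sup>2 + 2 * (norm (g n x - v x))\<^sup>2)"
        using 1[THEN integrable_of_L2_on] 2[THEN integrable_of_L2_on] by (intro integral_mono) auto
      then show ?thesis using 1[THEN integrable_of_L2_on] by simp
    qed
    then show "\<forall>\<^sub>F n in sequentially. (LINT x|lebesgue_on S. (norm ((f n x + g n x) - (u x + v x)))\<^sup>2)
        \<le> 2 * (LINT x|lebesgue_on S. (norm (f n x - u x))\<^sup>2) +
        2 * (LINT x|lebesgue_on S. (norm (g n x - v x))\<^sup>2)" by simp
  qed auto
  then show ?thesis using L unfolding L2_lim_def by (auto intro: L2_on_add)
qed

lemma L2_lim_bounded_scaleR:
  fixes f :: "nat \<Rightarrow> 'a::euclidean_space \<Rightarrow> 'b::euclidean_space"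
  assumes f: "L2_lim S f u"
    and c: "\<And>n. c n \<in> borel_measurable (lebesgue_on S)" "\<And>n x. x \<in> S \<Longrightarrow> \<bar>c n x\<bar> \<le> K"
  shows "L2_lim S (\<lambda>n x. c n x *\<^sub>R (f n x - u x)) (\<lambda>x. 0)"
proof -
  note L = L2_limD[OF f]
  have 1: "L2_on S (\<lambda>x. f n x - u x)" for n using L by (intro L2_on_diff)
  have AE: "AE x in lebesgue_on S. norm (c n x *\<^sub>R (f n x - u x)) \<le> K * norm (f n x - u x)" for n
    using c(2) by (intro AE_I2) (auto simp: space_restrict_space mult_right_mono)
  have 2: "L2_on S (\<lambda>x. c n x *\<^sub>R (f n x - u x))" for n
    by (rule L2_on_bound[OF _ 1 AE]) (use c(1) borel_measurable_of_L2_on[OF 1] in measurable)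
  have "(\<lambda>n. LINT x|lebesgue_on S. (norm (c n x *\<^sub>R (f n x - u x)))\<^sup>2) \<longlonglongrightarrow> 0"
  proof (rule tendsto_sandwich[OF _ _ tendsto_const])
    show "(\<lambda>n. K\<^sup>2 * (LINT x|lebesgue_on S. (norm (f n x - u x))\<^sup>2)) \<longlonglongrightarrow> 0"
      using tendsto_mult_left[OF L(3), of "K\<^sup>2"] by simp
    have "(LINT x|lebesgue_on S. (norm (c n x *\<^sub>R (f n x - u x)))\<^sup>2)
       \<le> (LINT x|lebesgue_on S. K\<^sup>2 * (norm (f n x - u x))\<^sup>2)" for n
    proof (rule integral_mono_AE)
      show "AE x in lebesgue_on S. (norm (c n x *\<^sub>R (f n x - u x)))\<^sup>2 \<le> K\<^sup>2 * (norm (f n x - u x))\<^sup>2"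
        using AE[of n] by eventually_elim (metis norm_ge_zero power_mono power_mult_distrib)
    qed (use 1[THEN integrable_of_L2_on] 2[THEN integrable_of_L2_on] in auto)
    then show "\<forall>\<^sub>F n in sequentially. (LINT x|lebesgue_on S. (norm (c n x *\<^sub>R (f n x - u x)))\<^sup>2)
       \<le> K\<^sup>2 * (LINT x|lebesgue_on S. (norm (f n x - u x))\<^sup>2)" by simp
  qed auto
  moreover have "L2_on S (\<lambda>x. 0 :: 'b)" by (simp add: L2_on_def)
  ultimately show ?thesis using 2 by (simp add: L2_lim_def)
qed

lemma L2_lim_dominated:
  fixes f :: "nat \<Rightarrow> 'a::euclidean_space \<Rightarrow> 'b::euclidean_space" and w :: "'a \<Rightarrow> 'c::euclidean_space"
  assumes "\<And>n. f n \<in> borel_measurable (lebesgue_on S)" "u \<in> borel_measurable (lebesgue_on S)"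
    and w: "L2_on S w"
    and lim: "AE x in lebesgue_on S. (\<lambda>n. f n x) \<longlonglongrightarrow> u x"
    and bnd: "\<And>n. AE x in lebesgue_on S. norm (f n x) \<le> norm (w x)"
  shows "L2_lim S f u"
proof -
  have 1: "L2_on S (f n)" for n
    by (rule L2_on_bound[OF assms(1) w, where C=1]) (use bnd in simp)
  have ubnd: "AE x in lebesgue_on S. norm (u x) \<le> norm (w x)"
  proof -
    have "AE x in lebesgue_on S. \<forall>n. norm (f n x) \<le> norm (w x)"
      using bnd by (simp add: AE_all_countable)
    with lim show ?thesis
    proof eventually_elim
      case (elim x)
      then show ?case by (intro LIMSEQ_le_const2[OF tendsto_norm]) auto
    qed
  qed
  have 2: "L2_on S u"
    by (rule L2_on_bound[OF assms(2) w, where C=1]) (use ubnd in simp)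
  have 3: "L2_on S (\<lambda>x. f n x - u x)" for n by (intro L2_on_diff 1 2)
  have "(\<lambda>n. LINT x|lebesgue_on S. (norm (f n x - u x))\<^sup>2) \<longlonglongrightarrow> (LINT x|lebesgue_on S. 0)"
  proof (rule integral_dominated_convergence[where w="\<lambda>x. 4 * (norm (w x))\<^sup>2"])
    show "integrable (lebesgue_on S) (\<lambda>x. 4 * (norm (w x))\<^sup>2)"
      using w by (simp add: L2_on_def)
    show "AE x in lebesgue_on S. (\<lambda>n. (norm (f n x - u x))\<^sup>2) \<longlonglongrightarrow> 0"
      using lim
    proof eventually_elim
      case (elim x)
      show ?case using tendsto_power[OF tendsto_norm[OF tendsto_diff[OF elim tendsto_const[of "u x"]]], of 2]
        by simp
    qed
    show "AE x in lebesgue_on S. norm ((norm (f n x - u x))\<^sup>2) \<le> 4 * (norm (w x))\<^sup>2" for n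
      using bnd[of n] ubnd
    proof eventually_elim
      case (elim x)
      then have "norm (f n x - u x) \<le> 2 * norm (w x)" using norm_triangle_ineq4[of "f n x" "u x"] by simp
      then show ?case using power_mono[of "norm (f n x - u x)" "2 * norm (w x)" 2] by (simp add: power_mult_distrib)
    qed
    show "(\<lambda>x. (norm (f n x - u x))\<^sup>2) \<in> borel_measurable (lebesgue_on S)" for n
      using borel_measurable_of_L2_on[OF 3[of n]] by measurable
  qed simp
  then show ?thesis using 1 2 by (simp add: L2_lim_def)
qed

text \<open>The error splits into \<open>c n\<close> times \<open>f n - u\<close>, small because the
  factors are uniformly bounded, and \<open>c n - d\<close> times \<open>u\<close>, small by
  dominated convergence.\<close>

lemma L2_lim_scaleR:
  fixes f :: "nat \<Rightarrow> 'a::euclidean_space \<Rightarrow> 'b::euclidean_space"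
  assumes f: "L2_lim S f u"
    and c: "\<And>n. c n \<in> borel_measurable (lebesgue_on S)" "\<And>n x. x \<in> S \<Longrightarrow> \<bar>c n x\<bar> \<le> K"
    and d: "d \<in> borel_measurable (lebesgue_on S)"
      "AE x in lebesgue_on S. (\<lambda>n. c n x) \<longlonglongrightarrow> d x"
  shows "L2_lim S (\<lambda>n x. c n x *\<^sub>R f n x) (\<lambda>x. d x *\<^sub>R u x)"
proof -
  note [measurable] = borel_measurable_of_L2_on[OF L2_limD(2)[OF f]] c(1) d(1)
  have "L2_lim S (\<lambda>n x. c n x *\<^sub>R u x) (\<lambda>x. d x *\<^sub>R u x)"
  proof (rule L2_lim_dominated[where w="\<lambda>x. K *\<^sub>R u x"])
    show "L2_on S (\<lambda>x. K *\<^sub>R u x)" by (intro L2_on_scaleR L2_limD(2)[OF f])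
    show "AE x in lebesgue_on S. (\<lambda>n. c n x *\<^sub>R u x) \<longlonglongrightarrow> d x *\<^sub>R u x"
      using d(2) by eventually_elim (intro tendsto_intros)
    show "AE x in lebesgue_on S. norm (c n x *\<^sub>R u x) \<le> norm (K *\<^sub>R u x)" for n
      using c(2)[of _ n] by (intro AE_I2) (fastforce simp: space_restrict_space intro: mult_right_mono)
  qed measurable
  from L2_lim_add[OF L2_lim_bounded_scaleR[where c=c, OF f c] this] show ?thesis
    by (simp add: scaleR_diff_right)
qed

lemma L2_lim_const: "L2_on S u \<Longrightarrow> L2_lim S (\<lambda>n. u) u"
  by (simp add: L2_lim_def)

text \<open>Lets the integral identities that define weak derivatives pass to L2 limits, by
  Cauchy-Schwarz.\<close>

lemma L2_lim_integral_scaleR: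
  fixes f :: "nat \<Rightarrow> 'a::euclidean_space \<Rightarrow> 'b::euclidean_space"
  assumes g: "L2_on S g" and f: "L2_lim S f u"
  shows "(\<lambda>n. LINT x|lebesgue_on S. g x *\<^sub>R f n x) \<longlonglongrightarrow> (LINT x|lebesgue_on S. g x *\<^sub>R u x)"
proof -
  note L = L2_limD[OF f]
  have d: "L2_on S (\<lambda>x. f n x - u x)" for n using L by (intro L2_on_diff)
  have "(\<lambda>n. (LINT x|lebesgue_on S. g x *\<^sub>R f n x) - (LINT x|lebesgue_on S. g x *\<^sub>R u x)) \<longlonglongrightarrow> 0"
  proof (rule tendsto_norm_zero_cancel, rule tendsto_sandwich[OF _ _ tendsto_const])
    show "(\<lambda>n. sqrt (LINT x|lebesgue_on S. (g x)\<^sup>2) *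
        sqrt (LINT x|lebesgue_on S. (norm (f n x - u x))\<^sup>2)) \<longlonglongrightarrow> 0"
      using tendsto_mult_left[OF tendsto_real_sqrt[OF L(3)]] by simp
    have "norm ((LINT x|lebesgue_on S. g x *\<^sub>R f n x) - (LINT x|lebesgue_on S. g x *\<^sub>R u x))
       \<le> sqrt (LINT x|lebesgue_on S. (g x)\<^sup>2) * sqrt (LINT x|lebesgue_on S. (norm (f n x - u x))\<^sup>2)" for n
    proof -
      have "(LINT x|lebesgue_on S. g x *\<^sub>R f n x) - (LINT x|lebesgue_on S. g x *\<^sub>R u x)
          = (LINT x|lebesgue_on S. g x *\<^sub>R (f n x - u x))"
        by (simp add: scaleR_diff_right Bochner_Integration.integral_diff
            integrable_scaleR_L2[OF g L(1)] integrable_scaleR_L2[OF g L(2)])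
      also have "norm \<dots> \<le> (LINT x|lebesgue_on S. norm (g x *\<^sub>R (f n x - u x)))"
        by (rule integral_norm_bound)
      also have "\<dots> = (LINT x|lebesgue_on S. \<bar>g x\<bar> * norm (f n x - u x))" by simp
      also have "\<dots> \<le> \<bar>LINT x|lebesgue_on S. \<bar>g x\<bar> * norm (f n x - u x)\<bar>" by simp
      also have "\<dots> \<le> sqrt (LINT x|lebesgue_on S. \<bar>g x\<bar>\<^sup>2) * sqrt (LINT x|lebesgue_on S. (norm (f n x - u x))\<^sup>2)"
        using g d[of n] by (intro Cauchy_Schwarz_integral) (auto simp: L2_on_def)
      finally show ?thesis by simp
    qed
    then show "\<forall>\<^sub>F n in sequentially. norm ((LINT x|lebesgue_on S. g x *\<^sub>R f n x) - (LINT x|lebesgue_on S. g x *\<^sub>R u x))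
       \<le> sqrt (LINT x|lebesgue_on S. (g x)\<^sup>2) * sqrt (LINT x|lebesgue_on S. (norm (f n x - u x))\<^sup>2)"
      by simp
  qed auto
  then show ?thesis using LIM_zero_iff by blast
qed

section \<open>Continuously differentiable functions\<close>

text \<open>The derivative is an explicit argument, so that closed formulas can be carried along
  instead of the choice operator \<open>frechet_derivative\<close>. Continuity is required along
  basis directions, which matches \<open>C1c\<close>.\<close>

definition C1_deriv :: "('a::euclidean_space \<Rightarrow> 'b::real_normed_vector) \<Rightarrow> ('a \<Rightarrow> 'a \<Rightarrow> 'b) \<Rightarrow> bool" where
  "C1_deriv f D \<longleftrightarrow> (\<forall>x. (f has_derivative D x) (at x)) \<and>
     (\<forall>b\<in>Basis. continuous_on UNIV (\<lambda>x. D x b))"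

lemma C1_derivD:
  assumes "C1_deriv f D"
  shows "(f has_derivative D x) (at x)" "b \<in> Basis \<Longrightarrow> continuous_on UNIV (\<lambda>x. D x b)"
    "continuous_on S f" "frechet_derivative f (at x) = D x"
proof -
  show *: "(f has_derivative D x) (at x)" for x using assms by (simp add: C1_deriv_def)
  show "b \<in> Basis \<Longrightarrow> continuous_on UNIV (\<lambda>x. D x b)" using assms by (simp add: C1_deriv_def)
  show "continuous_on S f" by (rule has_derivative_continuous_on[of S f D]) (rule has_derivative_at_withinI[OF *])
  show "frechet_derivative f (at x) = D x" by (rule frechet_derivative_at[OF *, symmetric])
qed

lemma C1_deriv_const: "C1_deriv (\<lambda>x. c) (\<lambda>x d. 0)"
  by (simp add: C1_deriv_def)

lemma C1_deriv_add:
  assumes "C1_deriv f D" "C1_deriv g E"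
  shows "C1_deriv (\<lambda>x. f x + g x) (\<lambda>x d. D x d + E x d)"
  using assms by (auto simp: C1_deriv_def intro!: derivative_intros continuous_intros)

lemma C1_deriv_scaleR:
  fixes f :: "'a::euclidean_space \<Rightarrow> real"
  assumes "C1_deriv f D" "C1_deriv g E"
  shows "C1_deriv (\<lambda>x. f x *\<^sub>R g x) (\<lambda>x d. f x *\<^sub>R E x d + D x d *\<^sub>R g x)"
  using C1_derivD[OF assms(1)] C1_derivD[OF assms(2)]
  by (auto simp: C1_deriv_def intro!: derivative_intros continuous_intros)

lemma C1_deriv_compose:
  fixes f :: "'a::euclidean_space \<Rightarrow> real" and F :: "real \<Rightarrow> real"
  assumes "\<And>s. (F has_real_derivative F' s) (at s)" "continuous_on UNIV F'" "C1_deriv f D"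
  shows "C1_deriv (\<lambda>x. F (f x)) (\<lambda>x d. F' (f x) * D x d)"
  unfolding C1_deriv_def
proof (intro conjI ballI allI)
  fix x :: 'a
  have "(F has_derivative (*) (F' (f x))) (at (f x))"
    using assms(1) by (simp add: has_field_derivative_def)
  from has_derivative_compose[OF C1_derivD(1)[OF assms(3)] this]
  show "((\<lambda>x. F (f x)) has_derivative (\<lambda>d. F' (f x) * D x d)) (at x)" .
next
  fix b :: 'a assume b: "b \<in> Basis"
  show "continuous_on UNIV (\<lambda>x. F' (f x) * D x b)"
    by (intro continuous_intros C1_derivD[OF assms(3)] b continuous_on_compose2[OF assms(2)]) auto
qed

lemma C1_deriv_real_polynomial:
  fixes p :: "'a::euclidean_space \<Rightarrow> real"
  assumes "real_polynomial_function p"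
  shows "\<exists>D. C1_deriv p D"
  using assms
proof induction
  case (linear f)
  have "C1_deriv f (\<lambda>x. f)"
    unfolding C1_deriv_def using linear by (auto intro: bounded_linear_imp_has_derivative)
  then show ?case by (rule exI[where P="C1_deriv f"])
next
  case (const c) then show ?case using C1_deriv_const by blast
next
  case (add f g) then show ?case using C1_deriv_add by blast
next
  case (mult f g) then show ?case using C1_deriv_scaleR[of f _ g] by auto
qed

lemma C1cI:
  fixes f :: "'a::euclidean_space \<Rightarrow> 'b::real_normed_vector"
  assumes "C1_deriv f D" "compact K" "K \<subseteq> S" "\<And>x. x \<notin> K \<Longrightarrow> f x = 0"
  shows "f \<in> C1c S"
proof -
  have "closure {x. f x \<noteq> 0} \<subseteq> K"
    using assms(2,4) by (intro closure_minimal compact_imp_closed) auto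
  moreover have "compact (closure {x. f x \<noteq> 0})"
    using compact_Int_closed[OF assms(2) closed_closure[of "{x. f x \<noteq> 0}"]] calculation
    by (simp add: inf.absorb2)
  ultimately show ?thesis
    using assms(3) C1_derivD[OF assms(1)] by (auto simp: C1c_def differentiable_def)
qed

lemma C1cE:
  assumes "f \<in> C1c S"
  obtains K where "compact K" "K \<subseteq> S" "\<And>x. x \<notin> K \<Longrightarrow> f x = 0"
    "C1_deriv f (\<lambda>x. frechet_derivative f (at x))"
proof
  show "compact (closure {x. f x \<noteq> 0})" "closure {x. f x \<noteq> 0} \<subseteq> S"
    "C1_deriv f (\<lambda>x. frechet_derivative f (at x))"
    using assms by (auto simp: C1c_def C1_deriv_def frechet_derivative_works)
  show "f x = 0" if "x \<notin> closure {x. f x \<noteq> 0}" for x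
    using that closure_subset[of "{x. f x \<noteq> 0}"] by auto
qed

section \<open>Functions vanishing outside a compact set and integration by parts\<close>

lemma C1_deriv_zero_outside:
  fixes f :: "'a::euclidean_space \<Rightarrow> 'b::real_normed_vector"
  assumes "C1_deriv f D" "compact K" "\<And>x. x \<notin> K \<Longrightarrow> f x = 0" "x \<notin> K"
  shows "D x d = 0"
proof -
  have "(f has_derivative (\<lambda>d. 0)) (at x)"
  proof (rule has_derivative_transform_within_open)
    show "((\<lambda>x. 0) has_derivative (\<lambda>d. 0)) (at x)" by simp
    show "open (- K)" using assms(2) by (simp add: compact_imp_closed open_Compl)
  qed (use assms in auto)
  then show ?thesis using has_derivative_unique[OF C1_derivD(1)[OF assms(1)]] by metis
qed

lemma continuous_zero_outside_compact_bounded: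
  fixes f :: "'a::euclidean_space \<Rightarrow> 'b::real_normed_vector"
  assumes "continuous_on UNIV f" "compact K" "\<And>x. x \<notin> K \<Longrightarrow> f x = 0"
  obtains B where "B \<ge> 0" "\<And>x. norm (f x) \<le> B"
proof -
  have "bounded (f ` K)"
    using assms by (intro compact_imp_bounded compact_continuous_image) (auto intro: continuous_on_subset)
  then obtain B where B: "\<And>x. x \<in> K \<Longrightarrow> norm (f x) \<le> B" by (auto simp: bounded_iff)
  have "norm (f x) \<le> max B 0" for x
    using B[of x] assms(3)[of x] by (cases "x \<in> K") auto
  then show ?thesis using that[of "max B 0"] by auto
qed

lemma continuous_zero_outside_compact_integrable:
  fixes f :: "'a::euclidean_space \<Rightarrow> 'b::euclidean_space"
  assumes "continuous_on UNIV f" "compact K" "\<And>x. x \<notin> K \<Longrightarrow> f x = 0"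
  shows "integrable lborel f"
proof -
  have "integrable lborel (\<lambda>x. indicator K x *\<^sub>R f x)"
    using assms by (intro borel_integrable_compact) (auto intro: continuous_on_subset)
  moreover have "(\<lambda>x. indicator K x *\<^sub>R f x) = f"
    using assms(3) by (auto simp: indicator_def fun_eq_iff)
  ultimately show ?thesis by simp
qed

lemma continuous_imp_measurable_lebesgue_on:
  fixes f :: "'a::euclidean_space \<Rightarrow> 'b::euclidean_space"
  assumes "continuous_on UNIV f"
  shows "f \<in> borel_measurable (lebesgue_on S)"
  by (intro measurable_restrict_space1 measurable_completion)
    (use borel_measurable_continuous_onI[OF assms] in simp)

lemma LINT_lebesgue_on_eq_lborel:
  fixes f :: "'a::euclidean_space \<Rightarrow> 'b::euclidean_space"
  assumes "S \<in> sets lebesgue" "f \<in> borel_measurable borel" "\<And>x. x \<notin> S \<Longrightarrow> f x = 0"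
  shows "(LINT x|lebesgue_on S. f x) = (LINT x|lborel. f x)"
proof -
  have "(\<lambda>x. indicator S x *\<^sub>R f x) = f" using assms(3) by (auto simp: indicator_def fun_eq_iff)
  then have "(LINT x|lebesgue_on S. f x) = (LINT x|lebesgue. f x)"
    using assms(1) by (simp add: integral_restrict_space)
  then show ?thesis using assms(2) by (simp add: integral_completion)
qed

lemma L2_on_C1c:
  fixes f :: "'a::euclidean_space \<Rightarrow> 'b::euclidean_space"
  assumes "f \<in> C1c T" "S \<in> lmeasurable"
  shows "L2_on S f" "b \<in> Basis \<Longrightarrow> L2_on S (\<lambda>x. frechet_derivative f (at x) b)"
proof -
  obtain K where K: "compact K" "\<And>x. x \<notin> K \<Longrightarrow> f x = 0"
    and D: "C1_deriv f (\<lambda>x. frechet_derivative f (at x))" using assms(1) by (elim C1cE) auto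
  have *: "L2_on S g" if "continuous_on UNIV g" "\<And>x. x \<notin> K \<Longrightarrow> g x = 0" for g :: "'a \<Rightarrow> 'b"
    using continuous_zero_outside_compact_bounded[OF that(1) K(1) that(2)]
      L2_on_bounded[OF assms(2) continuous_imp_measurable_lebesgue_on[OF that(1)]] by metis
  show "L2_on S f" using * C1_derivD(3)[OF D] K(2) by auto
  show "L2_on S (\<lambda>x. frechet_derivative f (at x) b)" if "b \<in> Basis"
    using * C1_derivD(2)[OF D that] C1_deriv_zero_outside[OF D K] by auto
qed

text \<open>Difference quotients in direction \<open>b\<close> have integral 0 by translation
  invariance. The mean value inequality bounds them by a constant on one fixed ball outside of which
  they vanish, so dominated convergence transfers the value 0 to the derivative.\<close>

lemma integral_partial_eq_0:
  fixes f :: "'a::euclidean_space \<Rightarrow> 'b::euclidean_space"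
  assumes f: "C1_deriv f D" and K: "compact K" "\<And>x. x \<notin> K \<Longrightarrow> f x = 0" and b: "b \<in> Basis"
  shows "(LINT x|lborel. D x b) = 0"
proof -
  note cf = C1_derivD(3)[OF f, of UNIV] and cD = C1_derivD(2)[OF f b]
  have D0: "D x b = 0" if "x \<notin> K" for x by (rule C1_deriv_zero_outside[OF f K that])
  obtain M where M: "M \<ge> 0" "\<And>x. norm (D x b) \<le> M"
    using continuous_zero_outside_compact_bounded[OF cD K(1) D0] by auto
  have [measurable]: "f \<in> borel_measurable borel" "(\<lambda>x. D x b) \<in> borel_measurable borel"
    using cf cD by (auto intro: borel_measurable_continuous_onI)
  have fi: "integrable lborel f" by (rule continuous_zero_outside_compact_integrable[OF cf K])
  have shift: "integrable lborel (\<lambda>x. f (c + x))" "(LINT x|lborel. f (c + x)) = (LINT x|lborel. f x)" for c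
  proof -
    have "integrable (distr lborel borel ((+) c)) f" using fi by (simp add: lborel_distr_plus)
    then show "integrable lborel (\<lambda>x. f (c + x))" by (subst (asm) integrable_distr_eq) auto
    have "(LINT x|lborel. f x) = (LINT x|distr lborel borel ((+) c). f x)" by (simp add: lborel_distr_plus)
    then show "(LINT x|lborel. f (c + x)) = (LINT x|lborel. f x)" by (subst (asm) integral_distr) auto
  qed
  obtain r where r: "\<And>x. x \<in> K \<Longrightarrow> norm x \<le> r"
    using compact_imp_bounded[OF K(1)] by (auto simp: bounded_iff)
  define h where "h n = inverse (real (Suc n))" for n
  have h: "0 < h n" "h n \<le> 1" for n by (auto simp: h_def field_simps)
  define F where "F n x = (1 / h n) *\<^sub>R (f (h n *\<^sub>R b + x) - f x)" for n x
  have F0: "(LINT x|lborel. F n x) = 0" for n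
    unfolding F_def using shift fi by simp
  have path: "((\<lambda>t. f (t *\<^sub>R b + x)) has_derivative (\<lambda>s. s *\<^sub>R D (t *\<^sub>R b + x) b)) (at t)" for t x
  proof -
    have "((\<lambda>t. t *\<^sub>R b + x) has_derivative (\<lambda>s. s *\<^sub>R b)) (at t)" by (auto intro!: derivative_eq_intros)
    from has_derivative_compose[OF this C1_derivD(1)[OF f]]
    show ?thesis
      using linear_cmul[OF has_derivative_linear[OF C1_derivD(1)[OF f]]] by simp
  qed
  have Fb: "norm (F n x) \<le> M * indicator (cball 0 (r + norm b)) x" for n x
  proof (cases "x \<in> cball 0 (r + norm b)")
    case True
    have "norm (f (h n *\<^sub>R b + x) - f (0 *\<^sub>R b + x)) \<le> M * norm (h n - 0)"
    proof (rule differentiable_bound[of UNIV "\<lambda>t. f (t *\<^sub>R b + x)"])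
      show "onorm (\<lambda>s. s *\<^sub>R D (t *\<^sub>R b + x) b) \<le> M" for t
        using M by (intro onorm_bound) (auto simp: mult.commute[of M] intro!: mult_left_mono)
    qed (use path in auto)
    then have "norm (f (h n *\<^sub>R b + x) - f x) \<le> M * h n" using h[of n] by simp
    then show ?thesis using True h[of n] by (simp add: F_def divide_le_eq del: scaleR_diff_right)
  next
    case False
    then have n: "norm x > r + norm b" by simp
    have "norm x \<le> norm (h n *\<^sub>R b + x) + norm (h n *\<^sub>R b)"
      using norm_triangle_ineq4[of "h n *\<^sub>R b + x" "h n *\<^sub>R b"] by simp
    moreover have "norm (h n *\<^sub>R b) \<le> norm b" using h[of n] by (simp add: mult_left_le_one_le)
    ultimately have "norm (h n *\<^sub>R b + x) > r" using n by linarith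
    then have "f (h n *\<^sub>R b + x) = 0" using r[of "h n *\<^sub>R b + x"] K(2) by fastforce
    moreover have "norm x > r" using n norm_ge_zero[of b] by linarith
    then have "f x = 0" using r[of x] K(2) by fastforce
    ultimately show ?thesis using False by (simp add: F_def)
  qed
  have lim: "(\<lambda>n. F n x) \<longlonglongrightarrow> D x b" for x
  proof -
    have "((\<lambda>t. norm (f (t *\<^sub>R b + x) - f x - t *\<^sub>R D x b) / \<bar>t\<bar>) \<longlongrightarrow> 0) (at 0)"
      using path[of x 0] by (simp add: has_derivative_at)
    moreover have "\<forall>\<^sub>F t in at 0. norm (f (t *\<^sub>R b + x) - f x - t *\<^sub>R D x b) / \<bar>t\<bar>
        = norm ((1 / t) *\<^sub>R (f (t *\<^sub>R b + x) - f x) - D x b)"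
    proof (rule eventually_mono[rotated])
      show "\<forall>\<^sub>F t in at 0. t \<noteq> (0::real)" by (simp add: eventually_at_filter)
      fix t :: real assume t: "t \<noteq> 0"
      have "(1 / t) *\<^sub>R (f (t *\<^sub>R b + x) - f x) - D x b = (1 / t) *\<^sub>R (f (t *\<^sub>R b + x) - f x - t *\<^sub>R D x b)"
        using t by (simp add: scaleR_diff_right)
      then show "norm (f (t *\<^sub>R b + x) - f x - t *\<^sub>R D x b) / \<bar>t\<bar>
        = norm ((1 / t) *\<^sub>R (f (t *\<^sub>R b + x) - f x) - D x b)" by simp
    qed
    ultimately have "((\<lambda>t. norm ((1 / t) *\<^sub>R (f (t *\<^sub>R b + x) - f x) - D x b)) \<longlongrightarrow> 0) (at 0)"
      by (rule Lim_transform_eventually)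
    then have *: "((\<lambda>t. (1 / t) *\<^sub>R (f (t *\<^sub>R b + x) - f x)) \<longlongrightarrow> D x b) (at 0)"
      by (rule LIM_zero_cancel[OF tendsto_norm_zero_cancel])
    have "filterlim h (at 0) sequentially"
      using LIMSEQ_inverse_real_of_nat h unfolding filterlim_at h_def[abs_def]
      by (auto simp: less_le)
    from filterlim_compose[OF * this] show ?thesis by (simp add: F_def)
  qed
  have "(\<lambda>n. LINT x|lborel. F n x) \<longlonglongrightarrow> (LINT x|lborel. D x b)"
  proof (rule integral_dominated_convergence[where w="\<lambda>x. M * indicator (cball 0 (r + norm b)) x"])
    show "integrable lborel (\<lambda>x::'a. M * indicator (cball 0 (r + norm b)) x)"
      using emeasure_lborel_cball_finite[of "0::'a" "r + norm b"]
      by (intro integrable_mult_right integrable_real_indicator) auto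
    show "F n \<in> borel_measurable lborel" for n unfolding F_def by measurable
  qed (use Fb lim in auto)
  then show ?thesis using F0 by (simp add: LIMSEQ_const_iff)
qed

text \<open>The product of \<open>u\<close> with a test function has compact support, so the
  integral of its partial derivative is 0; the product rule splits it into the two sides of the
  identity.\<close>

lemma is_weak_partial_C1:
  fixes u :: "'a::euclidean_space \<Rightarrow> 'b::euclidean_space"
  assumes u: "C1_deriv u D" and b: "b \<in> Basis" and S: "S \<in> sets lebesgue"
  shows "is_weak_partial S u b (\<lambda>x. D x b)"
  unfolding is_weak_partial_def
proof
  fix \<phi> :: "'a \<Rightarrow> real" assume "\<phi> \<in> C1c S"
  then obtain K where K: "compact K" "K \<subseteq> S" "\<And>x. x \<notin> K \<Longrightarrow> \<phi> x = 0"
    and p: "C1_deriv \<phi> (\<lambda>x. frechet_derivative \<phi> (at x))" by (elim C1cE) auto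
  let ?d = "\<lambda>x. frechet_derivative \<phi> (at x) b"
  have d0: "?d x = 0" if "x \<notin> K" for x by (rule C1_deriv_zero_outside[OF p K(1,3) that])
  have c: "continuous_on UNIV \<phi>" "continuous_on UNIV ?d" "continuous_on UNIV u" "continuous_on UNIV (\<lambda>x. D x b)"
    using C1_derivD[OF p] C1_derivD[OF u] b by auto
  have ct: "continuous_on UNIV (\<lambda>x. ?d x *\<^sub>R u x)" "continuous_on UNIV (\<lambda>x. \<phi> x *\<^sub>R D x b)"
    by (intro continuous_intros c)+
  have i: "integrable lborel (\<lambda>x. ?d x *\<^sub>R u x)" "integrable lborel (\<lambda>x. \<phi> x *\<^sub>R D x b)"
    using continuous_zero_outside_compact_integrable[OF ct(1) K(1)]
      continuous_zero_outside_compact_integrable[OF ct(2) K(1)] d0 K(3) by auto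
  have "(LINT x|lborel. \<phi> x *\<^sub>R D x b + ?d x *\<^sub>R u x) = 0"
    by (rule integral_partial_eq_0[OF C1_deriv_scaleR[OF p u] K(1) _ b]) (simp add: K(3))
  then have "(LINT x|lborel. ?d x *\<^sub>R u x) = - (LINT x|lborel. \<phi> x *\<^sub>R D x b)"
    using i by (simp add: add_eq_0_iff)
  moreover have "(LINT x|lebesgue_on S. ?d x *\<^sub>R u x) = (LINT x|lborel. ?d x *\<^sub>R u x)"
    using d0 K(2) ct S by (intro LINT_lebesgue_on_eq_lborel) (auto intro: borel_measurable_continuous_onI)
  moreover have "(LINT x|lebesgue_on S. \<phi> x *\<^sub>R D x b) = (LINT x|lborel. \<phi> x *\<^sub>R D x b)"
    using K(2,3) ct S by (intro LINT_lebesgue_on_eq_lborel) (auto intro: borel_measurable_continuous_onI)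
  ultimately show "(LINT x|lebesgue_on S. ?d x *\<^sub>R u x) = - (LINT x|lebesgue_on S. \<phi> x *\<^sub>R D x b)"
    by simp
qed

section \<open>Density of test functions\<close>

lemma has_real_derivative_max0_square:
  "((\<lambda>s::real. (max 0 s)\<^sup>2) has_real_derivative 2 * max 0 s) (at s)"
proof -
  consider "s > 0" | "s < 0" | "s = 0" by linarith
  then show ?thesis
  proof cases
    case 1
    show ?thesis
    proof (rule has_field_derivative_transform_within_open[where S="{0<..}"])
      show "((\<lambda>s. s\<^sup>2) has_real_derivative 2 * max 0 s) (at s)"
        using 1 by (auto intro!: derivative_eq_intros)
    qed (use 1 in auto)
  next
    case 2
    show ?thesis
    proof (rule has_field_derivative_transform_within_open[where S="{..<0}"])
      show "((\<lambda>s. 0) has_real_derivative 2 * max 0 s) (at s)" using 2 by simp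
    qed (use 2 in auto)
  next
    case 3
    have "((\<lambda>y::real. (max 0 y)\<^sup>2 / y) \<longlongrightarrow> 0) (at 0)"
    proof (rule Lim_null_comparison)
      show "\<forall>\<^sub>F y in at 0. norm ((max 0 y)\<^sup>2 / y) \<le> \<bar>y::real\<bar>"
        by (rule always_eventually) (auto simp: max_def power2_eq_square)
      show "((\<lambda>y::real. \<bar>y\<bar>) \<longlongrightarrow> 0) (at 0)" by (rule tendsto_rabs_zero) (rule tendsto_ident_at)
    qed
    then show ?thesis using 3 by (simp add: has_field_derivative_iff)
  qed
qed

text \<open>A rational C^1 transition: 0 for negative arguments, always below 1, and tending to 1 at
  infinity. Rescaling its argument produces all cutoff functions below, both near the boundary of a
  ball and near the origin.\<close>

definition smooth_step :: "real \<Rightarrow> real" where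
  "smooth_step s = (max 0 s)\<^sup>2 / (1 + (max 0 s)\<^sup>2)"

lemma smooth_step_bounds: "0 \<le> smooth_step s" "smooth_step s \<le> 1" "s \<le> 0 \<Longrightarrow> smooth_step s = 0"
  using add_pos_nonneg[of 1 "(max 0 s)\<^sup>2"] by (simp_all add: smooth_step_def divide_simps)

lemma smooth_step_deriv:
  "(smooth_step has_real_derivative 2 * max 0 s / (1 + (max 0 s)\<^sup>2)\<^sup>2) (at s)"
proof -
  let ?q = "(max 0 s)\<^sup>2"
  have p: "1 + ?q \<noteq> 0" using add_pos_nonneg[of 1 ?q] by simp
  have "((\<lambda>s. 1 + (max 0 s)\<^sup>2) has_real_derivative 0 + 2 * max 0 s) (at s)"
    by (intro DERIV_add DERIV_const has_real_derivative_max0_square)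
  from DERIV_divide[OF has_real_derivative_max0_square this p]
  have "(smooth_step has_real_derivative
      (2 * max 0 s * (1 + ?q) - ?q * (0 + 2 * max 0 s)) / ((1 + ?q) * (1 + ?q))) (at s)"
    by (simp add: smooth_step_def[abs_def])
  moreover have "(2 * max 0 s * (1 + ?q) - ?q * (0 + 2 * max 0 s)) / ((1 + ?q) * (1 + ?q))
      = 2 * max 0 s / (1 + ?q)\<^sup>2"
    by (simp add: algebra_simps power2_eq_square)
  ultimately show ?thesis by simp
qed

lemma smooth_step_deriv_continuous:
  "continuous_on S (\<lambda>s::real. 2 * max 0 s / (1 + (max 0 s)\<^sup>2)\<^sup>2)"
proof -
  have "1 + (max 0 s)\<^sup>2 \<noteq> 0" for s :: real using add_pos_nonneg[of 1 "(max 0 s)\<^sup>2"] by simp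
  then show ?thesis by (intro continuous_intros) auto
qed

lemma smooth_step_tendsto: "(smooth_step \<longlongrightarrow> 1) at_top"
proof (rule Lim_transform_eventually)
  have "((\<lambda>s::real. 1 - 1 / (1 + s\<^sup>2)) \<longlongrightarrow> 1 - 0) at_top"
    by (intro tendsto_intros real_tendsto_divide_at_top filterlim_tendsto_add_at_top filterlim_pow_at_top filterlim_ident) auto
  then show "((\<lambda>s::real. 1 - 1 / (1 + s\<^sup>2)) \<longlongrightarrow> 1) at_top" by simp
  show "\<forall>\<^sub>F s in at_top. 1 - 1 / (1 + s\<^sup>2) = smooth_step s"
    using eventually_ge_at_top[of 0]
  proof eventually_elim
    case (elim s)
    have "1 + s\<^sup>2 \<noteq> 0" using add_pos_nonneg[of 1 "s\<^sup>2"] by simp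
    then show ?case using elim by (simp add: smooth_step_def field_simps)
  qed
qed

lemma ball_cutoff:
  fixes c :: "'a::euclidean_space"
  assumes "\<rho> > 0"
  obtains ch :: "nat \<Rightarrow> 'a \<Rightarrow> real" and K D where "\<And>n. C1_deriv (ch n) (D n)"
    "\<And>n. compact (K n)" "\<And>n. K n \<subseteq> ball c \<rho>" "\<And>n x. x \<notin> K n \<Longrightarrow> ch n x = 0"
    "\<And>n x. 0 \<le> ch n x" "\<And>n x. ch n x \<le> 1" "\<And>x. x \<in> ball c \<rho> \<Longrightarrow> (\<lambda>n. ch n x) \<longlonglongrightarrow> 1"
proof -
  \<comment> \<open>Nonpositive once the squared distance from \<open>c\<close> is at least
    \<open>\<rho>\<^sup>2 - 1 / real (Suc n)\<close>, and tending to infinity with \<open>n\<close>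
    at every point of the open ball.\<close>
  define q where "q n x = real (Suc n) * (\<rho>\<^sup>2 - (x - c) \<bullet> (x - c)) - 1" for n x
  have q: "C1_deriv (q n) (\<lambda>x d. - (real (Suc n) * (2 * ((x - c) \<bullet> d))))" for n
    unfolding C1_deriv_def q_def
    by (auto intro!: derivative_eq_intros continuous_intros simp: fun_eq_iff inner_commute algebra_simps)
  \<comment> \<open>The maximum covers small \<open>n\<close>, for which
    \<open>\<rho>\<^sup>2 - 1 / real (Suc n)\<close> may be negative; then \<open>q n\<close> is
    nonpositive everywhere and \<open>K n\<close> is the single point \<open>c\<close>.\<close>
  define K where "K n = cball c (sqrt (max 0 (\<rho>\<^sup>2 - 1 / real (Suc n))))" for n
  show ?thesis
  proof
    show "C1_deriv (\<lambda>x. smooth_step (q n x)) (\<lambda>x d. 2 * max 0 (q n x) / (1 + (max 0 (q n x))\<^sup>2)\<^sup>2 *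
        - (real (Suc n) * (2 * ((x - c) \<bullet> d))))" for n
      by (rule C1_deriv_compose[OF smooth_step_deriv smooth_step_deriv_continuous q])
    show "compact (K n)" for n by (simp add: K_def)
    show "K n \<subseteq> ball c \<rho>" for n
    proof -
      have "sqrt (max 0 (\<rho>\<^sup>2 - 1 / real (Suc n))) < sqrt (\<rho>\<^sup>2)"
        using assms by (intro real_sqrt_less_mono) auto
      then show ?thesis using assms by (auto simp: K_def)
    qed
    show "smooth_step (q n x) = 0" if "x \<notin> K n" for n x
    proof -
      have "sqrt (max 0 (\<rho>\<^sup>2 - 1 / real (Suc n))) < norm (x - c)"
        using that by (simp add: K_def dist_norm norm_minus_commute)
      then have "max 0 (\<rho>\<^sup>2 - 1 / real (Suc n)) < (norm (x - c))\<^sup>2"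
        by (metis max.cobounded1 norm_ge_zero real_less_rsqrt real_sqrt_ge_zero real_sqrt_less_iff real_sqrt_unique)
      then have "q n x \<le> 0"
        by (simp add: q_def power2_norm_eq_inner[symmetric] field_simps)
      then show ?thesis by (rule smooth_step_bounds)
    qed
    show "0 \<le> smooth_step (q n x)" "smooth_step (q n x) \<le> 1" for n x by (rule smooth_step_bounds)+
    show "(\<lambda>n. smooth_step (q n x)) \<longlonglongrightarrow> 1" if "x \<in> ball c \<rho>" for x
    proof (rule filterlim_compose[OF smooth_step_tendsto])
      have "(norm (x - c))\<^sup>2 < \<rho>\<^sup>2"
        using that assms by (intro power_strict_mono) (auto simp: dist_norm norm_minus_commute)
      then have p: "0 < \<rho>\<^sup>2 - (x - c) \<bullet> (x - c)" by (simp add: power2_norm_eq_inner)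
      have "filterlim (\<lambda>n. real (Suc n)) at_top sequentially"
        using filterlim_compose[OF filterlim_real_sequentially filterlim_Suc] .
      from filterlim_tendsto_pos_mult_at_top[OF tendsto_const p this]
      have "filterlim (\<lambda>n. - 1 + real (Suc n) * (\<rho>\<^sup>2 - (x - c) \<bullet> (x - c))) at_top sequentially"
        by (intro filterlim_tendsto_add_at_top[OF tendsto_const]) (simp add: mult.commute)
      then show "filterlim (\<lambda>n. q n x) at_top sequentially" by (simp add: q_def[abs_def])
    qed
  qed
qed

text \<open>The functions approximable by test functions are closed under L2 limits. The class is
  enlarged step by step: polynomials (multiplied by cutoffs), continuous functions
  (Stone-Weierstrass on the closed ball), truncated measurable functions (almost everywhere limits
  of continuous ones), and finally all of L2 by removing the truncation.\<close>

lemma C1c_dense_L2_ball: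
  fixes w :: "'a::euclidean_space \<Rightarrow> real"
  assumes \<rho>: "\<rho> > 0" and w: "L2_on (ball c \<rho>) w"
  obtains \<phi> where "\<And>n::nat. \<phi> n \<in> C1c (ball c \<rho>)" "L2_lim (ball c \<rho>) \<phi> w"
proof -
  let ?B = "ball c \<rho>"
  have B: "?B \<in> lmeasurable" "?B \<in> sets lebesgue" by auto
  define P where "P u \<longleftrightarrow> L2_on ?B u \<and>
      (\<forall>e>0. \<exists>\<phi>\<in>C1c ?B. (LINT x|lebesgue_on ?B. (norm (\<phi> x - u x))\<^sup>2) < e)" for u :: "'a \<Rightarrow> real"
  have L2C: "L2_on ?B \<phi>" if "\<phi> \<in> C1c ?B" for \<phi> :: "'a \<Rightarrow> real" using L2_on_C1c(1)[OF that B(1)] .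
  have Pc: "P \<phi>" if "\<phi> \<in> C1c ?B" for \<phi>
    unfolding P_def using L2C[OF that] that by (auto intro!: bexI[of _ \<phi>])
  have Plim: "P u" if f: "L2_lim ?B f u" and Pf: "\<And>n. P (f n)" for f u
    unfolding P_def
  proof (intro conjI allI impI)
    show "L2_on ?B u" using L2_limD(2)[OF f] .
    fix e :: real assume e: "e > 0"
    obtain n where n: "(LINT x|lebesgue_on ?B. (norm (f n x - u x))\<^sup>2) < e / 4"
      using order_tendstoD(2)[OF L2_limD(3)[OF f], of "e / 4"] e by (auto simp: eventually_sequentially)
    obtain \<phi> where p: "\<phi> \<in> C1c ?B" "(LINT x|lebesgue_on ?B. (norm (\<phi> x - f n x))\<^sup>2) < e / 4"
      using Pf[of n] e unfolding P_def by (meson divide_pos_pos zero_less_numeral)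
    have i: "integrable (lebesgue_on ?B) (\<lambda>x. (norm (\<phi> x - f n x))\<^sup>2)"
      "integrable (lebesgue_on ?B) (\<lambda>x. (norm (f n x - u x))\<^sup>2)"
      "integrable (lebesgue_on ?B) (\<lambda>x. (norm (\<phi> x - u x))\<^sup>2)"
      by (intro integrable_of_L2_on L2_on_diff L2C[OF p(1)] L2_limD(1,2)[OF f])+
    have "(norm (\<phi> x - u x))\<^sup>2 \<le> 2 * (norm (\<phi> x - f n x))\<^sup>2 + 2 * (norm (f n x - u x))\<^sup>2" for x
    proof -
      have "0 \<le> ((\<phi> x - f n x) - (f n x - u x))\<^sup>2" by simp
      then show ?thesis by (simp add: power2_eq_square algebra_simps)
    qed
    then have "(LINT x|lebesgue_on ?B. (norm (\<phi> x - u x))\<^sup>2) \<le>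
      (LINT x|lebesgue_on ?B. 2 * (norm (\<phi> x - f n x))\<^sup>2 + 2 * (norm (f n x - u x))\<^sup>2)"
      using i by (intro integral_mono) auto
    also have "\<dots> < e" using i n p(2) by simp
    finally show "\<exists>\<phi>\<in>C1c ?B. (LINT x|lebesgue_on ?B. (norm (\<phi> x - u x))\<^sup>2) < e" using p(1) by blast
  qed
  have Ppoly: "P p" if p: "real_polynomial_function p" for p
  proof -
    obtain D where D: "C1_deriv p D" using C1_deriv_real_polynomial[OF p] ..
    obtain ch :: "nat \<Rightarrow> 'a \<Rightarrow> real" and K E where chi: "\<And>n. C1_deriv (ch n) (E n)"
      "\<And>n. compact (K n)" "\<And>n. K n \<subseteq> ?B" "\<And>n x. x \<notin> K n \<Longrightarrow> ch n x = 0"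
      "\<And>n x. 0 \<le> ch n x" "\<And>n x. ch n x \<le> 1" "\<And>x. x \<in> ?B \<Longrightarrow> (\<lambda>n. ch n x) \<longlonglongrightarrow> 1"
      by (rule ball_cutoff[OF \<rho>, of c]) (rule that)
    have "bounded (p ` cball c \<rho>)"
      by (intro compact_imp_bounded compact_continuous_image C1_derivD(3)[OF D]) simp
    then obtain M where M: "\<And>x. x \<in> cball c \<rho> \<Longrightarrow> \<bar>p x\<bar> \<le> M"
      unfolding bounded_iff by (metis imageI real_norm_def)
    have L: "L2_on ?B p"
      using M by (intro L2_on_bounded[OF B(1), where C=M] continuous_imp_measurable_lebesgue_on C1_derivD(3)[OF D]) auto
    have "L2_lim ?B (\<lambda>n x. ch n x *\<^sub>R p x) (\<lambda>x. 1 *\<^sub>R p x)"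
    proof (rule L2_lim_scaleR[OF L2_lim_const[OF L], where K=1])
      show "ch n \<in> borel_measurable (lebesgue_on ?B)" for n
        by (intro continuous_imp_measurable_lebesgue_on C1_derivD(3)[OF chi(1)])
      show "\<bar>ch n x\<bar> \<le> 1" for n x using chi(5,6) by simp
      show "AE x in lebesgue_on ?B. (\<lambda>n. ch n x) \<longlonglongrightarrow> 1"
        using chi(7) by (intro AE_I2) (auto simp: space_restrict_space)
    qed auto
    moreover have "P (\<lambda>x. ch n x *\<^sub>R p x)" for n
      by (intro Pc C1cI[OF C1_deriv_scaleR[OF chi(1) D] chi(2)[of n] chi(3)[of n]]) (simp add: chi(4))
    ultimately show ?thesis using Plim[of "\<lambda>n x. ch n x *\<^sub>R p x" p] by simp
  qed
  have Pcont: "P g" if g: "continuous_on UNIV g" for g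
  proof -
    have "\<forall>n. \<exists>p. real_polynomial_function p \<and> (\<forall>x\<in>cball c \<rho>. \<bar>g x - p x\<bar> < inverse (real (Suc n)))"
      using Stone_Weierstrass_polynomial_function[of "cball c \<rho>" g] continuous_on_subset[OF g]
      by (auto simp: real_polynomial_function_eq)
    then obtain p where p: "\<And>n. real_polynomial_function (p n)"
      "\<And>n x. x \<in> cball c \<rho> \<Longrightarrow> \<bar>g x - p n x\<bar> < inverse (real (Suc n))" by metis
    have "bounded (g ` cball c \<rho>)"
      by (intro compact_imp_bounded compact_continuous_image continuous_on_subset[OF g]) auto
    then obtain M where M: "\<And>x. x \<in> cball c \<rho> \<Longrightarrow> \<bar>g x\<bar> \<le> M"
      unfolding bounded_iff by (metis imageI real_norm_def)
    have "L2_lim ?B p g"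
    proof (rule L2_lim_dominated[where w="\<lambda>x. M + 1"])
      show "p n \<in> borel_measurable (lebesgue_on ?B)" for n
        using C1_deriv_real_polynomial[OF p(1)[of n]] C1_derivD(3) continuous_imp_measurable_lebesgue_on by blast
      show "g \<in> borel_measurable (lebesgue_on ?B)" by (rule continuous_imp_measurable_lebesgue_on[OF g])
      show "L2_on ?B (\<lambda>x. M + 1)" by (rule L2_on_const[OF B(1)])
      show "AE x in lebesgue_on ?B. (\<lambda>n. p n x) \<longlonglongrightarrow> g x"
      proof (intro AE_I2)
        fix x assume "x \<in> space (lebesgue_on ?B)"
        then have x: "x \<in> cball c \<rho>" by (simp add: space_restrict_space)
        have "(\<lambda>n. p n x - g x) \<longlonglongrightarrow> 0"
        proof (rule Lim_null_comparison[OF _ LIMSEQ_inverse_real_of_nat])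
          show "\<forall>\<^sub>F n in sequentially. norm (p n x - g x) \<le> inverse (real (Suc n))"
            using p(2)[OF x] by (intro always_eventually allI) (simp add: abs_minus_commute less_imp_le)
        qed
        then show "(\<lambda>n. p n x) \<longlonglongrightarrow> g x" using LIM_zero_iff by blast
      qed
      show "AE x in lebesgue_on ?B. norm (p n x) \<le> norm (M + 1)" for n
      proof (intro AE_I2)
        fix x assume "x \<in> space (lebesgue_on ?B)"
        then have x: "x \<in> cball c \<rho>" by (simp add: space_restrict_space)
        have "inverse (real (Suc n)) \<le> 1" by (simp add: field_simps)
        then show "norm (p n x) \<le> norm (M + 1)" using p(2)[OF x, of n] M[OF x] by simp
      qed
    qed
    then show ?thesis using Plim Ppoly p(1) by blast
  qed
  \<comment> \<open>Truncation supplies a constant majorant for the almost everywhere convergent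
    continuous approximants, which come without any bound.\<close>
  define T where "T n s = max (- real n) (min (real n) s)" for n s
  have wm: "w \<in> borel_measurable (lebesgue_on ?B)" by (rule borel_measurable_of_L2_on[OF w])
  have PT: "P (\<lambda>x. T n (w x))" for n
  proof -
    have "w measurable_on ?B" using measurable_on_iff_borel_measurable[OF B(2)] wm by blast
    then obtain N g where N: "negligible N" and g: "\<And>k::nat. continuous_on UNIV (g k)"
      "\<And>x. x \<notin> N \<Longrightarrow> (\<lambda>k. g k x) \<longlonglongrightarrow> (if x \<in> ?B then w x else 0)"
      unfolding measurable_on_def by blast
    have cT: "continuous_on UNIV (T n)" unfolding T_def by (intro continuous_intros)
    have cTg: "continuous_on UNIV (\<lambda>x. T n (g k x))" for k
      by (rule continuous_on_compose2[OF cT g(1)]) auto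
    have "L2_lim ?B (\<lambda>k x. T n (g k x)) (\<lambda>x. T n (w x))"
    proof (rule L2_lim_dominated[where w="\<lambda>x. real n"])
      show "(\<lambda>x. T n (g k x)) \<in> borel_measurable (lebesgue_on ?B)" for k
        by (rule continuous_imp_measurable_lebesgue_on[OF cTg])
      show "(\<lambda>x. T n (w x)) \<in> borel_measurable (lebesgue_on ?B)" unfolding T_def using wm by measurable
      show "L2_on ?B (\<lambda>x. real n)" by (rule L2_on_const[OF B(1)])
      have "AE x in lebesgue. x \<notin> N" using N by (simp add: negligible_iff_null_sets AE_not_in)
      then have "AE x in lebesgue_on ?B. x \<notin> N \<and> x \<in> ?B"
        by (subst AE_restrict_space_iff) auto
      then show "AE x in lebesgue_on ?B. (\<lambda>k. T n (g k x)) \<longlonglongrightarrow> T n (w x)"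
      proof eventually_elim
        case (elim x)
        then have "(\<lambda>k. g k x) \<longlonglongrightarrow> w x" using g(2)[of x] by simp
        then show ?case unfolding T_def by (intro tendsto_intros)
      qed
    qed (auto simp: T_def)
    then show ?thesis using Plim Pcont cTg by blast
  qed
  have "L2_lim ?B (\<lambda>n x. T n (w x)) w"
  proof (rule L2_lim_dominated[OF _ wm w])
    show "(\<lambda>x. T n (w x)) \<in> borel_measurable (lebesgue_on ?B)" for n unfolding T_def using wm by measurable
    have "(\<lambda>n. T n (w x)) \<longlonglongrightarrow> w x" for x
    proof (rule tendsto_eventually)
      obtain m where "\<bar>w x\<bar> \<le> real m" using real_arch_simple by blast
      then show "\<forall>\<^sub>F n in sequentially. T n (w x) = w x"
        unfolding eventually_sequentially by (intro exI[of _ m]) (auto simp: T_def max_def min_def)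
    qed
    then show "AE x in lebesgue_on ?B. (\<lambda>n. T n (w x)) \<longlonglongrightarrow> w x" by simp
    show "AE x in lebesgue_on ?B. norm (T n (w x)) \<le> norm (w x)" for n
      by (intro AE_I2) (auto simp: T_def max_def min_def)
  qed
  then have Pw: "P w" using Plim PT by blast
  then have "\<forall>n. \<exists>\<phi>\<in>C1c ?B. (LINT x|lebesgue_on ?B. (norm (\<phi> x - w x))\<^sup>2) < inverse (real (Suc n))"
    unfolding P_def by (metis inverse_positive_iff_positive of_nat_0_less_iff zero_less_Suc)
  then obtain \<phi> where p: "\<And>n. \<phi> n \<in> C1c ?B"
    "\<And>n. (LINT x|lebesgue_on ?B. (norm (\<phi> n x - w x))\<^sup>2) < inverse (real (Suc n))" by metis
  have "(\<lambda>n. LINT x|lebesgue_on ?B. (norm (\<phi> n x - w x))\<^sup>2) \<longlonglongrightarrow> 0"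
    by (rule tendsto_sandwich[OF _ _ tendsto_const LIMSEQ_inverse_real_of_nat])
      (use p(2) in \<open>auto intro!: always_eventually less_imp_le\<close>)
  then have "L2_lim ?B \<phi> w" unfolding L2_lim_def using w L2C p(1) by blast
  then show ?thesis using that p(1) by blast
qed

section \<open>Uniqueness and closedness of weak derivatives\<close>

text \<open>Each component of \<open>w\<close> is an L2 limit of test functions. Testing with these
  and passing to the limit gives that the square of the component has integral 0.\<close>

lemma AE_eq_0_of_test_integrals:
  fixes w :: "'a::euclidean_space \<Rightarrow> 'b::euclidean_space"
  assumes \<rho>: "\<rho> > 0" and w: "L2_on (ball c \<rho>) w"
    and z: "\<And>\<phi>. \<phi> \<in> C1c (ball c \<rho>) \<Longrightarrow> (LINT x|lebesgue_on (ball c \<rho>). \<phi> x *\<^sub>R w x) = 0"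
  shows "AE x in lebesgue_on (ball c \<rho>). w x = 0"
proof -
  let ?B = "ball c \<rho>"
  have "AE x in lebesgue_on ?B. w x \<bullet> e = 0" if e: "e \<in> Basis" for e
  proof -
    have we: "L2_on ?B (\<lambda>x. w x \<bullet> e)" by (rule L2_on_inner[OF w])
    obtain \<phi> where p: "\<And>n::nat. \<phi> n \<in> C1c ?B" "L2_lim ?B \<phi> (\<lambda>x. w x \<bullet> e)"
      using C1c_dense_L2_ball[OF \<rho> we] by metis
    have "(LINT x|lebesgue_on ?B. (w x \<bullet> e) *\<^sub>R \<phi> n x) = 0" for n
    proof -
      have "(LINT x|lebesgue_on ?B. (w x \<bullet> e) *\<^sub>R \<phi> n x) = (LINT x|lebesgue_on ?B. (\<phi> n x *\<^sub>R w x) \<bullet> e)"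
        by (intro Bochner_Integration.integral_cong) auto
      also have "\<dots> = (LINT x|lebesgue_on ?B. \<phi> n x *\<^sub>R w x) \<bullet> e"
        by (intro Bochner_Integration.integral_inner_left integrable_scaleR_L2 w L2_limD(1)[OF p(2)])
      finally show ?thesis using z[OF p(1)] by simp
    qed
    then have "(LINT x|lebesgue_on ?B. (w x \<bullet> e) *\<^sub>R (w x \<bullet> e)) = 0"
      using L2_lim_integral_scaleR[OF we p(2)] by (simp add: LIMSEQ_const_iff)
    moreover have "integrable (lebesgue_on ?B) (\<lambda>x. (w x \<bullet> e) *\<^sub>R (w x \<bullet> e))"
      by (rule integrable_scaleR_L2[OF we we])
    ultimately have "AE x in lebesgue_on ?B. (w x \<bullet> e) *\<^sub>R (w x \<bullet> e) = 0"
      by (subst (asm) integral_nonneg_eq_0_iff_AE) auto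
    then show ?thesis by simp
  qed
  then have "AE x in lebesgue_on ?B. \<forall>e\<in>Basis. w x \<bullet> e = 0"
    by (intro AE_finite_allI) auto
  then show ?thesis by eventually_elim (simp add: euclidean_all_zero_iff)
qed

lemma is_weak_partial_unique:
  fixes v v' :: "'a::euclidean_space \<Rightarrow> 'b::euclidean_space"
  assumes "\<rho> > 0" "L2_on (ball c \<rho>) v" "L2_on (ball c \<rho>) v'"
    "is_weak_partial (ball c \<rho>) u b v" "is_weak_partial (ball c \<rho>) u b v'"
  shows "AE x in lebesgue_on (ball c \<rho>). v x = v' x"
proof -
  have "AE x in lebesgue_on (ball c \<rho>). v x - v' x = 0"
  proof (rule AE_eq_0_of_test_integrals[OF assms(1)])
    show "L2_on (ball c \<rho>) (\<lambda>x. v x - v' x)" by (intro L2_on_diff assms)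
    fix \<phi> :: "'a \<Rightarrow> real" assume p: "\<phi> \<in> C1c (ball c \<rho>)"
    have "L2_on (ball c \<rho>) \<phi>" using L2_on_C1c(1)[OF p] by simp
    from integrable_scaleR_L2[OF this assms(2)] integrable_scaleR_L2[OF this assms(3)]
    show "(LINT x|lebesgue_on (ball c \<rho>). \<phi> x *\<^sub>R (v x - v' x)) = 0"
      using assms(4,5)[unfolded is_weak_partial_def, rule_format, OF p]
      by (simp add: scaleR_diff_right)
  qed
  then show ?thesis by simp
qed

text \<open>For a fixed test function both sides of the defining identity are continuous in L2. This
  is the source of the explicit weak derivatives of absolutely continuous and of singular functions
  below.\<close>

lemma is_weak_partial_L2_lim:
  fixes u :: "'a::euclidean_space \<Rightarrow> 'b::euclidean_space"
  assumes "S \<in> lmeasurable" "L2_lim S f u" "L2_lim S g v" "b \<in> Basis"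
    "\<And>n. is_weak_partial S (f n) b (g n)"
  shows "is_weak_partial S u b v"
  unfolding is_weak_partial_def
proof
  fix \<phi> :: "'a \<Rightarrow> real" assume p: "\<phi> \<in> C1c S"
  note L = L2_on_C1c[OF p assms(1)]
  have "(\<lambda>n. LINT x|lebesgue_on S. frechet_derivative \<phi> (at x) b *\<^sub>R f n x)
      \<longlonglongrightarrow> (LINT x|lebesgue_on S. frechet_derivative \<phi> (at x) b *\<^sub>R u x)"
    by (rule L2_lim_integral_scaleR[OF L(2)[OF assms(4)] assms(2)])
  moreover have "(\<lambda>n. - (LINT x|lebesgue_on S. \<phi> x *\<^sub>R g n x)) \<longlonglongrightarrow> - (LINT x|lebesgue_on S. \<phi> x *\<^sub>R v x)"
    by (intro tendsto_minus L2_lim_integral_scaleR[OF L(1) assms(3)])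
  ultimately show "(LINT x|lebesgue_on S. frechet_derivative \<phi> (at x) b *\<^sub>R u x)
      = - (LINT x|lebesgue_on S. \<phi> x *\<^sub>R v x)"
    using assms(5)[unfolded is_weak_partial_def, rule_format, OF p] LIMSEQ_unique by simp
qed

lemma W12_weak_partial:
  assumes "u \<in> W12 S" "b \<in> Basis"
  shows "L2_on S (weak_partial S u b)" "is_weak_partial S u b (weak_partial S u b)"
proof -
  have "\<exists>v. L2_on S v \<and> is_weak_partial S u b v" using assms by (auto simp: W12_def)
  then have "L2_on S (weak_partial S u b) \<and> is_weak_partial S u b (weak_partial S u b)"
    unfolding weak_partial_def by (rule someI_ex)
  then show "L2_on S (weak_partial S u b)" "is_weak_partial S u b (weak_partial S u b)" by auto
qed

lemma weak_partial_AE_eq: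
  assumes "\<rho> > 0" "L2_on (ball c \<rho>) v" "is_weak_partial (ball c \<rho>) u b v"
  shows "AE x in lebesgue_on (ball c \<rho>). weak_partial (ball c \<rho>) u b x = v x"
proof -
  have "\<exists>v. L2_on (ball c \<rho>) v \<and> is_weak_partial (ball c \<rho>) u b v" using assms by auto
  then have "L2_on (ball c \<rho>) (weak_partial (ball c \<rho>) u b) \<and>
      is_weak_partial (ball c \<rho>) u b (weak_partial (ball c \<rho>) u b)"
    unfolding weak_partial_def by (rule someI_ex)
  then show ?thesis using is_weak_partial_unique[OF assms(1)] assms(2,3) by blast
qed

section \<open>Sobolev functions on an interval\<close>

text \<open>Absolute continuity with square integrable derivative, anchored at \<open>R\<close>
  because the boundary value is prescribed there. Borel measurability of \<open>v\<close>, rather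
  than Lebesgue measurability, makes \<open>v (norm x)\<close> measurable by plain
  composition.\<close>

definition ac_on :: "real \<Rightarrow> (real \<Rightarrow> real) \<Rightarrow> (real \<Rightarrow> real) \<Rightarrow> bool" where
  "ac_on R h v \<longleftrightarrow> v \<in> borel_measurable borel \<and> L2_on {0<..<R} v \<and>
     (\<forall>r\<in>{0..R}. h r = h R - integral {r..R} v)"

lemma ac_onD:
  assumes "ac_on R h v"
  shows "v \<in> borel_measurable borel" "L2_on {0<..<R} v"
    "0 \<le> r \<Longrightarrow> r \<le> R \<Longrightarrow> h r = h R - integral {r..R} v"
proof -
  show "v \<in> borel_measurable borel" "L2_on {0<..<R} v" using assms unfolding ac_on_def by blast+
  have "\<forall>r\<in>{0..R}. h r = h R - integral {r..R} v" using assms unfolding ac_on_def by blast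
  then show "0 \<le> r \<Longrightarrow> r \<le> R \<Longrightarrow> h r = h R - integral {r..R} v"
    by (meson atLeastAtMost_iff)
qed

lemma borel_measurable_lebesgue_onI:
  "f \<in> borel_measurable borel \<Longrightarrow> f \<in> borel_measurable (lebesgue_on S)"
  by (intro measurable_restrict_space1 measurable_completion) simp

lemma interval_eq_ball: "{0<..<R} = ball (R / 2) (R / 2)" for R :: real
  by (auto simp: dist_real_def abs_less_iff field_simps)

lemma L2_on_one: "S \<in> lmeasurable \<Longrightarrow> L2_on S (\<lambda>x. 1 :: real)"
  by (rule L2_on_const)

lemma L2_on_imp_integrable:
  fixes v :: "'a::euclidean_space \<Rightarrow> 'b::euclidean_space"
  assumes "L2_on S v" "S \<in> lmeasurable"
  shows "integrable (lebesgue_on S) v"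
  using integrable_scaleR_L2[OF L2_on_one[OF assms(2)] assms(1)] by simp

lemma L2_interval_integrable_on:
  fixes v :: "real \<Rightarrow> real"
  assumes "L2_on {0<..<R} v" "0 \<le> a" "b \<le> R"
  shows "v integrable_on {a..b}"
proof -
  have "integrable (lebesgue_on {0<..<R}) v" by (rule L2_on_imp_integrable[OF assms(1)]) auto
  then have "v integrable_on {0<..<R}" by (rule integrable_on_lebesgue_on) auto
  then have "v integrable_on {0..R}" by (simp add: integrable_on_open_interval_real)
  then show ?thesis by (rule integrable_subinterval_real) (use assms in auto)
qed

text \<open>Turns L2 convergence of derivatives into uniform convergence of the primitives anchored
  at \<open>R\<close>.\<close>

lemma L2_interval_integral_bound:
  fixes v :: "real \<Rightarrow> real"
  assumes v: "L2_on {0<..<R} v" and r: "0 \<le> r" "r \<le> R"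
  shows "\<bar>integral {r..R} v\<bar> \<le> sqrt R * sqrt (LINT x|lebesgue_on {0<..<R}. (norm (v x))\<^sup>2)"
proof -
  have one: "L2_on {0<..<R} (\<lambda>x. 1 :: real)" by (rule L2_on_const) auto
  have a: "L2_on {0<..<R} (\<lambda>x. \<bar>v x\<bar>)"
    using borel_measurable_of_L2_on[OF v] by (intro L2_on_bound[OF _ v, where C=1]) auto
  note io = L2_interval_integrable_on[OF v] L2_interval_integrable_on[OF a]
  have "\<bar>integral {r..R} v\<bar> \<le> integral {r..R} (\<lambda>x. \<bar>v x\<bar>)"
    using integral_norm_bound_integral[of v "{r..R}" "\<lambda>x. \<bar>v x\<bar>"] io r by simp
  also have "\<dots> \<le> integral {0..R} (\<lambda>x. \<bar>v x\<bar>)"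
    using io r by (intro integral_subset_le) auto
  also have "\<dots> = (LINT x|lebesgue_on {0<..<R}. 1 * \<bar>v x\<bar>)"
    using lebesgue_integral_eq_integral[OF L2_on_imp_integrable[OF a]]
    by (simp add: integral_open_interval_real)
  also have "\<dots> \<le> sqrt (LINT x|lebesgue_on {0<..<R}. 1\<^sup>2) * sqrt (LINT x|lebesgue_on {0<..<R}. \<bar>v x\<bar>\<^sup>2)"
    using one a by (intro order_trans[OF abs_ge_self Cauchy_Schwarz_integral]) (auto simp: L2_on_def)
  also have "(LINT x|lebesgue_on {0<..<R}. 1\<^sup>2) = R" using r by (simp add: measure_restrict_space)
  finally show ?thesis by simp
qed

text \<open>The primitive of a test function is constant near both ends of the interval. This
  provides approximants that are constant near \<open>R\<close>, and a compactly supported primitive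
  whenever the total integral is 0.\<close>

lemma test_function_primitive:
  fixes w :: "real \<Rightarrow> real"
  assumes "w \<in> C1c {0<..<R}" and R: "R > 0"
  obtains W \<delta>1 \<delta>2 where "\<And>r. (W has_real_derivative w r) (at r)" "0 < \<delta>1" "\<delta>1 < \<delta>2" "\<delta>2 < R"
    "\<And>r. r \<le> \<delta>1 \<Longrightarrow> W r = 0" "\<And>r. r \<ge> \<delta>2 \<Longrightarrow> W r = W R"
    "W R = (LINT x|lebesgue_on {0<..<R}. w x)" "continuous_on UNIV w"
proof -
  obtain K where K: "compact K" "K \<subseteq> {0<..<R}" "\<And>x. x \<notin> K \<Longrightarrow> w x = 0"
    and D: "C1_deriv w (\<lambda>x. frechet_derivative w (at x))" using assms by (elim C1cE) auto
  have cw: "continuous_on S w" for S by (rule C1_derivD(3)[OF D])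
  obtain a b where ab: "0 < a" "a < b" "b < R" "K \<subseteq> {a..b}"
  proof (cases "K = {}")
    case True
    show ?thesis using that[of "R / 3" "R / 2"] R True by auto
  next
    case False
    obtain m M where m: "m \<in> K" "\<And>x. x \<in> K \<Longrightarrow> m \<le> x" and M: "M \<in> K" "\<And>x. x \<in> K \<Longrightarrow> x \<le> M"
      using compact_attains_inf[OF K(1) False] compact_attains_sup[OF K(1) False] by blast
    show ?thesis
    proof (rule that[of "m / 2" "(M + R) / 2"])
      show "K \<subseteq> {m / 2..(M + R) / 2}"
      proof
        fix x assume "x \<in> K"
        then have "m \<le> x" "x \<le> M" "0 < x" "x < R" "0 < m" "M < R" using m M K(2) by auto
        then show "x \<in> {m / 2..(M + R) / 2}" by auto
      qed
    qed (use m(1) M(1) m(2)[OF M(1)] K(2) in auto)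
  qed
  have w0: "w x = 0" if "x < a \<or> b < x" for x using K(3)[of x] ab(4) that by (cases "x \<in> K") auto
  define W where "W x = integral {0..x} w" for x
  have W0: "W x = 0" if "x \<le> a" for x
  proof -
    have "integral {0..x} w = integral {0..x} (\<lambda>x. 0)"
    proof (rule integral_spike[of "{a}"])
      fix y assume "y \<in> {0..x} - {a}"
      then show "0 = w y" using w0[of y] that by auto
    qed auto
    then show ?thesis by (simp add: W_def)
  qed
  have der: "(W has_real_derivative w r) (at r)" for r
  proof (cases "r < a")
    case True
    have "(W has_real_derivative 0) (at r)"
      by (rule has_field_derivative_transform_within_open[where S="{..<a}" and f="\<lambda>_. 0"])
        (use True W0 in auto)
    then show ?thesis using w0[of r] True by simp
  next
    case False
    have "((\<lambda>u. integral {0..u} w) has_vector_derivative w r) (at r within {0..r + 1})"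
      by (rule integral_has_vector_derivative[OF cw]) (use False ab in auto)
    then have "(W has_vector_derivative w r) (at r within {0<..<r + 1})"
      unfolding W_def by (rule has_vector_derivative_within_subset) auto
    then have "(W has_vector_derivative w r) (at r)"
      by (subst (asm) at_within_open) (use False ab in auto)
    then show ?thesis by (simp add: has_real_derivative_iff_has_vector_derivative)
  qed
  have Wb: "W r = W R" if "r \<ge> b" for r
  proof -
    have "\<exists>c. \<forall>x\<in>{b..}. W x = c"
    proof (rule has_field_derivative_zero_constant)
      show "(W has_field_derivative 0) (at x within {b..})" if "x \<in> {b..}" for x
      proof -
        have "w x = 0"
        proof (cases "x = b")
          case False then show ?thesis using w0[of x] that by auto
        next
          case True
          \<comment> \<open>The support only forces \<open>w\<close> to vanish strictly beyond
            \<open>b\<close>; the value at \<open>b\<close> itself follows by continuity from the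
            right.\<close>
          have "w b = 0"
          proof (rule tendsto_unique)
            show "(w \<longlongrightarrow> w b) (at_right b)"
              using cw[of UNIV] by (simp add: continuous_on_def tendsto_within_subset[OF _ subset_UNIV])
            show "(w \<longlongrightarrow> 0) (at_right b)"
              by (rule tendsto_eventually) (auto simp: eventually_at_right_less w0 intro: eventually_mono[OF eventually_at_right_less])
          qed simp
          then show ?thesis using True by simp
        qed
        then show ?thesis using der[of x] by (auto intro: has_field_derivative_at_within)
      qed
    qed simp
    then show ?thesis using that ab by (metis atLeast_iff less_imp_le)
  qed
  have "L2_on {0<..<R} w" using L2_on_C1c(1)[OF assms(1)] by auto
  then have "W R = (LINT x|lebesgue_on {0<..<R}. w x)"
    using lebesgue_integral_eq_integral[OF L2_on_imp_integrable, of "{0<..<R}" w]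
    by (simp add: W_def integral_open_interval_real)
  then show ?thesis using that[OF der ab(1-3) W0 Wb] cw by blast
qed

lemma C1c_real_derivative:
  fixes W :: "real \<Rightarrow> real"
  assumes "\<And>r. (W has_real_derivative w r) (at r)"
  shows "frechet_derivative W (at x) 1 = w x"
  using assms[of x] frechet_derivative_at[of W "(*) (w x)" x]
  by (metis has_field_derivative_def mult.right_neutral)

lemma C1_deriv_realI:
  fixes W :: "real \<Rightarrow> real"
  assumes "\<And>r. (W has_real_derivative w r) (at r)" "continuous_on UNIV w"
  shows "C1_deriv W (\<lambda>r d. w r * d)"
  using assms unfolding C1_deriv_def has_field_derivative_def by auto

text \<open>Test functions approximating \<open>v\<close> are integrated back from \<open>R\<close>.
  Their compact support makes \<open>p n\<close> equal to \<open>h R\<close> near \<open>R\<close>;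
  for \<open>h R = 0\<close> this yields compactly supported approximants.\<close>

lemma ac_on_approx:
  assumes R: "R > 0" and h: "ac_on R h v"
  obtains p w :: "nat \<Rightarrow> real \<Rightarrow> real" and e :: "nat \<Rightarrow> real" and \<delta> :: "nat \<Rightarrow> real" where
    "\<And>n r. (p n has_real_derivative w n r) (at r)" "\<And>n. continuous_on UNIV (w n)"
    "L2_lim {0<..<R} w v" "e \<longlonglongrightarrow> 0" "\<And>n r. r \<in> {0..R} \<Longrightarrow> \<bar>p n r - h r\<bar> \<le> e n"
    "\<And>n. \<delta> n < R" "\<And>n r. \<delta> n \<le> r \<Longrightarrow> p n r = h R" "\<And>n r. r \<le> 0 \<Longrightarrow> p n r = p n 0"
proof -
  have v: "L2_on {0<..<R} v" and hv: "\<And>r. r \<in> {0..R} \<Longrightarrow> h r = h R - integral {r..R} v"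
    using h unfolding ac_on_def by blast+
  obtain w where w: "\<And>n::nat. w n \<in> C1c {0<..<R}" "L2_lim {0<..<R} w v"
    using C1c_dense_L2_ball[of "R / 2" "R / 2" v] R v unfolding interval_eq_ball by auto
  have "\<forall>n. \<exists>W a b. (\<forall>r. (W has_real_derivative w n r) (at r)) \<and> 0 < a \<and> b < R \<and>
      (\<forall>r\<ge>b. W r = W R) \<and> (\<forall>r\<le>a. W r = 0) \<and> continuous_on UNIV (w n)"
    using test_function_primitive[OF w(1) R] by metis
  then obtain W a b where W: "\<And>n r. (W n has_real_derivative w n r) (at r)" "\<And>n. 0 < a n" "\<And>n. b n < R"
    "\<And>n r. r \<ge> b n \<Longrightarrow> W n r = W n R" "\<And>n r. r \<le> a n \<Longrightarrow> W n r = 0" "\<And>n. continuous_on UNIV (w n)"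
    by metis
  define e where "e n = sqrt R * sqrt (LINT x|lebesgue_on {0<..<R}. (norm (w n x - v x))\<^sup>2)" for n
  show ?thesis
  proof (rule that[of "\<lambda>n r. h R - (W n R - W n r)" w e b])
    show "((\<lambda>r. h R - (W n R - W n r)) has_real_derivative w n r) (at r)" for n r
      by (auto intro!: derivative_eq_intros W(1))
    show "e \<longlonglongrightarrow> 0"
      unfolding e_def using tendsto_mult_left[OF tendsto_real_sqrt[OF L2_limD(3)[OF w(2)]], of "sqrt R"] by simp
    show "\<bar>h R - (W n R - W n r) - h r\<bar> \<le> e n" if r: "r \<in> {0..R}" for n r
    proof -
      have "(w n has_integral (W n R - W n r)) {r..R}"
        by (rule fundamental_theorem_of_calculus)
          (use r W(1) in \<open>auto simp: has_real_derivative_iff_has_vector_derivative[symmetric] intro: has_field_derivative_at_within\<close>)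
      then have "W n R - W n r = integral {r..R} (w n)" by (simp add: integral_unique)
      then have "h R - (W n R - W n r) - h r = - integral {r..R} (\<lambda>x. w n x - v x)"
        using hv[OF r] L2_interval_integrable_on[OF L2_limD(1)[OF w(2)]] L2_interval_integrable_on[OF v] r
        by (simp add: Henstock_Kurzweil_Integration.integral_diff)
      then show ?thesis
        using L2_interval_integral_bound[OF L2_on_diff[OF L2_limD(1)[OF w(2)] v]] r by (simp add: e_def)
    qed
    show "h R - (W n R - W n r) = h R" if "b n \<le> r" for n r using W(4)[OF that] by simp
    show "h R - (W n R - W n r) = h R - (W n R - W n 0)" if "r \<le> 0" for n r
      using W(5)[of r n] W(5)[of 0 n] W(2)[of n] that by simp
  qed (use W w in auto)
qed

lemma ac_on_continuous:
  assumes "R > 0" "ac_on R h v" shows "continuous_on {0..R} h"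
proof -
  obtain p w :: "nat \<Rightarrow> real \<Rightarrow> real" and e \<delta> :: "nat \<Rightarrow> real" where
    pw: "\<And>n r. (p n has_real_derivative w n r) (at r)" "\<And>n. continuous_on UNIV (w n)"
    "L2_lim {0<..<R} w v" "e \<longlonglongrightarrow> 0" "\<And>n r. r \<in> {0..R} \<Longrightarrow> \<bar>p n r - h r\<bar> \<le> e n"
    "\<And>n. \<delta> n < R" "\<And>n r. \<delta> n \<le> r \<Longrightarrow> p n r = h R" "\<And>n r. r \<le> 0 \<Longrightarrow> p n r = p n 0"
    by (rule ac_on_approx[OF assms]) (rule that)
  have "uniform_limit {0..R} p h sequentially"
  proof (rule uniform_limitI)
    fix \<epsilon> :: real assume "\<epsilon> > 0"
    then have "\<forall>\<^sub>F n in sequentially. e n < \<epsilon>" using pw(4) by (auto dest: order_tendstoD(2))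
    then show "\<forall>\<^sub>F n in sequentially. \<forall>r\<in>{0..R}. dist (p n r) (h r) < \<epsilon>"
      by eventually_elim (auto simp: dist_real_def intro: le_less_trans[OF pw(5)])
  qed
  moreover have "continuous_on {0..R} (p n)" for n
    using pw(1) by (intro DERIV_continuous_on) (auto intro: has_field_derivative_at_within)
  ultimately show ?thesis by (intro uniform_limit_theorem[of _ p]) auto
qed

lemma measurable_of_continuous_closed_interval:
  fixes h :: "real \<Rightarrow> real"
  assumes "continuous_on {0..R} h" shows "h \<in> borel_measurable (lebesgue_on {0<..<R})"
  by (rule continuous_imp_measurable_on_sets_lebesgue) (use assms in \<open>auto intro: continuous_on_subset\<close>)

lemma L2_on_continuous_closed_interval:
  fixes h :: "real \<Rightarrow> real"
  assumes "continuous_on {0..R} h" shows "L2_on {0<..<R} h"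
proof -
  have "bounded (h ` {0..R})" using assms by (intro compact_imp_bounded compact_continuous_image) auto
  then obtain M where "\<And>r. r \<in> {0..R} \<Longrightarrow> norm (h r) \<le> M" unfolding bounded_iff by (metis imageI)
  then show ?thesis
    by (intro L2_on_bounded[where C=M] measurable_of_continuous_closed_interval assms) auto
qed

lemma L2_lim_uniform:
  fixes h :: "real \<Rightarrow> real"
  assumes "continuous_on {0..R} h" "\<And>n. continuous_on {0..R} (p n)" "e \<longlonglongrightarrow> 0"
    "\<And>n r. r \<in> {0..R} \<Longrightarrow> \<bar>p n r - h r\<bar> \<le> e n"
  shows "L2_lim {0<..<R} p h"
proof (cases "R > 0")
  case True
  then have e0: "e n \<ge> 0" for n using order_trans[OF abs_ge_zero assms(4)[of 0 n]] by simp
  have L: "L2_on {0<..<R} (p n)" "L2_on {0<..<R} h" for n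
    using assms by (auto intro: L2_on_continuous_closed_interval)
  have "(\<lambda>n. LINT x|lebesgue_on {0<..<R}. (norm (p n x - h x))\<^sup>2) \<longlonglongrightarrow> 0"
  proof (rule tendsto_sandwich[OF _ _ tendsto_const])
    show "(\<lambda>n. (e n)\<^sup>2 * R) \<longlonglongrightarrow> 0"
      using tendsto_mult_right[OF tendsto_power[OF assms(3), of 2], of R] by simp
    have "(LINT x|lebesgue_on {0<..<R}. (norm (p n x - h x))\<^sup>2) \<le> (LINT x|lebesgue_on {0<..<R}. (e n)\<^sup>2)" for n
    proof (rule integral_mono)
      show "integrable (lebesgue_on {0<..<R}) (\<lambda>x. (norm (p n x - h x))\<^sup>2)"
        using L by (intro integrable_of_L2_on L2_on_diff)
      show "integrable (lebesgue_on {0<..<R}) (\<lambda>x. (e n)\<^sup>2)"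
        by (intro finite_measure.integrable_const finite_measure_lebesgue_on) auto
      show "(norm (p n x - h x))\<^sup>2 \<le> (e n)\<^sup>2" if "x \<in> space (lebesgue_on {0<..<R})" for x
        using assms(4)[of x n] that by (intro power_mono) auto
    qed
    also have "(LINT x|lebesgue_on {0<..<R}. (e n)\<^sup>2) = (e n)\<^sup>2 * R" for n
      using True by (simp add: measure_restrict_space)
    finally show "\<forall>\<^sub>F n in sequentially. (LINT x|lebesgue_on {0<..<R}. (norm (p n x - h x))\<^sup>2) \<le> (e n)\<^sup>2 * R"
      by simp
  qed auto
  then show ?thesis using L by (auto simp: L2_lim_def)
next
  case False
  then have "space (lebesgue_on {0<..<R}) = {}" by simp
  then have "(LINT x|lebesgue_on {0<..<R}. (norm (p n x - h x))\<^sup>2) = 0" for n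
    by (simp add: Bochner_Integration.integral_empty)
  then show ?thesis using assms by (auto simp: L2_lim_def intro: L2_on_continuous_closed_interval)
qed

section \<open>Sobolev functions in one dimension as absolutely continuous functions\<close>

lemma ac_on_weak_partial:
  assumes R: "R > 0" and h: "ac_on R h v"
  shows "is_weak_partial {0<..<R} h 1 v" "h \<in> W12 {0<..<R}"
proof -
  obtain p w :: "nat \<Rightarrow> real \<Rightarrow> real" and e \<delta> :: "nat \<Rightarrow> real" where
    pw: "\<And>n r. (p n has_real_derivative w n r) (at r)" "\<And>n. continuous_on UNIV (w n)"
    "L2_lim {0<..<R} w v" "e \<longlonglongrightarrow> 0" "\<And>n r. r \<in> {0..R} \<Longrightarrow> \<bar>p n r - h r\<bar> \<le> e n"
    "\<And>n. \<delta> n < R" "\<And>n r. \<delta> n \<le> r \<Longrightarrow> p n r = h R" "\<And>n r. r \<le> 0 \<Longrightarrow> p n r = p n 0"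
    by (rule ac_on_approx[OF assms]) (rule that)
  have c: "continuous_on {0..R} h" by (rule ac_on_continuous[OF assms])
  note C1 = C1_deriv_realI[OF pw(1,2)]
  have "L2_lim {0<..<R} p h"
    by (rule L2_lim_uniform[OF c _ pw(4,5)]) (use C1_derivD(3)[OF C1] in auto)
  moreover have "is_weak_partial {0<..<R} (p n) 1 (w n)" for n
    using is_weak_partial_C1[OF C1[of n], of 1 "{0<..<R}"] by simp
  ultimately show wp: "is_weak_partial {0<..<R} h 1 v"
    by (intro is_weak_partial_L2_lim[OF _ _ pw(3)]) auto
  show "h \<in> W12 {0<..<R}"
    unfolding W12_def using wp ac_onD(2)[OF h] L2_on_continuous_closed_interval[OF c] by auto
qed

text \<open>The argument of du Bois-Reymond: subtracting from a test function a multiple of a fixed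
  test function of nonzero integral gives integral 0, so the primitive of the difference is a test
  function and can be inserted into the hypothesis.\<close>

lemma weak_partial_zero_imp_constant:
  fixes k :: "real \<Rightarrow> real"
  assumes R: "R > 0" and c: "continuous_on {0..R} k"
    and z: "is_weak_partial {0<..<R} k 1 (\<lambda>_. 0)"
  shows "\<forall>r\<in>{0..R}. k r = k R"
proof -
  let ?I = "{0<..<R}"
  have I: "?I \<in> lmeasurable" by auto
  have Lk: "L2_on ?I k" by (rule L2_on_continuous_closed_interval[OF c])
  have LC: "L2_on ?I \<phi>" if "\<phi> \<in> C1c ?I" for \<phi> :: "real \<Rightarrow> real" using L2_on_C1c(1)[OF that I] .
  obtain \<eta>0 :: "real \<Rightarrow> real" where e0: "\<eta>0 \<in> C1c ?I" "(LINT x|lebesgue_on ?I. \<eta>0 x) \<noteq> 0"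
  proof -
    \<comment> \<open>A test function with nonzero integral: approximants of the constant 1 have
      integrals tending to \<open>R > 0\<close>.\<close>
    obtain \<phi> where p: "\<And>n::nat. \<phi> n \<in> C1c ?I" "L2_lim ?I \<phi> (\<lambda>_. 1::real)"
      using C1c_dense_L2_ball[of "R / 2" "R / 2" "\<lambda>_. 1"] R L2_on_one[OF I] unfolding interval_eq_ball by auto
    have "(\<lambda>n. LINT x|lebesgue_on ?I. \<phi> n x) \<longlonglongrightarrow> R"
      using L2_lim_integral_scaleR[OF L2_on_one[OF I] p(2)] R by (simp add: measure_restrict_space)
    then have "\<forall>\<^sub>F n in sequentially. (LINT x|lebesgue_on ?I. \<phi> n x) > 0"
      using R by (rule order_tendstoD)
    then obtain n where "(LINT x|lebesgue_on ?I. \<phi> n x) > 0" by (auto simp: eventually_sequentially)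
    then show ?thesis using that[of "\<phi> n"] p(1) by simp
  qed
  define m where "m = (LINT x|lebesgue_on ?I. \<eta>0 x)"
  define cc where "cc = (LINT x|lebesgue_on ?I. \<eta>0 x * k x) / m"
  have "AE x in lebesgue_on ?I. k x - cc = 0"
    unfolding interval_eq_ball
  proof (rule AE_eq_0_of_test_integrals, unfold interval_eq_ball[symmetric])
    show "L2_on ?I (\<lambda>x. k x - cc)" by (intro L2_on_diff Lk L2_on_const I)
    fix w :: "real \<Rightarrow> real" assume w: "w \<in> C1c ?I"
    \<comment> \<open>The factor for which \<open>\<psi>\<close> has integral 0, so that its
      primitive \<open>\<Psi>\<close> vanishes again near \<open>R\<close>.\<close>
    define s where "s = (LINT x|lebesgue_on ?I. w x) / m"
    define \<psi> where "\<psi> x = w x - s * \<eta>0 x" for x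
    obtain W a b where W: "\<And>r. (W has_real_derivative w r) (at r)" "0 < a" "a < b" "b < R"
      "\<And>r. r \<le> a \<Longrightarrow> W r = 0" "\<And>r. r \<ge> b \<Longrightarrow> W r = W R" "W R = (LINT x|lebesgue_on ?I. w x)"
      "continuous_on UNIV w"
      by (rule test_function_primitive[OF w R]) blast
    obtain E a' b' where E: "\<And>r. (E has_real_derivative \<eta>0 r) (at r)" "0 < a'" "a' < b'" "b' < R"
      "\<And>r. r \<le> a' \<Longrightarrow> E r = 0" "\<And>r. r \<ge> b' \<Longrightarrow> E r = E R" "E R = (LINT x|lebesgue_on ?I. \<eta>0 x)"
      "continuous_on UNIV \<eta>0"
      by (rule test_function_primitive[OF e0(1) R]) blast
    define \<Psi> where "\<Psi> r = W r - s * E r" for r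
    have der: "(\<Psi> has_real_derivative \<psi> r) (at r)" for r
      unfolding \<Psi>_def \<psi>_def by (auto intro!: derivative_eq_intros W(1) E(1))
    have C1: "C1_deriv \<Psi> (\<lambda>r d. \<psi> r * d)"
      by (rule C1_deriv_realI[OF der]) (auto simp: \<psi>_def intro!: continuous_intros W E)
    have "\<Psi> \<in> C1c ?I"
    proof (rule C1cI[OF C1])
      show "compact {min a a'..max b b'}" "{min a a'..max b b'} \<subseteq> ?I" using W E by auto
      show "\<Psi> x = 0" if "x \<notin> {min a a'..max b b'}" for x
      proof (cases "x < min a a'")
        case True then show ?thesis using W(5) E(5) by (simp add: \<Psi>_def)
      next
        case False
        then have "x \<ge> b" "x \<ge> b'" using that by auto
        then have "\<Psi> x = W R - s * E R" using W(6) E(6) by (simp add: \<Psi>_def)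
        also have "\<dots> = 0" using W(7) E(7) e0(2) by (simp add: s_def m_def)
        finally show ?thesis .
      qed
    qed
    from z[unfolded is_weak_partial_def, rule_format, OF this]
    have "(LINT x|lebesgue_on ?I. \<psi> x * k x) = 0" by (simp add: C1c_real_derivative[OF der])
    moreover have i: "integrable (lebesgue_on ?I) (\<lambda>x. w x * k x)" "integrable (lebesgue_on ?I) (\<lambda>x. \<eta>0 x * k x)"
      "integrable (lebesgue_on ?I) w"
      using integrable_scaleR_L2[OF LC[OF w] Lk] integrable_scaleR_L2[OF LC[OF e0(1)] Lk]
        L2_on_imp_integrable[OF LC[OF w] I] by auto
    ultimately have "(LINT x|lebesgue_on ?I. w x * k x) = s * (LINT x|lebesgue_on ?I. \<eta>0 x * k x)"
      by (simp add: \<psi>_def left_diff_distrib mult.assoc)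
    also have "\<dots> = cc * (LINT x|lebesgue_on ?I. w x)" by (simp add: s_def cc_def)
    finally show "(LINT x|lebesgue_on ?I. w x *\<^sub>R (k x - cc)) = 0"
      using i by (simp add: right_diff_distrib mult.commute)
  qed (use R in auto)
  then have ae: "AE x in lebesgue_on ?I. k x = cc" by simp
  \<comment> \<open>By continuity, the set where \<open>k\<close> differs from \<open>cc\<close> is
    open; being negligible, it is empty.\<close>
  have in0: "k x = cc" if x: "x \<in> ?I" for x
  proof (rule ccontr)
    assume ne: "k x \<noteq> cc"
    have "continuous_on ?I k" using c by (rule continuous_on_subset) auto
    then have op: "open (?I \<inter> k -` (- {cc}))" by (intro continuous_open_preimage) auto
    have "AE y in lebesgue. y \<in> ?I \<longrightarrow> k y = cc"
      using ae by (subst (asm) AE_restrict_space_iff) auto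
    then have "AE y in lebesgue. y \<notin> ?I \<inter> k -` (- {cc})" by eventually_elim auto
    then have "negligible (?I \<inter> k -` (- {cc}))"
      using op by (subst negligible_iff_null_sets, subst AE_iff_null_sets) auto
    then have "?I \<inter> k -` (- {cc}) = {}" using op open_not_negligible by blast
    then show False using x ne by auto
  qed
  have "k r = cc" if "r \<in> {0..R}" for r
    using continuous_constant_on_closure[of ?I k cc r] c in0 R that by (simp add: closure_greaterThanLessThan)
  then show ?thesis using R by simp
qed

text \<open>Let \<open>H\<close> be the primitive, with the value of \<open>h\<close> at
  \<open>R\<close>, of a Borel version of the weak derivative. Then \<open>h - H\<close> has weak
  derivative 0, hence is constant, and it vanishes at \<open>R\<close>.\<close>

lemma W12_imp_ac_on:
  assumes R: "R > 0" and h: "h \<in> W12 {0<..<R}" "continuous_on {0..R} h"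
  obtains v where "ac_on R h v"
proof -
  let ?I = "{0<..<R}"
  define w where "w = weak_partial ?I h 1"
  have w: "L2_on ?I w" "is_weak_partial ?I h 1 w"
    using W12_weak_partial[OF h(1), of 1] by (auto simp: w_def)
  have "(\<lambda>x. if x \<in> ?I then w x else 0) \<in> borel_measurable lebesgue"
    using borel_measurable_of_L2_on[OF w(1)] by (subst borel_measurable_if) auto
  then obtain v where v: "v \<in> borel_measurable lborel" "AE x in lborel. (if x \<in> ?I then w x else 0) = v x"
    using completion_ex_borel_measurable_real by blast
  have ae: "AE x in lebesgue_on ?I. w x = v x"
    using AE_completion[OF v(2)] by (subst AE_restrict_space_iff) (auto elim: eventually_mono)
  have vm: "v \<in> borel_measurable borel" "v \<in> borel_measurable (lebesgue_on ?I)"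
    using v(1) by (auto intro!: measurable_restrict_space1 measurable_completion)
  have vL: "L2_on ?I v"
    by (rule L2_on_bound[OF vm(2) w(1), where C=1]) (use ae in auto)
  define H where "H r = h R - integral {r..R} v" for r
  have "ac_on R H v" using vm vL unfolding ac_on_def by (simp add: H_def)
  note H = ac_on_weak_partial(1)[OF R this] ac_on_continuous[OF R this]
  have k: "is_weak_partial ?I (\<lambda>r. h r - H r) 1 (\<lambda>_. 0)"
    unfolding is_weak_partial_def
  proof
    fix \<phi> :: "real \<Rightarrow> real" assume p: "\<phi> \<in> C1c ?I"
    have L: "L2_on ?I (\<lambda>x. frechet_derivative \<phi> (at x) 1)" "L2_on ?I \<phi>"
      using L2_on_C1c[OF p, of ?I] by auto
    have "(LINT x|lebesgue_on ?I. \<phi> x *\<^sub>R w x) = (LINT x|lebesgue_on ?I. \<phi> x *\<^sub>R v x)"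
      using ae borel_measurable_of_L2_on[OF L(2)] borel_measurable_of_L2_on[OF w(1)] vm(2)
      by (intro integral_cong_AE) auto
    then have "(LINT x|lebesgue_on ?I. frechet_derivative \<phi> (at x) 1 *\<^sub>R h x)
        = (LINT x|lebesgue_on ?I. frechet_derivative \<phi> (at x) 1 *\<^sub>R H x)"
      using w(2) H(1) p by (simp add: is_weak_partial_def)
    moreover have "integrable (lebesgue_on ?I) (\<lambda>x. frechet_derivative \<phi> (at x) 1 *\<^sub>R h x)"
      "integrable (lebesgue_on ?I) (\<lambda>x. frechet_derivative \<phi> (at x) 1 *\<^sub>R H x)"
      by (intro integrable_scaleR_L2 L L2_on_continuous_closed_interval h H(2))+
    ultimately show "(LINT x|lebesgue_on ?I. frechet_derivative \<phi> (at x) 1 *\<^sub>R (h x - H x))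
        = - (LINT x|lebesgue_on ?I. \<phi> x *\<^sub>R 0)"
      by (simp add: scaleR_diff_right right_diff_distrib)
  qed
  have "\<forall>r\<in>{0..R}. h r - H r = h R - H R"
    by (rule weak_partial_zero_imp_constant[OF R _ k]) (intro continuous_intros h H(2))
  moreover have "H R = h R" by (simp add: H_def)
  ultimately have "\<forall>r\<in>{0..R}. h r = H r" by simp
  then have "\<forall>r\<in>{0..R}. h r = h R - integral {r..R} v" unfolding H_def .
  then have "ac_on R h v" using vm vL unfolding ac_on_def by blast
  then show ?thesis by (rule that)
qed

text \<open>The fundamental theorem of calculus for \<open>P\<close> times the square of
  \<open>h\<close>, obtained from the C^1 approximants of \<open>h\<close>. It supplies the
  boundary-term identity in the Picone argument and, for \<open>h = 1\<close>, integrates an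
  explicit primitive.\<close>

lemma ac_on_by_parts:
  assumes R: "R > 0" and h: "ac_on R h v" and ab: "0 \<le> a" "a \<le> b" "b \<le> R"
    and P: "\<And>r. (P has_real_derivative P' r) (at r)" "continuous_on UNIV P'"
  shows "integrable (lebesgue_on {0<..<R}) (\<lambda>r. indicator {a..b} r * (2 * P r * h r * v r + P' r * (h r)\<^sup>2))"
    "(LINT r|lebesgue_on {0<..<R}. indicator {a..b} r * (2 * P r * h r * v r + P' r * (h r)\<^sup>2))
      = P b * (h b)\<^sup>2 - P a * (h a)\<^sup>2"
proof -
  let ?I = "{0<..<R}"
  have I: "?I \<in> lmeasurable" by auto
  obtain p w :: "nat \<Rightarrow> real \<Rightarrow> real" and e \<delta> :: "nat \<Rightarrow> real" where
    pw: "\<And>n r. (p n has_real_derivative w n r) (at r)" "\<And>n. continuous_on UNIV (w n)"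
    "L2_lim {0<..<R} w v" "e \<longlonglongrightarrow> 0" "\<And>n r. r \<in> {0..R} \<Longrightarrow> \<bar>p n r - h r\<bar> \<le> e n"
    "\<And>n. \<delta> n < R" "\<And>n r. \<delta> n \<le> r \<Longrightarrow> p n r = h R" "\<And>n r. r \<le> 0 \<Longrightarrow> p n r = p n 0"
    by (rule ac_on_approx[OF R h]) (rule that)
  have ch: "continuous_on {0..R} h" by (rule ac_on_continuous[OF R h])
  have cp: "continuous_on S (p n)" for n S by (rule C1_derivD(3)[OF C1_deriv_realI[OF pw(1,2)]])
  have cP: "continuous_on S P" "continuous_on S P'" for S
    using C1_derivD(3)[OF C1_deriv_realI[OF P]] P(2) by (auto intro: continuous_on_subset)
  have lim: "(\<lambda>n. p n r) \<longlonglongrightarrow> h r" if "r \<in> {0..R}" for r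
    using Lim_null_comparison[OF _ pw(4), of "\<lambda>n. p n r - h r"] pw(5)[OF that] LIM_zero_iff by auto
  have "bounded (h ` {0..R})" "bounded (P ` {0..R})" "bounded (P' ` {0..R})"
    using ch cP by (auto intro!: compact_imp_bounded compact_continuous_image)
  then obtain Mh MP MP' where M: "\<And>r. r \<in> {0..R} \<Longrightarrow> \<bar>h r\<bar> \<le> Mh" "\<And>r. r \<in> {0..R} \<Longrightarrow> \<bar>P r\<bar> \<le> MP"
    "\<And>r. r \<in> {0..R} \<Longrightarrow> \<bar>P' r\<bar> \<le> MP'"
    unfolding bounded_iff by (metis imageI real_norm_def)
  obtain Me where Me: "\<And>n. \<bar>e n\<bar> \<le> Me"
    using convergent_imp_Bseq[OF convergentI[OF pw(4)]] by (auto simp: Bseq_def)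
  have pb: "\<bar>p n r\<bar> \<le> Mh + Me" if "r \<in> {0..R}" for n r
    using pw(5)[OF that, of n] M(1)[OF that] Me[of n] by linarith
  have M0: "0 \<le> Mh" "0 \<le> MP" "0 \<le> MP'" "0 \<le> Me"
    using order_trans[OF abs_ge_zero M(1)[of 0]] order_trans[OF abs_ge_zero M(2)[of 0]]
      order_trans[OF abs_ge_zero M(3)[of 0]] order_trans[OF abs_ge_zero Me[of 0]] R by auto
  have m: "f \<in> borel_measurable (lebesgue_on ?I)" if "continuous_on {0..R} f" for f :: "real \<Rightarrow> real"
    by (rule measurable_of_continuous_closed_interval[OF that])
  have [measurable]: "h \<in> borel_measurable (lebesgue_on ?I)" "P \<in> borel_measurable (lebesgue_on ?I)"
    "P' \<in> borel_measurable (lebesgue_on ?I)" "\<And>n. p n \<in> borel_measurable (lebesgue_on ?I)"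
    "(indicator {a..b} :: real \<Rightarrow> real) \<in> borel_measurable (lebesgue_on ?I)"
    using m[OF ch] m[OF cP(1)] m[OF cP(2)] m[OF cp]
    by (auto intro!: borel_measurable_lebesgue_onI)
  \<comment> \<open>Both terms of the integrand are uniformly bounded, pointwise convergent factors
    times an L2 convergent sequence; the bound on \<open>p n\<close> comes from its uniform distance
    \<open>e n\<close> to \<open>h\<close>.\<close>
  have 1: "L2_lim ?I (\<lambda>n r. (indicator {a..b} r * (2 * P r * p n r)) *\<^sub>R w n r)
      (\<lambda>r. (indicator {a..b} r * (2 * P r * h r)) *\<^sub>R v r)"
  proof (rule L2_lim_scaleR[OF pw(3), where K="2 * MP * (Mh + Me)"])
    show "\<bar>indicator {a..b} x * (2 * P x * p n x)\<bar> \<le> 2 * MP * (Mh + Me)" if "x \<in> ?I" for n x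
    proof -
      have "\<bar>P x\<bar> * \<bar>p n x\<bar> \<le> MP * (Mh + Me)"
        using M(2)[of x] pb[of x n] that M0 by (intro mult_mono) auto
      then show ?thesis using M0 by (auto simp: indicator_def abs_mult)
    qed
    show "AE x in lebesgue_on ?I. (\<lambda>n. indicator {a..b} x * (2 * P x * p n x))
        \<longlonglongrightarrow> indicator {a..b} x * (2 * P x * h x)"
      by (intro AE_I2 tendsto_intros lim) (auto simp: space_restrict_space)
  qed measurable
  have 2: "L2_lim ?I (\<lambda>n r. (indicator {a..b} r * (P' r * p n r)) *\<^sub>R p n r)
      (\<lambda>r. (indicator {a..b} r * (P' r * h r)) *\<^sub>R h r)"
  proof (rule L2_lim_scaleR[where K="MP' * (Mh + Me)"])
    show "L2_lim ?I p h" by (rule L2_lim_uniform[OF ch cp pw(4,5)])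
    show "\<bar>indicator {a..b} x * (P' x * p n x)\<bar> \<le> MP' * (Mh + Me)" if "x \<in> ?I" for n x
    proof -
      have "\<bar>P' x\<bar> * \<bar>p n x\<bar> \<le> MP' * (Mh + Me)"
        using M(3)[of x] pb[of x n] that M0 by (intro mult_mono) auto
      then show ?thesis using M0 by (auto simp: indicator_def abs_mult)
    qed
    show "AE x in lebesgue_on ?I. (\<lambda>n. indicator {a..b} x * (P' x * p n x))
        \<longlonglongrightarrow> indicator {a..b} x * (P' x * h x)"
      by (intro AE_I2 tendsto_intros lim) (auto simp: space_restrict_space)
  qed measurable
  let ?g = "\<lambda>n r. indicator {a..b} r * (2 * P r * p n r * w n r + P' r * (p n r)\<^sup>2)"
  let ?h = "\<lambda>r. indicator {a..b} r * (2 * P r * h r * v r + P' r * (h r)\<^sup>2)"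
  have 3: "L2_lim ?I ?g ?h"
    using L2_lim_add[OF 1 2] by (simp add: algebra_simps power2_eq_square)
  show int: "integrable (lebesgue_on ?I) ?h"
    using L2_on_imp_integrable[OF L2_limD(2)[OF 3] I] .
  have "(\<lambda>n. LINT r|lebesgue_on ?I. ?g n r) \<longlonglongrightarrow> (LINT r|lebesgue_on ?I. ?h r)"
    using L2_lim_integral_scaleR[OF L2_on_one[OF I] 3] by simp
  moreover have "(LINT r|lebesgue_on ?I. ?g n r) = P b * (p n b)\<^sup>2 - P a * (p n a)\<^sup>2" for n
  proof -
    let ?q = "\<lambda>r. 2 * P r * p n r * w n r + P' r * (p n r)\<^sup>2"
    have "(LINT r|lebesgue_on ?I. ?g n r) = integral {0..R} (?g n)"
      using lebesgue_integral_eq_integral[OF L2_on_imp_integrable[OF L2_limD(1)[OF 3] I]]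
      by (simp add: integral_open_interval_real)
    also have "\<dots> = integral {0..R} (\<lambda>r. if r \<in> {a..b} then ?q r else 0)"
      by (intro integral_cong) (auto simp: indicator_def)
    also have "\<dots> = integral {a..b} ?q"
    proof -
      have "{a..b} \<inter> {0..R} = {a..b}" "{0..R} \<inter> {a..b} = {a..b}" using ab by auto
      then show ?thesis by (simp only: Henstock_Kurzweil_Integration.integral_restrict_Int)
    qed
    also have "\<dots> = P b * (p n b)\<^sup>2 - P a * (p n a)\<^sup>2"
    proof (rule integral_unique, rule fundamental_theorem_of_calculus[OF ab(2)])
      fix r
      have "((\<lambda>r. P r * (p n r)\<^sup>2) has_real_derivative ?q r) (at r)"
        by (auto intro!: derivative_eq_intros P(1) pw(1) simp: algebra_simps)
      then show "((\<lambda>r. P r * (p n r)\<^sup>2) has_vector_derivative ?q r) (at r within {a..b})"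
        by (auto simp: has_real_derivative_iff_has_vector_derivative[symmetric] intro: has_field_derivative_at_within)
    qed
    finally show ?thesis .
  qed
  moreover have "(\<lambda>n. P b * (p n b)\<^sup>2 - P a * (p n a)\<^sup>2) \<longlonglongrightarrow> P b * (h b)\<^sup>2 - P a * (h a)\<^sup>2"
    by (intro tendsto_intros lim) (use ab in auto)
  ultimately show "(LINT r|lebesgue_on ?I. ?h r) = P b * (h b)\<^sup>2 - P a * (h a)\<^sup>2"
    using LIMSEQ_unique by simp
qed

section \<open>Integration in polar coordinates\<close>

lemma lebesgue_on_borel:
  fixes f :: "'a::euclidean_space \<Rightarrow> 'b::{banach, second_countable_topology}"
  assumes "S \<in> sets borel" "f \<in> borel_measurable borel"
  shows "(LINT x|lebesgue_on S. f x) = (LINT x|restrict_space lborel S. f x)"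
    "integrable (lebesgue_on S) f \<longleftrightarrow> integrable (restrict_space lborel S) f"
proof -
  have m: "(\<lambda>x. indicator S x *\<^sub>R f x) \<in> borel_measurable lborel" using assms by measurable
  show "(LINT x|lebesgue_on S. f x) = (LINT x|restrict_space lborel S. f x)"
    using assms(1) by (simp add: integral_restrict_space integral_completion[OF m])
  show "integrable (lebesgue_on S) f \<longleftrightarrow> integrable (restrict_space lborel S) f"
    using assms(1) by (simp add: integrable_restrict_space integrable_completion[OF m])
qed

text \<open>Finite measures on the line are determined by their values on half lines. There the left
  side is the volume of a spherical shell and the right side integrates to the same difference of
  cubes.\<close>

lemma distr_norm_ball:
  "distr (restrict_space lborel (ball (0 :: real^3) R)) borel norm =
   density lborel (\<lambda>r. ennreal (4 * pi * r\<^sup>2 * indicator {0<..<R} r))" (is "?M = ?N")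
proof (rule measure_eqI_lessThan)
  have emM: "emeasure ?M {a<..} = emeasure lborel ({x. a < norm x} \<inter> ball (0 :: real^3) R)" for a
  proof -
    have "emeasure ?M {a<..} = emeasure (restrict_space lborel (ball (0 :: real^3) R)) ({x. a < norm x} \<inter> ball 0 R)"
      by (subst emeasure_distr) (auto simp: space_restrict_space intro!: arg_cong2[where f=emeasure] measurable_restrict_space1)
    then show ?thesis by (subst (asm) emeasure_restrict_space) auto
  qed
  show "emeasure ?M {a<..} < \<infinity>" for a
    unfolding emM using emeasure_mono[of "{x. a < norm x} \<inter> ball (0 :: real^3) R" "ball 0 R" lborel]
      emeasure_lborel_ball_finite[of "0 :: real^3" R] by (auto intro: le_less_trans)
  fix a :: real
  \<comment> \<open>Norms are nonnegative, so a negative threshold selects the whole ball.\<close>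
  define b where "b = max 0 a"
  have N: "emeasure ?N {a<..} = (\<integral>\<^sup>+r. ennreal (4 * pi * r\<^sup>2) * indicator {b..R} r \<partial>lborel)"
  proof -
    have "emeasure ?N {a<..} = (\<integral>\<^sup>+r. ennreal (4 * pi * r\<^sup>2 * indicator {0<..<R} r) * indicator {a<..} r \<partial>lborel)"
      by (subst emeasure_density) auto
    also have "\<dots> = (\<integral>\<^sup>+r. ennreal (4 * pi * r\<^sup>2) * indicator {b..R} r \<partial>lborel)"
    proof (rule nn_integral_cong_AE)
      have "AE r in lborel. r \<noteq> b" "AE r in lborel. r \<noteq> R" by (rule AE_lborel_singleton)+
      then show "AE r in lborel. ennreal (4 * pi * r\<^sup>2 * indicator {0<..<R} r) * indicator {a<..} r
          = ennreal (4 * pi * r\<^sup>2) * indicator {b..R} r"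
        by eventually_elim (auto simp: indicator_def b_def)
    qed
    finally show ?thesis .
  qed
  show "emeasure ?M {a<..} = emeasure ?N {a<..}"
  proof (cases "b < R")
    case False
    have "{x. a < norm x} \<inter> ball (0 :: real^3) R = {}"
    proof -
      have "\<not> (a < norm x \<and> norm x < R)" for x :: "real^3"
        using False norm_ge_zero[of x] unfolding b_def by linarith
      then show ?thesis by auto
    qed
    moreover have "(\<integral>\<^sup>+r. ennreal (4 * pi * r\<^sup>2) * indicator {b..R} r \<partial>lborel) = (\<integral>\<^sup>+r. 0 \<partial>(lborel :: real measure))"
    proof (rule nn_integral_cong_AE)
      have "AE r in lborel. r \<noteq> b" by (rule AE_lborel_singleton)
      then show "AE r in lborel. ennreal (4 * pi * r\<^sup>2) * indicator {b..R} r = 0"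
        by eventually_elim (use False in \<open>auto simp: indicator_def\<close>)
    qed
    ultimately show ?thesis unfolding emM N by simp
  next
    case True
    have b0: "b \<ge> 0" by (simp add: b_def)
    have c3: "emeasure lborel (ball (0 :: real^3) r) = ennreal (4 / 3 * pi * r ^ 3)"
      "emeasure lborel (cball (0 :: real^3) r) = ennreal (4 / 3 * pi * r ^ 3)" if "r \<ge> 0" for r
      using emeasure_ball[of r "0 :: real^3"] emeasure_cball[of r "0 :: real^3"] that unit_ball_vol_3 by auto
    have "emeasure ?M {a<..} = ennreal (4 / 3 * pi * R ^ 3) - ennreal (4 / 3 * pi * b ^ 3)"
    proof (cases "a < 0")
      case a: True
      then have "{x. a < norm x} \<inter> ball (0 :: real^3) R = ball 0 R"
        using le_less_trans[OF _ less_le_trans[OF a norm_ge_zero]] less_le_trans[OF a norm_ge_zero] by auto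
      then show ?thesis using a True c3(1)[of R] unfolding emM by (simp add: b_def)
    next
      case a: False
      then have ab: "a = b" by (simp add: b_def)
      have "{x. a < norm x} \<inter> ball (0 :: real^3) R = ball 0 R - cball 0 b" using ab by auto
      moreover have "emeasure lborel (ball (0 :: real^3) R - cball 0 b) = emeasure lborel (ball (0 :: real^3) R) - emeasure lborel (cball (0 :: real^3) b)"
        using True emeasure_lborel_cball_finite[of "0 :: real^3" b] by (intro emeasure_Diff) (auto simp: less_top)
      ultimately show ?thesis using True b0 by (simp add: emM c3)
    qed
    also have "\<dots> = ennreal (4 / 3 * pi * R ^ 3 - 4 / 3 * pi * b ^ 3)"
      using b0 by (intro ennreal_minus) auto
    also have "\<dots> = (\<integral>\<^sup>+r. ennreal (4 * pi * r\<^sup>2) * indicator {b..R} r \<partial>lborel)"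
    proof (rule nn_integral_FTC_Icc[symmetric])
      show "((\<lambda>r. 4 / 3 * pi * r ^ 3) has_real_derivative 4 * pi * x\<^sup>2) (at x)" for x
        by (auto intro!: derivative_eq_intros)
    qed (use True in auto)
    finally show ?thesis unfolding N .
  qed
qed auto

lemma radial_integral:
  fixes f :: "real \<Rightarrow> real"
  assumes f: "f \<in> borel_measurable borel"
  shows "integrable (lebesgue_on (ball (0 :: real^3) R)) (\<lambda>x. f (norm x)) \<longleftrightarrow>
      integrable (lebesgue_on {0<..<R}) (\<lambda>r. r\<^sup>2 * f r)"
    "(LINT x|lebesgue_on (ball (0 :: real^3) R). f (norm x)) = 4 * pi * (LINT r|lebesgue_on {0<..<R}. r\<^sup>2 * f r)"
proof -
  note [measurable] = f
  have mf: "(\<lambda>x :: real^3. f (norm x)) \<in> borel_measurable borel" by measurable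
  have mr: "(\<lambda>r. r\<^sup>2 * f r) \<in> borel_measurable borel" by measurable
  have mn: "norm \<in> restrict_space lborel (ball (0 :: real^3) R) \<rightarrow>\<^sub>M borel"
    by (intro measurable_restrict_space1) simp
  let ?D = "\<lambda>r. 4 * pi * r\<^sup>2 * indicator {0<..<R} r"
  have eq: "?D r *\<^sub>R f r = 4 * pi * (indicator {0<..<R} r *\<^sub>R (r\<^sup>2 * f r))" for r by simp
  have "integrable (lebesgue_on (ball (0 :: real^3) R)) (\<lambda>x. f (norm x)) \<longleftrightarrow> integrable lborel (\<lambda>r. ?D r *\<^sub>R f r)"
    unfolding lebesgue_on_borel(2)[OF borel_open[OF open_ball] mf] integrable_distr_eq[OF mn f, symmetric] distr_norm_ball
    by (subst integrable_density) auto
  also have "\<dots> \<longleftrightarrow> integrable (lebesgue_on {0<..<R}) (\<lambda>r. r\<^sup>2 * f r)"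
    unfolding eq lebesgue_on_borel(2)[OF borel_open[OF open_greaterThanLessThan] mr]
    by (simp add: integrable_restrict_space)
  finally show "integrable (lebesgue_on (ball (0 :: real^3) R)) (\<lambda>x. f (norm x)) \<longleftrightarrow>
      integrable (lebesgue_on {0<..<R}) (\<lambda>r. r\<^sup>2 * f r)" .
  have "(LINT x|lebesgue_on (ball (0 :: real^3) R). f (norm x)) = (LINT r|lborel. ?D r *\<^sub>R f r)"
    unfolding lebesgue_on_borel(1)[OF borel_open[OF open_ball] mf] integral_distr[OF mn f, symmetric] distr_norm_ball
    by (subst integral_density) auto
  also have "\<dots> = 4 * pi * (LINT r|lebesgue_on {0<..<R}. r\<^sup>2 * f r)"
    unfolding eq lebesgue_on_borel(1)[OF borel_open[OF open_greaterThanLessThan] mr]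
    by (simp add: integral_restrict_space)
  finally show "(LINT x|lebesgue_on (ball (0 :: real^3) R). f (norm x)) = 4 * pi * (LINT r|lebesgue_on {0<..<R}. r\<^sup>2 * f r)" .
qed

section \<open>Orthogonal invariance and angular means\<close>

lemma lborel_distr_orthogonal:
  fixes T :: "real^'n::{finite,wellorder} \<Rightarrow> real^'n::_"
  assumes T: "orthogonal_transformation T"
  shows "distr lborel borel T = lborel"
proof (rule lborel_eqI[symmetric])
  have [measurable]: "T \<in> borel_measurable borel"
    using T by (intro borel_measurable_continuous_onI linear_continuous_on)
      (simp add: orthogonal_transformation_linear linear_linear)
  fix l u :: "real^'n::_" assume lu: "\<And>b. b \<in> Basis \<Longrightarrow> l \<bullet> b \<le> u \<bullet> b"
  have iT: "orthogonal_transformation (inv T)" and bT: "bij T"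
    using T by (auto simp: orthogonal_transformation_inv orthogonal_transformation_bij)
  have lm: "inv T ` box l u \<in> lmeasurable"
    using measurable_orthogonal_image[OF iT] by simp
  have "emeasure (distr lborel borel T) (box l u) = emeasure lborel (inv T ` box l u)"
    using bT by (subst emeasure_distr) (auto simp: bij_vimage_eq_inv_image)
  also have "\<dots> = emeasure lebesgue (inv T ` box l u)" 
  proof -
    have "T -` box l u \<in> sets borel" using measurable_sets_borel[of T borel "box l u"] by auto
    then show ?thesis using bT by (simp add: bij_vimage_eq_inv_image)
  qed
  also have "\<dots> = ennreal (measure lebesgue (inv T ` box l u))"
    using lm by (intro emeasure_eq_measure2)
  also have "measure lebesgue (inv T ` box l u) = measure lebesgue (box l u)"
    by (rule measure_orthogonal_image[OF iT]) simp
  also have "\<dots> = (\<Prod>b\<in>Basis. (u - l) \<bullet> b)" using lu by simp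
  finally show "emeasure (distr lborel borel T) (box l u) = ennreal (\<Prod>b\<in>Basis. (u - l) \<bullet> b)" .
qed simp

lemma integral_ball_orthogonal:
  fixes T :: "real^'n::{finite,wellorder} \<Rightarrow> real^'n::_" and F :: "real^'n::_ \<Rightarrow> real"
  assumes T: "orthogonal_transformation T" and F: "F \<in> borel_measurable borel"
  shows "(LINT x|lebesgue_on (ball 0 R). F (T x)) = (LINT x|lebesgue_on (ball 0 R). F x)"
proof -
  have [measurable]: "T \<in> borel_measurable borel"
    using T by (intro borel_measurable_continuous_onI linear_continuous_on)
      (simp add: orthogonal_transformation_linear linear_linear)
  note [measurable] = F
  have ind: "indicator (ball 0 R) (T x) = (indicator (ball 0 R) x :: real)" for x
    using orthogonal_transformation_norm[OF T, of x] by (simp add: indicator_def)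
  have "(LINT x|lebesgue_on (ball 0 R). F x) = (LINT x|distr lborel borel T. indicator (ball 0 R) x *\<^sub>R F x)"
    unfolding lebesgue_on_borel(1)[OF borel_open[OF open_ball] F] lborel_distr_orthogonal[OF T]
    by (simp add: integral_restrict_space)
  also have "\<dots> = (LINT x|lborel. indicator (ball 0 R) (T x) *\<^sub>R F (T x))"
    using F by (intro integral_distr borel_measurable_scaleR borel_measurable_indicator) auto
  also have "\<dots> = (LINT x|lebesgue_on (ball 0 R). F (T x))"
  proof -
    have "(\<lambda>x. F (T x)) \<in> borel_measurable borel" by measurable
    from lebesgue_on_borel(1)[OF borel_open[OF open_ball] this] show ?thesis
      unfolding ind by (simp add: integral_restrict_space)
  qed
  finally show ?thesis ..
qed

lemma norm_vec3: "norm (x :: real^3) = sqrt ((x $ 1)\<^sup>2 + (x $ 2)\<^sup>2 + (x $ 3)\<^sup>2)"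
  by (simp add: norm_vec_def L2_set_def sum_3)

lemma orthogonal_swap12: "orthogonal_transformation (\<lambda>x :: real^3. vector [x $ 2, x $ 1, x $ 3] :: real^3)"
  unfolding orthogonal_transformation
  by (simp add: norm_vec3 vector_3 linear_iff vec_eq_iff forall_3 algebra_simps)

lemma orthogonal_swap13: "orthogonal_transformation (\<lambda>x :: real^3. vector [x $ 3, x $ 2, x $ 1] :: real^3)"
  unfolding orthogonal_transformation
  by (simp add: norm_vec3 vector_3 linear_iff vec_eq_iff forall_3 algebra_simps)

text \<open>Mixing two coordinates at 45 degrees relates the pure fourth moments to the mixed ones,
  which permutations of coordinates cannot do. The map has determinant - 1, hence is a
  reflection.\<close>

lemma orthogonal_rotation12:
  "orthogonal_transformation (\<lambda>x :: real^3. vector [(x $ 1 + x $ 2) / sqrt 2, (x $ 1 - x $ 2) / sqrt 2, x $ 3] :: real^3)"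
  unfolding orthogonal_transformation
proof
  show "linear (\<lambda>x :: real^3. vector [(x $ 1 + x $ 2) / sqrt 2, (x $ 1 - x $ 2) / sqrt 2, x $ 3] :: real^3)"
    by (simp add: vector_3 linear_iff vec_eq_iff forall_3 add_divide_distrib diff_divide_distrib right_diff_distrib distrib_left)
  show "\<forall>v :: real^3. norm (vector [(v $ 1 + v $ 2) / sqrt 2, (v $ 1 - v $ 2) / sqrt 2, v $ 3] :: real^3) = norm v"
    by (simp add: norm_vec3 vector_3 power_divide) (simp add: field_simps power2_eq_square)
qed

text \<open>Permutations make the three second moments \<open>q\<close> equal, and their sum is the
  full integral. The 45 degree map gives \<open>p 1 1 = 3 * p 1 2\<close> for the fourth moments;
  together with \<open>q 1 = p 1 1 + p 1 2 + p 1 3\<close> the mean of the fourth power becomes 3/5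
  of 1/3.\<close>

lemma angular_moments:
  fixes f :: "real \<Rightarrow> real"
  assumes f: "f \<in> borel_measurable borel" and i: "integrable (lebesgue_on (ball (0 :: real^3) R)) (\<lambda>x. f (norm x))"
  shows "integrable (lebesgue_on (ball (0 :: real^3) R)) (\<lambda>x. f (norm x) * (x $ 3 / norm x)\<^sup>2)"
    "(LINT x|lebesgue_on (ball (0 :: real^3) R). f (norm x) * (x $ 3 / norm x)\<^sup>2)
      = (LINT x|lebesgue_on (ball (0 :: real^3) R). f (norm x)) / 3"
    "integrable (lebesgue_on (ball (0 :: real^3) R)) (\<lambda>x. f (norm x) * (x $ 3 / norm x) ^ 4)"
    "(LINT x|lebesgue_on (ball (0 :: real^3) R). f (norm x) * (x $ 3 / norm x) ^ 4)
      = (LINT x|lebesgue_on (ball (0 :: real^3) R). f (norm x)) / 5"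
proof -
  let ?B = "ball (0 :: real^3) R"
  let ?M = "lebesgue_on ?B"
  note [measurable] = f
  have int: "integrable ?M (\<lambda>x. f (norm x) * g x)"
    if g: "g \<in> borel_measurable borel" "\<And>x. \<bar>g x\<bar> \<le> 1" for g
  proof (rule Bochner_Integration.integrable_bound[OF i])
    note [measurable] = g(1)
    show "(\<lambda>x. f (norm x) * g x) \<in> borel_measurable ?M"
      by (intro borel_measurable_lebesgue_onI) measurable
    show "AE x in ?M. norm (f (norm x) * g x) \<le> norm (f (norm x))"
      using g(2) by (intro AE_I2) (simp add: abs_mult mult_left_le)
  qed
  define n :: "3 \<Rightarrow> real^3 \<Rightarrow> real" where "n i x = x $ i / norm x" for i x
  have [measurable]: "n i \<in> borel_measurable borel" for i unfolding n_def by measurable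
  have n1: "\<bar>n i x\<bar> \<le> 1" for i x
    using component_le_norm_cart[of x i] by (simp add: n_def divide_le_eq)
  have nsq: "(n 1 x)\<^sup>2 + (n 2 x)\<^sup>2 + (n 3 x)\<^sup>2 = 1" if "x \<noteq> 0" for x
  proof -
    have nn: "(norm x)\<^sup>2 = (x $ 1)\<^sup>2 + (x $ 2)\<^sup>2 + (x $ 3)\<^sup>2" unfolding norm_vec3 by simp
    have "(n 1 x)\<^sup>2 + (n 2 x)\<^sup>2 + (n 3 x)\<^sup>2 = ((x $ 1)\<^sup>2 + (x $ 2)\<^sup>2 + (x $ 3)\<^sup>2) / (norm x)\<^sup>2"
      by (simp add: n_def power_divide add_divide_distrib)
    also have "\<dots> = (norm x)\<^sup>2 / (norm x)\<^sup>2" by (simp only: nn)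
    finally have "(n 1 x)\<^sup>2 + (n 2 x)\<^sup>2 + (n 3 x)\<^sup>2 = (norm x)\<^sup>2 / (norm x)\<^sup>2" .
    then show ?thesis using that by simp
  qed
  have n2: "\<bar>(n i x)\<^sup>2\<bar> \<le> 1" for i x using n1[of i x] by (simp add: abs_square_le_1)
  have n22: "\<bar>(n i x)\<^sup>2 * (n j x)\<^sup>2\<bar> \<le> 1" for i j x
    using mult_mono[OF n2[of i x] n2[of j x]] by (simp add: abs_mult)
  define q where "q i = (LINT x|?M. f (norm x) * (n i x)\<^sup>2)" for i
  define p where "p i j = (LINT x|?M. f (norm x) * ((n i x)\<^sup>2 * (n j x)\<^sup>2))" for i j
  have iq: "integrable ?M (\<lambda>x. f (norm x) * (n i x)\<^sup>2)" for i by (rule int[OF _ n2]) measurable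
  have ip: "integrable ?M (\<lambda>x. f (norm x) * ((n i x)\<^sup>2 * (n j x)\<^sup>2))" for i j by (rule int[OF _ n22]) measurable
  have ip4: "integrable ?M (\<lambda>x. f (norm x) * n i x ^ 4)" for i using ip[of i i] by simp
  have T: "(LINT x|?M. F (S x)) = (LINT x|?M. F x)"
    if "orthogonal_transformation S" "F \<in> borel_measurable borel" for F :: "real^3 \<Rightarrow> real" and S
    by (rule integral_ball_orthogonal[OF that])
  note N12 = orthogonal_transformation_norm[OF orthogonal_swap12]
  note N13 = orthogonal_transformation_norm[OF orthogonal_swap13]
  note NR = orthogonal_transformation_norm[OF orthogonal_rotation12]
  have q12: "q 2 = q 1"
    using T[OF orthogonal_swap12, of "\<lambda>x. f (norm x) * (n 1 x)\<^sup>2"] by (simp add: q_def n_def N12 vector_3)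
  have q13: "q 3 = q 1"
    using T[OF orthogonal_swap13, of "\<lambda>x. f (norm x) * (n 1 x)\<^sup>2"] by (simp add: q_def n_def N13 vector_3)
  have p12: "p 2 2 = p 1 1" "p 2 3 = p 1 3"
    using T[OF orthogonal_swap12, of "\<lambda>x. f (norm x) * ((n 1 x)\<^sup>2 * (n 1 x)\<^sup>2)"]
      T[OF orthogonal_swap12, of "\<lambda>x. f (norm x) * ((n 1 x)\<^sup>2 * (n 3 x)\<^sup>2)"] by (simp_all add: p_def n_def N12 vector_3)
  have p13: "p 3 3 = p 1 1" "p 3 2 = p 1 2"
    using T[OF orthogonal_swap13, of "\<lambda>x. f (norm x) * ((n 1 x)\<^sup>2 * (n 1 x)\<^sup>2)"]
      T[OF orthogonal_swap13, of "\<lambda>x. f (norm x) * ((n 1 x)\<^sup>2 * (n 2 x)\<^sup>2)"] by (simp_all add: p_def n_def N13 vector_3)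
  have psym: "p i j = p j i" for i j by (simp add: p_def mult.commute)
  \<comment> \<open>At the origin division by zero makes every \<open>n i\<close> vanish, so the
    squares sum to 1 only almost everywhere.\<close>
  have ae: "AE x in ?M. x \<noteq> 0"
    by (subst AE_restrict_space_iff) (auto intro!: AE_completion eventually_mono[OF AE_lborel_singleton])
  have sumq: "(LINT x|?M. f (norm x)) = q 1 + q 2 + q 3"
  proof -
    have "(LINT x|?M. f (norm x)) = (LINT x|?M. f (norm x) * (n 1 x)\<^sup>2 + f (norm x) * (n 2 x)\<^sup>2 + f (norm x) * (n 3 x)\<^sup>2)"
    proof (rule integral_cong_AE)
      show "AE x in ?M. f (norm x) = f (norm x) * (n 1 x)\<^sup>2 + f (norm x) * (n 2 x)\<^sup>2 + f (norm x) * (n 3 x)\<^sup>2"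
        using ae by eventually_elim (simp add: nsq flip: distrib_left)
    qed (intro borel_measurable_lebesgue_onI, measurable)+
    then show ?thesis using iq by (simp add: q_def)
  qed
  have sump: "q 1 = p 1 1 + p 1 2 + p 1 3"
  proof -
    have "q 1 = (LINT x|?M. f (norm x) * ((n 1 x)\<^sup>2 * (n 1 x)\<^sup>2) + f (norm x) * ((n 1 x)\<^sup>2 * (n 2 x)\<^sup>2)
        + f (norm x) * ((n 1 x)\<^sup>2 * (n 3 x)\<^sup>2))"
      unfolding q_def
    proof (rule integral_cong_AE)
      show "AE x in ?M. f (norm x) * (n 1 x)\<^sup>2 = f (norm x) * ((n 1 x)\<^sup>2 * (n 1 x)\<^sup>2)
          + f (norm x) * ((n 1 x)\<^sup>2 * (n 2 x)\<^sup>2) + f (norm x) * ((n 1 x)\<^sup>2 * (n 3 x)\<^sup>2)"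
        using ae
      proof eventually_elim
        case (elim x)
        show ?case by (simp only: distrib_left[symmetric] nsq[OF elim] mult_1_right)
      qed
    qed (intro borel_measurable_lebesgue_onI, measurable)+
    then show ?thesis using ip ip4 by (simp add: p_def)
  qed
  have rot: "2 * p 1 1 = (p 1 1 + 6 * p 1 2 + p 2 2) / 2"
  proof -
    let ?F = "\<lambda>x. f (norm x) * ((n 1 x)\<^sup>2 * (n 1 x)\<^sup>2) + f (norm x) * ((n 2 x)\<^sup>2 * (n 2 x)\<^sup>2)"
    let ?S = "\<lambda>x :: real^3. vector [(x $ 1 + x $ 2) / sqrt 2, (x $ 1 - x $ 2) / sqrt 2, x $ 3] :: real^3"
    have nS: "n 1 (?S x) = (n 1 x + n 2 x) / sqrt 2" "n 2 (?S x) = (n 1 x - n 2 x) / sqrt 2" for x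
      unfolding n_def NR by (simp_all add: vector_3 add_divide_distrib diff_divide_distrib mult.commute)
    have FS: "?F (?S x) = (f (norm x) * ((n 1 x)\<^sup>2 * (n 1 x)\<^sup>2) + 6 * (f (norm x) * ((n 1 x)\<^sup>2 * (n 2 x)\<^sup>2))
        + f (norm x) * ((n 2 x)\<^sup>2 * (n 2 x)\<^sup>2)) / 2" for x
    proof -
      define a b where "a = n 1 x" and "b = n 2 x"
      have "((a + b) / sqrt 2)\<^sup>2 = (a + b)\<^sup>2 / 2" "((a - b) / sqrt 2)\<^sup>2 = (a - b)\<^sup>2 / 2"
        by (simp_all add: power_divide)
      moreover have "(a + b)\<^sup>2 / 2 * ((a + b)\<^sup>2 / 2) + (a - b)\<^sup>2 / 2 * ((a - b)\<^sup>2 / 2)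
          = (a\<^sup>2 * a\<^sup>2 + 6 * (a\<^sup>2 * b\<^sup>2) + b\<^sup>2 * b\<^sup>2) / 2"
        by (simp add: field_simps power2_eq_square)
      ultimately have "((a + b) / sqrt 2)\<^sup>2 * ((a + b) / sqrt 2)\<^sup>2 + ((a - b) / sqrt 2)\<^sup>2 * ((a - b) / sqrt 2)\<^sup>2
          = (a\<^sup>2 * a\<^sup>2 + 6 * (a\<^sup>2 * b\<^sup>2) + b\<^sup>2 * b\<^sup>2) / 2" by (simp only:)
      moreover have "u * X + u * Y = (u * A + 6 * (u * B) + u * C) / 2" if "X + Y = (A + 6 * B + C) / 2"
        for u X Y A B C :: real
      proof -
        have "u * X + u * Y = u * (X + Y)" by (simp only: distrib_left)
        then show ?thesis unfolding that by (simp add: field_simps)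
      qed
      ultimately show ?thesis unfolding nS NR a_def[symmetric] b_def[symmetric] by blast
    qed
    have "(LINT x|?M. ?F (?S x)) = (LINT x|?M. ?F x)"
      by (rule T[OF orthogonal_rotation12]) measurable
    moreover have "(LINT x|?M. ?F x) = p 1 1 + p 2 2" using ip ip4 by (simp add: p_def)
    moreover have "(LINT x|?M. ?F (?S x)) = (p 1 1 + 6 * p 1 2 + p 2 2) / 2"
      unfolding FS using ip ip4 by (simp add: p_def)
    ultimately show ?thesis using p12 by simp
  qed
  have "p 1 2 = p 1 3" using p12(2) p13(2) psym[of 2 3] by simp
  then have p11: "p 1 1 = q 1 * 3 / 5" using rot sump p12(1) by simp
  have e4: "(n 3 x)\<^sup>2 * (n 3 x)\<^sup>2 = (x $ 3 / norm x) ^ 4" for x by (simp add: n_def flip: power_add)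
  show "integrable ?M (\<lambda>x. f (norm x) * (x $ 3 / norm x)\<^sup>2)" using iq[of 3] by (simp add: n_def)
  show "integrable ?M (\<lambda>x. f (norm x) * (x $ 3 / norm x) ^ 4)" using ip[of 3 3] unfolding e4 .
  show "(LINT x|?M. f (norm x) * (x $ 3 / norm x)\<^sup>2) = (LINT x|?M. f (norm x)) / 3"
    using sumq q12 q13 by (simp add: q_def n_def)
  show "(LINT x|?M. f (norm x) * (x $ 3 / norm x) ^ 4) = (LINT x|?M. f (norm x)) / 5"
    using sumq q12 q13 p13(1) p11 unfolding p_def e4 by simp
qed

section \<open>Products of radial and angular functions\<close>

text \<open>Uniqueness of weak derivatives replaces the chosen \<open>weak_partial\<close> in
  \<open>W12_0\<close> by any explicit family \<open>v\<close>.\<close>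

lemma W12_0I:
  fixes u :: "'a::euclidean_space \<Rightarrow> 'b::euclidean_space"
  assumes \<rho>: "\<rho> > 0" and \<phi>: "\<And>n. \<phi> n \<in> C1c (ball c \<rho>)" and u: "L2_lim (ball c \<rho>) \<phi> u"
    and v: "\<And>b. b \<in> Basis \<Longrightarrow> L2_lim (ball c \<rho>) (\<lambda>n x. frechet_derivative (\<phi> n) (at x) b) (v b)"
    and wp: "\<And>b. b \<in> Basis \<Longrightarrow> is_weak_partial (ball c \<rho>) u b (v b)"
  shows "u \<in> W12_0 (ball c \<rho>)"
  unfolding W12_0_def
proof (intro CollectI conjI exI[of _ \<phi>] allI ballI)
  let ?B = "ball c \<rho>"
  show "u \<in> W12 ?B" unfolding W12_def using L2_limD(2)[OF u] L2_limD(2)[OF v] wp by blast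
  show "\<phi> n \<in> C1c ?B" for n by fact
  show "(\<lambda>n. LINT x|lebesgue_on ?B. (norm (u x - \<phi> n x))\<^sup>2) \<longlonglongrightarrow> 0"
    using L2_limD(3)[OF u] by (simp add: norm_minus_commute)
  fix b :: 'a assume b: "b \<in> Basis"
  have ae: "AE x in lebesgue_on ?B. weak_partial ?B u b x = v b x"
    by (rule weak_partial_AE_eq[OF \<rho> L2_limD(2)[OF v[OF b]] wp[OF b]])
  have "(LINT x|lebesgue_on ?B. (norm (weak_partial ?B u b x - frechet_derivative (\<phi> n) (at x) b))\<^sup>2)
      = (LINT x|lebesgue_on ?B. (norm (frechet_derivative (\<phi> n) (at x) b - v b x))\<^sup>2)" for n
  proof (rule integral_cong_AE)
    note [measurable] = borel_measurable_of_L2_on[OF L2_limD(1)[OF v[OF b]]]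
      borel_measurable_of_L2_on[OF L2_limD(2)[OF v[OF b]]]
      borel_measurable_of_L2_on[OF W12_weak_partial(1)[OF \<open>u \<in> W12 ?B\<close> b]]
    show "(\<lambda>x. (norm (weak_partial ?B u b x - frechet_derivative (\<phi> n) (at x) b))\<^sup>2) \<in> borel_measurable (lebesgue_on ?B)"
      by measurable
    show "(\<lambda>x. (norm (frechet_derivative (\<phi> n) (at x) b - v b x))\<^sup>2) \<in> borel_measurable (lebesgue_on ?B)"
      by measurable
  qed (use ae in \<open>eventually_elim, simp add: norm_minus_commute\<close>)
  then show "(\<lambda>n. LINT x|lebesgue_on ?B. (norm (weak_partial ?B u b x - frechet_derivative (\<phi> n) (at x) b))\<^sup>2) \<longlonglongrightarrow> 0"
    using L2_limD(3)[OF v[OF b]] by simp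
qed

text \<open>In dimension three the Jacobian r^2 cancels the singularity of the square. This function
  is the majorant for the singular gradient terms below.\<close>

lemma L2_on_inverse_norm: "L2_on (ball (0 :: real^3) R) (\<lambda>x. 1 / norm x)"
proof -
  have m: "(\<lambda>s :: real. (1 / s)\<^sup>2) \<in> borel_measurable borel" by measurable
  have "integrable (lebesgue_on {0<..<R}) (\<lambda>r. r\<^sup>2 * (1 / r)\<^sup>2) \<longleftrightarrow> integrable (lebesgue_on {0<..<R}) (\<lambda>r. 1 :: real)"
    by (rule Bochner_Integration.integrable_cong) (auto simp: power_divide)
  moreover have "integrable (lebesgue_on {0<..<R}) (\<lambda>r. 1 :: real)"
    by (intro L2_on_imp_integrable L2_on_one) auto
  ultimately have "integrable (lebesgue_on (ball (0 :: real^3) R)) (\<lambda>x. (1 / norm x)\<^sup>2)"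
    using radial_integral(1)[OF m] by simp
  moreover have "(\<lambda>x :: real^3. 1 / norm x) \<in> borel_measurable (lebesgue_on (ball 0 R))"
    by (intro borel_measurable_lebesgue_onI) measurable
  ultimately show ?thesis by (simp add: L2_on_def)
qed

lemma radial_square_integrable:
  fixes f :: "real \<Rightarrow> real"
  assumes [measurable]: "f \<in> borel_measurable borel" and L: "L2_on {0<..<R} f"
  shows "integrable (lebesgue_on (ball (0 :: real^3) R)) (\<lambda>x. (norm (f (norm x)))\<^sup>2)"
    "(LINT x|lebesgue_on (ball (0 :: real^3) R). (norm (f (norm x)))\<^sup>2)
      \<le> 4 * pi * (R\<^sup>2 * (LINT r|lebesgue_on {0<..<R}. (norm (f r))\<^sup>2))"
proof -
  have m: "(\<lambda>r. (norm (f r))\<^sup>2) \<in> borel_measurable borel" by measurable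
  have b: "r\<^sup>2 * (norm (f r))\<^sup>2 \<le> R\<^sup>2 * (norm (f r))\<^sup>2" if "r \<in> {0<..<R}" for r
    using that by (intro mult_right_mono power_mono) auto
  have i: "integrable (lebesgue_on {0<..<R}) (\<lambda>r. r\<^sup>2 * (norm (f r))\<^sup>2)"
  proof (rule Bochner_Integration.integrable_bound)
    show "integrable (lebesgue_on {0<..<R}) (\<lambda>r. R\<^sup>2 * (norm (f r))\<^sup>2)" using integrable_of_L2_on[OF L] by simp
    show "(\<lambda>r. r\<^sup>2 * (norm (f r))\<^sup>2) \<in> borel_measurable (lebesgue_on {0<..<R})"
      by (intro borel_measurable_lebesgue_onI) measurable
    show "AE r in lebesgue_on {0<..<R}. norm (r\<^sup>2 * (norm (f r))\<^sup>2) \<le> norm (R\<^sup>2 * (norm (f r))\<^sup>2)"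
      using b by (intro AE_I2) (simp add: space_restrict_space)
  qed
  then show "integrable (lebesgue_on (ball (0 :: real^3) R)) (\<lambda>x. (norm (f (norm x)))\<^sup>2)"
    using radial_integral(1)[OF m] by simp
  have "(LINT r|lebesgue_on {0<..<R}. r\<^sup>2 * (norm (f r))\<^sup>2) \<le> (LINT r|lebesgue_on {0<..<R}. R\<^sup>2 * (norm (f r))\<^sup>2)"
    using i integrable_of_L2_on[OF L] b by (intro integral_mono) (auto simp: space_restrict_space)
  then show "(LINT x|lebesgue_on (ball (0 :: real^3) R). (norm (f (norm x)))\<^sup>2)
      \<le> 4 * pi * (R\<^sup>2 * (LINT r|lebesgue_on {0<..<R}. (norm (f r))\<^sup>2))"
    using radial_integral(2)[OF m, of R] by simp
qed

lemma L2_on_radial: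
  fixes f :: "real \<Rightarrow> real"
  assumes "f \<in> borel_measurable borel" "L2_on {0<..<R} f"
  shows "L2_on (ball (0 :: real^3) R) (\<lambda>x. f (norm x))"
  unfolding L2_on_def using radial_square_integrable(1)[OF assms] assms(1)
  by (auto intro!: borel_measurable_lebesgue_onI)

lemma L2_lim_radial:
  fixes f :: "nat \<Rightarrow> real \<Rightarrow> real"
  assumes m: "\<And>n. f n \<in> borel_measurable borel" "g \<in> borel_measurable borel" and L: "L2_lim {0<..<R} f g"
  shows "L2_lim (ball (0 :: real^3) R) (\<lambda>n x. f n (norm x)) (\<lambda>x. g (norm x))"
proof -
  have "(\<lambda>n. LINT x|lebesgue_on (ball (0 :: real^3) R). (norm (f n (norm x) - g (norm x)))\<^sup>2) \<longlonglongrightarrow> 0"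
  proof (rule tendsto_sandwich[OF _ _ tendsto_const])
    show "(\<lambda>n. 4 * pi * (R\<^sup>2 * (LINT r|lebesgue_on {0<..<R}. (norm (f n r - g r))\<^sup>2))) \<longlonglongrightarrow> 0"
      using tendsto_mult_left[OF tendsto_mult_left[OF L2_limD(3)[OF L], of "R\<^sup>2"], of "4 * pi"] by simp
    show "\<forall>\<^sub>F n in sequentially. (LINT x|lebesgue_on (ball (0 :: real^3) R). (norm (f n (norm x) - g (norm x)))\<^sup>2)
       \<le> 4 * pi * (R\<^sup>2 * (LINT r|lebesgue_on {0<..<R}. (norm (f n r - g r))\<^sup>2))"
      using radial_square_integrable(2)[of "\<lambda>r. f _ r - g r" R] L2_on_diff[OF L2_limD(1,2)[OF L]] m
      by (intro always_eventually allI) auto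
  qed auto
  then show ?thesis
    unfolding L2_lim_def using L2_on_radial[OF m(1) L2_limD(1)[OF L]] L2_on_radial[OF m(2) L2_limD(2)[OF L]] by simp
qed

text \<open>Modelled on fields homogeneous of degree 0: bounded, with derivative of order
  \<open>1 / norm x\<close>, and C^1 away from the origin. The director field and constant tensors
  are both covered.\<close>

definition angular_field ::
  "(real^3 \<Rightarrow> 'b::euclidean_space) \<Rightarrow> (real^3 \<Rightarrow> real^3 \<Rightarrow> 'b) \<Rightarrow> real \<Rightarrow> bool" where
  "angular_field Y D C \<longleftrightarrow> (\<forall>x. x \<noteq> 0 \<longrightarrow> (Y has_derivative D x) (at x) \<and> norm (Y x) \<le> C \<and>
      (\<forall>b\<in>Basis. norm (D x b) \<le> C / norm x)) \<and> (\<forall>b\<in>Basis. continuous_on (- {0}) (\<lambda>x. D x b))"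

text \<open>The product rule for \<open>h (norm x) *\<^sub>R Y x\<close>, where \<open>v\<close> is
  the derivative of \<open>h\<close> and \<open>(x \<bullet> b) / norm x\<close> that of the norm in
  direction \<open>b\<close>.\<close>

definition radial_partial ::
  "(real \<Rightarrow> real) \<Rightarrow> (real \<Rightarrow> real) \<Rightarrow> (real^3 \<Rightarrow> 'b::euclidean_space) \<Rightarrow> (real^3 \<Rightarrow> real^3 \<Rightarrow> 'b) \<Rightarrow>
    real^3 \<Rightarrow> real^3 \<Rightarrow> 'b" where
  "radial_partial h v Y D b x = (v (norm x) * ((x \<bullet> b) / norm x)) *\<^sub>R Y x + h (norm x) *\<^sub>R D x b"

lemma angular_fieldD:
  assumes "angular_field Y D C"
  shows "x \<noteq> 0 \<Longrightarrow> (Y has_derivative D x) (at x)" "x \<noteq> 0 \<Longrightarrow> norm (Y x) \<le> C"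
    "x \<noteq> 0 \<Longrightarrow> b \<in> Basis \<Longrightarrow> norm (D x b) \<le> C / norm x"
    "b \<in> Basis \<Longrightarrow> continuous_on (- {0}) (\<lambda>x. D x b)" "continuous_on (- {0}) Y" "C \<ge> 0"
proof -
  show "x \<noteq> 0 \<Longrightarrow> (Y has_derivative D x) (at x)" "x \<noteq> 0 \<Longrightarrow> norm (Y x) \<le> C"
    "x \<noteq> 0 \<Longrightarrow> b \<in> Basis \<Longrightarrow> norm (D x b) \<le> C / norm x"
    "b \<in> Basis \<Longrightarrow> continuous_on (- {0}) (\<lambda>x. D x b)" for x b
    using assms by (auto simp: angular_field_def)
  show "continuous_on (- {0}) Y"
  proof (rule has_derivative_continuous_on)
    fix x :: "real^3" assume "x \<in> - {0}"
    then show "(Y has_derivative D x) (at x within - {0})"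
      by - (rule has_derivative_at_withinI, use assms in \<open>simp add: angular_field_def\<close>)
  qed
  have "norm (Y (axis 1 1)) \<le> C" using assms by (simp add: angular_field_def axis_eq_0_iff)
  then show "C \<ge> 0" by (rule order_trans[OF norm_ge_zero])
qed

lemma borel_measurable_of_continuous_punctured:
  fixes f :: "'a::euclidean_space \<Rightarrow> 'b::euclidean_space"
  assumes "continuous_on (- {0}) f" shows "f \<in> borel_measurable borel"
proof -
  have "(\<lambda>x. if x \<in> {0} then f 0 else f x) \<in> borel_measurable borel"
    by (rule borel_measurable_continuous_on_if) (use assms in auto)
  moreover have "(\<lambda>x. if x \<in> {0} then f 0 else f x) = f" by auto
  ultimately show ?thesis by simp
qed

text \<open>A profile vanishing near 0 hides the singularity of \<open>Y\<close>: the product is 0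
  on a small ball and a product of C^1 functions off the origin, and these two open sets cover the
  space.\<close>

lemma C1_deriv_radial:
  fixes Y :: "real^3 \<Rightarrow> 'b::euclidean_space"
  assumes Y: "angular_field Y D C"
    and q: "\<And>r. (q has_real_derivative q' r) (at r)" "continuous_on UNIV q'"
    and \<epsilon>: "\<epsilon> > 0" "\<And>r. r < \<epsilon> \<Longrightarrow> q r = 0" "\<And>r. r < \<epsilon> \<Longrightarrow> q' r = 0"
  shows "C1_deriv (\<lambda>x. q (norm x) *\<^sub>R Y x) (\<lambda>x d. radial_partial q q' Y D d x)"
  unfolding C1_deriv_def radial_partial_def
proof (intro conjI allI ballI)
  have cq: "continuous_on S q" for S by (rule C1_derivD(3)[OF C1_deriv_realI[OF q]])
  fix x :: "real^3"
  show "((\<lambda>x. q (norm x) *\<^sub>R Y x) has_derivative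
      (\<lambda>d. (q' (norm x) * ((x \<bullet> d) / norm x)) *\<^sub>R Y x + q (norm x) *\<^sub>R D x d)) (at x)"
  proof (cases "norm x < \<epsilon>")
    case True
    have "((\<lambda>x. q (norm x) *\<^sub>R Y x) has_derivative (\<lambda>d. 0)) (at x)"
    proof (rule has_derivative_transform_within_open)
      show "((\<lambda>x. 0) has_derivative (\<lambda>d. 0)) (at x)" by simp
      show "open (ball (0 :: real^3) \<epsilon>)" by simp
    qed (use True \<epsilon> in auto)
    then show ?thesis using True \<epsilon> by simp
  next
    case False
    then have x: "x \<noteq> 0" using \<epsilon> by auto
    have "(q has_derivative (*) (q' (norm x))) (at (norm x))"
      using q(1) by (simp add: has_field_derivative_def)
    from has_derivative_compose[OF has_derivative_norm[OF x] this]
    have "((\<lambda>x. q (norm x)) has_derivative (\<lambda>d. q' (norm x) * (sgn x \<bullet> d))) (at x)"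
      by (simp add: inner_commute)
    from has_derivative_scaleR[OF this angular_fieldD(1)[OF Y x]]
    show ?thesis by (simp add: sgn_div_norm inner_commute add.commute divide_inverse mult.commute mult.left_commute)
  qed
next
  have cq: "continuous_on S q" for S by (rule C1_derivD(3)[OF C1_deriv_realI[OF q]])
  fix b :: "real^3" assume b: "b \<in> Basis"
  let ?f = "\<lambda>x. (q' (norm x) * ((x \<bullet> b) / norm x)) *\<^sub>R Y x + q (norm x) *\<^sub>R D x b"
  have "continuous_on (- {0} \<union> ball (0 :: real^3) \<epsilon>) ?f"
  proof (rule continuous_on_open_Un)
    show "continuous_on (- {0}) ?f"
      by (intro continuous_intros angular_fieldD(4,5)[OF Y] b continuous_on_compose2[OF q(2)] continuous_on_compose2[OF cq[of UNIV]]) auto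
    have "continuous_on (ball (0 :: real^3) \<epsilon>) (\<lambda>x. 0 :: 'b)" by simp
    then show "continuous_on (ball (0 :: real^3) \<epsilon>) ?f"
      by (rule continuous_on_eq) (use \<epsilon> in auto)
  qed auto
  moreover have "- {0} \<union> ball (0 :: real^3) \<epsilon> = UNIV" using \<epsilon>(1) by auto
  ultimately show "continuous_on UNIV ?f" by simp
qed

lemma L2_lim_scaleR_bounded_field:
  fixes f :: "nat \<Rightarrow> 'a::euclidean_space \<Rightarrow> real" and Z :: "'a \<Rightarrow> 'b::euclidean_space"
  assumes f: "L2_lim S f g" and Z: "Z \<in> borel_measurable (lebesgue_on S)" "AE x in lebesgue_on S. norm (Z x) \<le> C"
  shows "L2_lim S (\<lambda>n x. f n x *\<^sub>R Z x) (\<lambda>x. g x *\<^sub>R Z x)"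
proof -
  note L = L2_limD[OF f]
  note [measurable] = borel_measurable_of_L2_on[OF L(1)] borel_measurable_of_L2_on[OF L(2)] Z(1)
  have 1: "L2_on S (\<lambda>x. k x *\<^sub>R Z x)" if "L2_on S k" for k :: "'a \<Rightarrow> real"
  proof (rule L2_on_bound[OF _ that, where C=C])
    show "(\<lambda>x. k x *\<^sub>R Z x) \<in> borel_measurable (lebesgue_on S)"
      using borel_measurable_of_L2_on[OF that] by measurable
    show "AE x in lebesgue_on S. norm (k x *\<^sub>R Z x) \<le> C * norm (k x)"
      using Z(2) by eventually_elim (simp add: mult.commute[of C] mult_left_mono)
  qed
  have d: "L2_on S (\<lambda>x. f n x - g x)" for n by (intro L2_on_diff L)
  have "(\<lambda>n. LINT x|lebesgue_on S. (norm (f n x *\<^sub>R Z x - g x *\<^sub>R Z x))\<^sup>2) \<longlonglongrightarrow> 0"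
  proof (rule tendsto_sandwich[OF _ _ tendsto_const])
    show "(\<lambda>n. C\<^sup>2 * (LINT x|lebesgue_on S. (norm (f n x - g x))\<^sup>2)) \<longlonglongrightarrow> 0"
      using tendsto_mult_left[OF L(3), of "C\<^sup>2"] by simp
    have "(LINT x|lebesgue_on S. (norm (f n x *\<^sub>R Z x - g x *\<^sub>R Z x))\<^sup>2)
        \<le> (LINT x|lebesgue_on S. C\<^sup>2 * (norm (f n x - g x))\<^sup>2)" for n
    proof (rule integral_mono_AE)
      show "integrable (lebesgue_on S) (\<lambda>x. (norm (f n x *\<^sub>R Z x - g x *\<^sub>R Z x))\<^sup>2)"
        by (intro integrable_of_L2_on L2_on_diff 1 L)
      show "integrable (lebesgue_on S) (\<lambda>x. C\<^sup>2 * (norm (f n x - g x))\<^sup>2)"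
        using integrable_of_L2_on[OF d] by simp
      show "AE x in lebesgue_on S. (norm (f n x *\<^sub>R Z x - g x *\<^sub>R Z x))\<^sup>2 \<le> C\<^sup>2 * (norm (f n x - g x))\<^sup>2"
        using Z(2)
      proof eventually_elim
        case (elim x)
        have "norm (f n x *\<^sub>R Z x - g x *\<^sub>R Z x) \<le> C * norm (f n x - g x)"
          using mult_left_mono[OF elim, of "\<bar>f n x - g x\<bar>"]
          by (simp flip: scaleR_diff_left add: mult.commute)
        then show ?case by (metis norm_ge_zero power_mono power_mult_distrib)
      qed
    qed
    then show "\<forall>\<^sub>F n in sequentially. (LINT x|lebesgue_on S. (norm (f n x *\<^sub>R Z x - g x *\<^sub>R Z x))\<^sup>2)
        \<le> C\<^sup>2 * (LINT x|lebesgue_on S. (norm (f n x - g x))\<^sup>2)" using d[THEN integrable_of_L2_on] by simp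
  qed auto
  then show ?thesis unfolding L2_lim_def using 1 L by auto
qed

lemma AE_ball_nonzero: "AE x in lebesgue_on (ball (0 :: 'a::euclidean_space) R). x \<noteq> 0 \<and> x \<in> ball 0 R"
  by (subst AE_restrict_space_iff) (auto intro!: AE_completion eventually_mono[OF AE_lborel_singleton])

text \<open>Control of the derivative of the cutoff at the origin: \<open>4 / r\<close> is a
  majorant independent of the scale \<open>N\<close>, while the factor
  \<open>1 - smooth_step (N * r - 1)\<close> forces pointwise convergence to 0 as \<open>N\<close>
  grows.\<close>

lemma smooth_step_deriv_bound:
  fixes N r :: real
  assumes r: "r > 0" and N: "N > 0"
  defines "y \<equiv> max 0 (N * r - 1)"
  shows "0 \<le> N * (2 * y / (1 + y\<^sup>2)\<^sup>2)" "N * (2 * y / (1 + y\<^sup>2)\<^sup>2) \<le> 4 / r * (1 - smooth_step (N * r - 1))"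
proof -
  have y0: "y \<ge> 0" by (simp add: y_def)
  have q: "1 + y\<^sup>2 > 0" using add_pos_nonneg[of 1 "y\<^sup>2"] by simp
  show "0 \<le> N * (2 * y / (1 + y\<^sup>2)\<^sup>2)" using y0 N by simp
  have s: "1 - smooth_step (N * r - 1) = 1 / (1 + y\<^sup>2)"
    using q by (simp add: smooth_step_def y_def[symmetric] field_simps)
  have "N * r * y \<le> 2 * (1 + y\<^sup>2)"
  proof (cases "y = 0")
    case True then show ?thesis by simp
  next
    case False
    then have "N * r = y + 1" by (simp add: y_def max_def split: if_splits)
    moreover have "y \<le> 1 + y\<^sup>2" using zero_le_square[of "y - 1"] y0 by (simp add: power2_eq_square algebra_simps)
    ultimately show ?thesis by (simp add: power2_eq_square algebra_simps)
  qed
  then have "N * r * (2 * y) / (1 + y\<^sup>2)\<^sup>2 \<le> 4 * (1 + y\<^sup>2) / (1 + y\<^sup>2)\<^sup>2"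
    by (intro divide_right_mono) auto
  also have "\<dots> = 4 / (1 + y\<^sup>2)" using q unfolding power2_eq_square[of "1 + y\<^sup>2"]
    by (subst nonzero_mult_divide_mult_cancel_right) auto
  finally have "r * (N * (2 * y / (1 + y\<^sup>2)\<^sup>2)) \<le> 4 / (1 + y\<^sup>2)" by (simp add: ac_simps)
  moreover have "X \<le> 4 / r * (1 / A)" if "r * X \<le> 4 / A" for X A :: real
    using that r pos_le_divide_eq[OF r, of X "4 / A"] by (simp add: mult.commute)
  ultimately show "N * (2 * y / (1 + y\<^sup>2)\<^sup>2) \<le> 4 / r * (1 - smooth_step (N * r - 1))"
    unfolding s by blast
qed

text \<open>The field is approximated by C^1 fields with profile \<open>s n * p n\<close>, where
  \<open>p n\<close> approximates \<open>h\<close> and \<open>s n\<close> cuts off the origin.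
  Fields and derivatives converge in L2, so the pointwise product rule gives the weak derivative,
  and the approximants have compact support in the ball if \<open>h R = 0\<close>.\<close>

lemma radial_field_W12:
  fixes Y :: "real^3 \<Rightarrow> 'b::euclidean_space"
  assumes R: "R > 0" and h: "ac_on R h v" and Y: "angular_field Y D C"
  defines "u \<equiv> \<lambda>x. h (norm x) *\<^sub>R Y x"
  shows "b \<in> Basis \<Longrightarrow> L2_on (ball 0 R) (radial_partial h v Y D b)"
    "b \<in> Basis \<Longrightarrow> is_weak_partial (ball 0 R) u b (radial_partial h v Y D b)"
    "u \<in> W12 (ball 0 R)" "h R = 0 \<Longrightarrow> u \<in> W12_0 (ball 0 R)"
proof -
  let ?B = "ball (0 :: real^3) R"
  have B: "?B \<in> lmeasurable" by auto
  obtain p w :: "nat \<Rightarrow> real \<Rightarrow> real" and e \<delta> :: "nat \<Rightarrow> real" where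
    pw: "\<And>n r. (p n has_real_derivative w n r) (at r)" "\<And>n. continuous_on UNIV (w n)"
    "L2_lim {0<..<R} w v" "e \<longlonglongrightarrow> 0" "\<And>n r. r \<in> {0..R} \<Longrightarrow> \<bar>p n r - h r\<bar> \<le> e n"
    "\<And>n. \<delta> n < R" "\<And>n r. \<delta> n \<le> r \<Longrightarrow> p n r = h R" "\<And>n r. r \<le> 0 \<Longrightarrow> p n r = p n 0"
    by (rule ac_on_approx[OF R h]) (rule that)
  have ch: "continuous_on {0..R} h" by (rule ac_on_continuous[OF R h])
  have cp: "continuous_on S (p n)" for n S by (rule C1_derivD(3)[OF C1_deriv_realI[OF pw(1,2)]])
  have lim: "(\<lambda>n. p n r) \<longlonglongrightarrow> h r" if "r \<in> {0..R}" for r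
    using Lim_null_comparison[OF _ pw(4), of "\<lambda>n. p n r - h r"] pw(5)[OF that] LIM_zero_iff by auto
  have "bounded (h ` {0..R})" using ch by (auto intro!: compact_imp_bounded compact_continuous_image)
  then obtain Mh where Mh: "\<And>r. r \<in> {0..R} \<Longrightarrow> \<bar>h r\<bar> \<le> Mh" unfolding bounded_iff by (metis imageI real_norm_def)
  obtain Me where Me: "\<And>n. \<bar>e n\<bar> \<le> Me"
    using convergent_imp_Bseq[OF convergentI[OF pw(4)]] by (auto simp: Bseq_def)
  define M where "M = Mh + Me"
  have pb: "\<bar>p n r\<bar> \<le> M" if "r \<in> {0..R}" for n r
    using pw(5)[OF that, of n] Mh[OF that] Me[of n] by (simp add: M_def)
  have M0: "0 \<le> M" using order_trans[OF abs_ge_zero pb[of 0]] R by auto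
  define N where "N n = real (Suc n)" for n
  have N: "N n > 0" for n by (simp add: N_def)
  \<comment> \<open>Vanishes for \<open>r \<le> 1 / N n\<close> and tends to 1 at each positive
    \<open>r\<close>.\<close>
  define s where "s n r = smooth_step (N n * r - 1)" for n r
  define s' where "s' n r = N n * (2 * max 0 (N n * r - 1) / (1 + (max 0 (N n * r - 1))\<^sup>2)\<^sup>2)" for n r
  have ds: "(s n has_real_derivative s' n r) (at r)" for n r
    unfolding s_def s'_def
    by (rule DERIV_cong[OF DERIV_chain2[OF smooth_step_deriv]]) (auto intro!: derivative_eq_intros)
  have cs: "continuous_on UNIV (s n)" for n using ds by (intro DERIV_continuous_on) auto
  have cs': "continuous_on UNIV (s' n)" for n
    unfolding s'_def
    by (intro continuous_intros continuous_on_compose2[OF smooth_step_deriv_continuous[of UNIV]]) auto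
  have s_lim: "(\<lambda>n. s n r) \<longlonglongrightarrow> 1" if "r > 0" for r
    unfolding s_def
  proof (rule filterlim_compose[OF smooth_step_tendsto])
    have "filterlim N at_top sequentially"
      unfolding N_def by (rule filterlim_compose[OF filterlim_real_sequentially filterlim_Suc])
    from filterlim_tendsto_pos_mult_at_top[OF tendsto_const that this]
    have "filterlim (\<lambda>n. - 1 + r * N n) at_top sequentially"
      by (intro filterlim_tendsto_add_at_top[OF tendsto_const])
    then show "filterlim (\<lambda>n. N n * r - 1) at_top sequentially" by (simp add: mult.commute)
  qed
  have sb: "\<bar>s n r\<bar> \<le> 1" for n r using smooth_step_bounds by (simp add: s_def)
  have s'b: "\<bar>s' n r\<bar> \<le> 4 / r * (1 - s n r)" "\<bar>s' n r\<bar> \<le> 4 / r" if "r > 0" for n r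
  proof -
    show 1: "\<bar>s' n r\<bar> \<le> 4 / r * (1 - s n r)"
      using smooth_step_deriv_bound[OF that N, of n] unfolding s_def s'_def by linarith
    have "4 / r * (1 - s n r) \<le> 4 / r * 1"
      using that smooth_step_bounds(1) by (intro mult_left_mono) (auto simp: s_def)
    then show "\<bar>s' n r\<bar> \<le> 4 / r" using 1 by simp
  qed
  have s'_lim: "(\<lambda>n. s' n r) \<longlonglongrightarrow> 0" if "r > 0" for r
  proof (rule Lim_null_comparison)
    show "\<forall>\<^sub>F n in sequentially. norm (s' n r) \<le> 4 / r * (1 - s n r)" using s'b(1)[OF that] by simp
    show "(\<lambda>n. 4 / r * (1 - s n r)) \<longlonglongrightarrow> 0"
      using tendsto_mult_left[OF tendsto_diff[OF tendsto_const s_lim[OF that]], of "4 / r" 1] by simp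
  qed
  define q where "q n r = s n r * p n r" for n r
  define q' where "q' n r = s n r * w n r + s' n r * p n r" for n r
  have dq: "(q n has_real_derivative q' n r) (at r)" for n r
    unfolding q_def q'_def by (rule DERIV_cong[OF DERIV_mult[OF ds pw(1)]]) simp
  have cq': "continuous_on UNIV (q' n)" for n
    unfolding q'_def by (intro continuous_intros cs cs' pw(2) cp)
  have q0: "q n r = 0" "q' n r = 0" if "r < 1 / N n" for n r
  proof -
    have "N n * r - 1 \<le> 0" using that N[of n] by (simp add: field_simps)
    then show "q n r = 0" "q' n r = 0" by (simp_all add: q_def q'_def s_def s'_def smooth_step_bounds)
  qed
  define U where "U n x = q n (norm x) *\<^sub>R Y x" for n x
  have C1: "C1_deriv (U n) (\<lambda>x d. radial_partial (q n) (q' n) Y D d x)" for n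
    unfolding U_def using N[of n] by (intro C1_deriv_radial[OF Y dq cq', of "1 / N n"] q0) auto
  note Y0 = angular_fieldD[OF Y]
  have [measurable]: "Y \<in> borel_measurable borel" "\<And>b. b \<in> Basis \<Longrightarrow> (\<lambda>x. D x b) \<in> borel_measurable borel"
    using Y0 by (auto intro: borel_measurable_of_continuous_punctured)
  have [measurable]: "v \<in> borel_measurable borel" using ac_onD(1)[OF h] .
  have [measurable]: "w n \<in> borel_measurable borel" "p n \<in> borel_measurable borel"
    "s n \<in> borel_measurable borel" "s' n \<in> borel_measurable borel" for n
    using pw(2) cp cs cs' by (auto intro: borel_measurable_continuous_onI)
  have hn: "(\<lambda>x. h (norm x)) \<in> borel_measurable (lebesgue_on ?B)"
    by (rule continuous_imp_measurable_on_sets_lebesgue)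
      (auto intro!: continuous_on_compose2[OF ch] continuous_intros)
  have Ym: "Y \<in> borel_measurable (lebesgue_on ?B)" by (intro borel_measurable_lebesgue_onI) measurable
  have U_lim: "L2_lim ?B U u"
  proof (rule L2_lim_dominated)
    show "U n \<in> borel_measurable (lebesgue_on ?B)" for n
      by (rule continuous_imp_measurable_lebesgue_on[OF C1_derivD(3)[OF C1]])
    show "u \<in> borel_measurable (lebesgue_on ?B)" unfolding u_def using hn Ym by measurable
    show "L2_on ?B (\<lambda>x. M * C)" by (rule L2_on_const[OF B])
    show "AE x in lebesgue_on ?B. (\<lambda>n. U n x) \<longlonglongrightarrow> u x"
      using AE_ball_nonzero
    proof eventually_elim
      case (elim x)
      then have "(\<lambda>n. (s n (norm x) * p n (norm x)) *\<^sub>R Y x) \<longlonglongrightarrow> (1 * h (norm x)) *\<^sub>R Y x"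
        by (intro tendsto_intros s_lim lim) auto
      then show ?case by (simp add: U_def u_def q_def)
    qed
    show "AE x in lebesgue_on ?B. norm (U n x) \<le> norm (M * C)" for n
      using AE_ball_nonzero
    proof eventually_elim
      case (elim x)
      have "\<bar>s n (norm x) * p n (norm x)\<bar> * norm (Y x) \<le> (1 * M) * C"
        unfolding abs_mult using elim M0 by (intro mult_mono sb pb Y0) auto
      then show ?case using M0 Y0(6) by (simp add: U_def q_def)
    qed
  qed
  have V_lim: "L2_lim ?B (\<lambda>n x. radial_partial (q n) (q' n) Y D b x) (radial_partial h v Y D b)"
    if b: "b \<in> Basis" for b
  proof -
    note Db = borel_measurable_lebesgue_onI[OF \<open>\<And>b. b \<in> Basis \<Longrightarrow> (\<lambda>x. D x b) \<in> borel_measurable borel\<close>[OF b], of ?B]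
    define Z where "Z x = ((x \<bullet> b) / norm x) *\<^sub>R Y x" for x
    have Zm[measurable]: "Z \<in> borel_measurable borel" unfolding Z_def by measurable
    have Zb: "norm (Z x) \<le> C" if "x \<noteq> 0" for x
    proof -
      have "\<bar>x \<bullet> b\<bar> / norm x \<le> 1"
        using Cauchy_Schwarz_ineq2[of x b] b that by (simp add: divide_le_eq)
      from mult_mono[OF this Y0(2)[OF that]] show ?thesis by (simp add: Z_def)
    qed
    have ZAE: "AE x in lebesgue_on ?B. norm (Z x) \<le> C"
      using AE_ball_nonzero by eventually_elim (use Zb in auto)
    have 1: "L2_lim ?B (\<lambda>n x. s n (norm x) *\<^sub>R (w n (norm x) *\<^sub>R Z x)) (\<lambda>x. 1 *\<^sub>R (v (norm x) *\<^sub>R Z x))"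
    proof (rule L2_lim_scaleR[where K=1])
      show "L2_lim ?B (\<lambda>n x. w n (norm x) *\<^sub>R Z x) (\<lambda>x. v (norm x) *\<^sub>R Z x)"
        by (rule L2_lim_scaleR_bounded_field[OF L2_lim_radial[OF _ _ pw(3)] _ ZAE])
          (auto intro!: borel_measurable_lebesgue_onI)
      show "AE x in lebesgue_on ?B. (\<lambda>n. s n (norm x)) \<longlonglongrightarrow> 1"
        using AE_ball_nonzero by eventually_elim (auto intro: s_lim)
      show "(\<lambda>x. s n (norm x)) \<in> borel_measurable (lebesgue_on ?B)" for n
        by (intro borel_measurable_lebesgue_onI) measurable
    qed (use sb in auto)
    \<comment> \<open>The contribution of the cutoff: it disappears in the limit, being pointwise
      convergent to 0 and dominated by a multiple of \<open>1 / norm x\<close>.\<close>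
    have 2: "L2_lim ?B (\<lambda>n x. (s' n (norm x) * p n (norm x)) *\<^sub>R Z x) (\<lambda>x. 0)"
    proof (rule L2_lim_dominated)
      show "L2_on ?B (\<lambda>x. (4 * M * C) *\<^sub>R (1 / norm x))" by (intro L2_on_scaleR L2_on_inverse_norm)
      show "(\<lambda>x. (s' n (norm x) * p n (norm x)) *\<^sub>R Z x) \<in> borel_measurable (lebesgue_on ?B)" for n
        by (intro borel_measurable_lebesgue_onI) measurable
      show "AE x in lebesgue_on ?B. (\<lambda>n. (s' n (norm x) * p n (norm x)) *\<^sub>R Z x) \<longlonglongrightarrow> 0"
        using AE_ball_nonzero
      proof eventually_elim
        case (elim x)
        then have "(\<lambda>n. (s' n (norm x) * p n (norm x)) *\<^sub>R Z x) \<longlonglongrightarrow> (0 * h (norm x)) *\<^sub>R Z x"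
          by (intro tendsto_intros s'_lim lim) auto
        then show ?case by simp
      qed
      show "AE x in lebesgue_on ?B. norm ((s' n (norm x) * p n (norm x)) *\<^sub>R Z x) \<le> norm ((4 * M * C) *\<^sub>R (1 / norm x))" for n
        using AE_ball_nonzero
      proof eventually_elim
        case (elim x)
        have "\<bar>s' n (norm x) * p n (norm x)\<bar> * norm (Z x) \<le> (4 / norm x * M) * C"
          unfolding abs_mult using elim M0 by (intro mult_mono s'b pb Zb) auto
        then show ?case using M0 Y0(6) by (simp add: ac_simps)
      qed
    qed auto
    have 3: "L2_lim ?B (\<lambda>n x. (s n (norm x) * p n (norm x)) *\<^sub>R D x b) (\<lambda>x. h (norm x) *\<^sub>R D x b)"
    proof (rule L2_lim_dominated)
      show "L2_on ?B (\<lambda>x. (M * C) *\<^sub>R (1 / norm x))" by (intro L2_on_scaleR L2_on_inverse_norm)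
      have "(\<lambda>x. s n (norm x) * p n (norm x)) \<in> borel_measurable (lebesgue_on ?B)" for n
        by (intro borel_measurable_lebesgue_onI) measurable
      then show "(\<lambda>x. (s n (norm x) * p n (norm x)) *\<^sub>R D x b) \<in> borel_measurable (lebesgue_on ?B)" for n
        using Db by measurable
      show "(\<lambda>x. h (norm x) *\<^sub>R D x b) \<in> borel_measurable (lebesgue_on ?B)" using hn Db by measurable
      show "AE x in lebesgue_on ?B. (\<lambda>n. (s n (norm x) * p n (norm x)) *\<^sub>R D x b) \<longlonglongrightarrow> h (norm x) *\<^sub>R D x b"
        using AE_ball_nonzero
      proof eventually_elim
        case (elim x)
        then have "(\<lambda>n. (s n (norm x) * p n (norm x)) *\<^sub>R D x b) \<longlonglongrightarrow> (1 * h (norm x)) *\<^sub>R D x b"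
          by (intro tendsto_intros s_lim lim) auto
        then show ?case by simp
      qed
      show "AE x in lebesgue_on ?B. norm ((s n (norm x) * p n (norm x)) *\<^sub>R D x b) \<le> norm ((M * C) *\<^sub>R (1 / norm x))" for n
        using AE_ball_nonzero
      proof eventually_elim
        case (elim x)
        have "\<bar>s n (norm x) * p n (norm x)\<bar> * norm (D x b) \<le> (1 * M) * (C / norm x)"
          unfolding abs_mult using elim M0 b by (intro mult_mono sb pb Y0) auto
        then show ?case using M0 Y0(6) by (simp add: ac_simps)
      qed
    qed
    have eq1: "radial_partial (q n) (q' n) Y D b x = s n (norm x) *\<^sub>R (w n (norm x) *\<^sub>R Z x)
        + (s' n (norm x) * p n (norm x)) *\<^sub>R Z x + (s n (norm x) * p n (norm x)) *\<^sub>R D x b" for n x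
      by (simp add: radial_partial_def q_def q'_def Z_def distrib_right scaleR_add_left add_divide_distrib mult.assoc)
    have eq2: "radial_partial h v Y D b x = 1 *\<^sub>R (v (norm x) *\<^sub>R Z x) + 0 + h (norm x) *\<^sub>R D x b" for x
      by (simp add: radial_partial_def Z_def)
    show ?thesis
      using L2_lim_add[OF L2_lim_add[OF 1 2] 3] unfolding eq1[symmetric] eq2[symmetric] .
  qed
  have wp: "is_weak_partial ?B u b (radial_partial h v Y D b)" if b: "b \<in> Basis" for b
    by (rule is_weak_partial_L2_lim[OF B U_lim V_lim[OF b] b is_weak_partial_C1[OF C1 b]]) auto
  show "L2_on ?B (radial_partial h v Y D b)" if "b \<in> Basis" for b by (rule L2_limD(2)[OF V_lim[OF that]])
  show "is_weak_partial ?B u b (radial_partial h v Y D b)" if "b \<in> Basis" for b by (rule wp[OF that])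
  show "u \<in> W12 ?B" unfolding W12_def using L2_limD(2)[OF U_lim] L2_limD(2)[OF V_lim] wp by blast
  \<comment> \<open>The approximating profiles equal \<open>h R = 0\<close> beyond
    \<open>\<delta> n < R\<close>, so the same approximants are test functions.\<close>
  show "u \<in> W12_0 ?B" if hR: "h R = 0"
  proof (rule W12_0I[OF R _ U_lim _ wp])
    show "U n \<in> C1c ?B" for n
    proof (rule C1cI[OF C1])
      show "compact (cball (0 :: real^3) (max 0 (\<delta> n)))" "cball (0 :: real^3) (max 0 (\<delta> n)) \<subseteq> ?B"
        using pw(6)[of n] R by auto
      show "U n x = 0" if "x \<notin> cball 0 (max 0 (\<delta> n))" for x
        using that pw(7)[of n "norm x"] hR by (simp add: U_def q_def)
    qed
    show "L2_lim ?B (\<lambda>n x. frechet_derivative (U n) (at x) b) (radial_partial h v Y D b)"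
      if "b \<in> Basis" for b
      using V_lim[OF that] unfolding C1_derivD(4)[OF C1] .
  qed
qed

section \<open>An upper bound for the minimizing profile\<close>

lemma bulk_measurable_continuous:
  "continuous_on S h \<Longrightarrow> continuous_on S (\<lambda>r. bulk t (h r))"
  unfolding bulk_def by (intro continuous_intros) auto

text \<open>Fixes an explicit weak derivative and multiplies out r^2, so that the integrand has no
  singular term at 0 and its integrability is plain.\<close>

lemma radial_energy_ac_on:
  fixes t :: real
  assumes R: "R > 0" and h: "ac_on R h v"
  defines "e \<equiv> \<lambda>r. 1 / 2 * (r * v r)\<^sup>2 + 3 * (h r)\<^sup>2 + r\<^sup>2 * bulk t (h r)"
  shows "integrable (lebesgue_on {0<..<R}) e" "radial_energy R t h = (LINT r|lebesgue_on {0<..<R}. e r)"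
proof -
  let ?I = "{0<..<R}"
  have I: "?I \<in> lmeasurable" by auto
  note v = ac_onD(2)[OF h] and c = ac_on_continuous[OF R h]
  have rv: "L2_on ?I (\<lambda>r. r * v r)"
  proof (rule L2_on_bound[OF _ v, where C=R])
    show "(\<lambda>r. r * v r) \<in> borel_measurable (lebesgue_on ?I)"
      using ac_onD(1)[OF h] by (intro borel_measurable_lebesgue_onI) measurable
    show "AE x in lebesgue_on ?I. norm (x * v x) \<le> R * norm (v x)"
      by (intro AE_I2) (auto simp: space_restrict_space abs_mult intro: mult_right_mono)
  qed
  have "continuous_on {0..R} (\<lambda>r. 3 * (h r)\<^sup>2 + r\<^sup>2 * bulk t (h r))"
    by (intro continuous_intros c bulk_measurable_continuous)
  from L2_on_imp_integrable[OF L2_on_continuous_closed_interval[OF this] I] integrable_of_L2_on[OF rv]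
  show ie: "integrable (lebesgue_on ?I) e" unfolding e_def by (simp add: add.assoc)
  have ae: "AE r in lebesgue_on ?I. weak_partial ?I h 1 r = v r"
    using weak_partial_AE_eq[of "R / 2" "R / 2" v h 1] R v ac_on_weak_partial(1)[OF R h]
    unfolding interval_eq_ball[symmetric] by simp
  have wm: "weak_partial ?I h 1 \<in> borel_measurable (lebesgue_on ?I)"
    using W12_weak_partial(1)[OF ac_on_weak_partial(2)[OF R h], of 1] by (auto dest: borel_measurable_of_L2_on)
  show "radial_energy R t h = (LINT r|lebesgue_on ?I. e r)"
    unfolding radial_energy_def
  proof (rule integral_cong_AE)
    have [measurable]: "h \<in> borel_measurable (lebesgue_on ?I)" "(\<lambda>r. bulk t (h r)) \<in> borel_measurable (lebesgue_on ?I)"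
      "(\<lambda>r. r) \<in> borel_measurable (lebesgue_on ?I)"
      by (intro measurable_of_continuous_closed_interval c bulk_measurable_continuous continuous_on_id)+
    note [measurable] = wm
    show "(\<lambda>r. r\<^sup>2 * (1 / 2 * (weak_partial ?I h 1 r)\<^sup>2 + 3 * (h r)\<^sup>2 / r\<^sup>2 + bulk t (h r)))
        \<in> borel_measurable (lebesgue_on ?I)" by measurable
    show "e \<in> borel_measurable (lebesgue_on ?I)" using ie by auto
    have "AE r in lebesgue_on ?I. r > 0" by (intro AE_I2) (auto simp: space_restrict_space)
    with ae show "AE r in lebesgue_on ?I. r\<^sup>2 * (1 / 2 * (weak_partial ?I h 1 r)\<^sup>2 + 3 * (h r)\<^sup>2 / r\<^sup>2 + bulk t (h r)) = e r"
      by eventually_elim (simp add: e_def field_simps power2_eq_square)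
  qed
qed

section \<open>Competitors by gluing and the comparison principle\<close>

lemma ac_on_C1:
  assumes U: "\<And>r. (U has_real_derivative U' r) (at r)" "continuous_on UNIV U'"
  shows "ac_on R U U'"
  unfolding ac_on_def
proof (intro conjI ballI)
  show "U' \<in> borel_measurable borel" using U(2) by (rule borel_measurable_continuous_onI)
  show "L2_on {0<..<R} U'" by (intro L2_on_continuous_closed_interval continuous_on_subset[OF U(2)]) auto
  show "U r = U R - integral {r..R} U'" if "r \<in> {0..R}" for r
  proof -
    have "(U' has_integral (U R - U r)) {r..R}"
      by (rule fundamental_theorem_of_calculus)
        (use that U(1) in \<open>auto simp: has_real_derivative_iff_has_vector_derivative[symmetric] intro: has_field_derivative_at_within\<close>)
    then show ?thesis by (simp add: integral_unique)
  qed
qed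

lemma ac_on_integral:
  assumes "ac_on R h v" "0 \<le> a" "a \<le> b" "b \<le> R"
  shows "integral {a..b} v = h b - h a"
proof -
  have "integral {a..b} v + integral {b..R} v = integral {a..R} v"
    using assms by (intro Henstock_Kurzweil_Integration.integral_combine L2_interval_integrable_on[OF ac_onD(2)[OF assms(1)]]) auto
  moreover have "integral {a..R} v = h R - h a" "integral {b..R} v = h R - h b"
    using ac_onD(3)[OF assms(1), of a] ac_onD(3)[OF assms(1), of b] assms by linarith+
  ultimately show ?thesis by linarith
qed

text \<open>Gluing at equal values creates no jump, so the glued derivative still integrates to the
  glued function. The alternative \<open>\<alpha> = 0\<close> reflects that the left end of the
  interval carries no boundary condition.\<close>

lemma ac_on_splice:
  assumes R: "R > 0" and h: "ac_on R h v" and k: "ac_on R k w"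
    and ab: "0 \<le> \<alpha>" "\<alpha> < \<beta>" "\<beta> \<le> R" and match: "k \<beta> = h \<beta>" "\<alpha> = 0 \<or> k \<alpha> = h \<alpha>"
  shows "ac_on R (\<lambda>r. if r \<in> {\<alpha>..\<beta>} then k r else h r) (\<lambda>r. if r \<in> {\<alpha>..\<beta>} then w r else v r)"
    (is "ac_on R ?k ?w")
  unfolding ac_on_def
proof (intro conjI ballI)
  note [measurable] = ac_onD(1)[OF h] ac_onD(1)[OF k]
  show m: "?w \<in> borel_measurable borel" by measurable
  show L: "L2_on {0<..<R} ?w"
  proof (rule L2_on_bound[where C=1])
    show "?w \<in> borel_measurable (lebesgue_on {0<..<R})" by (rule borel_measurable_lebesgue_onI[OF m])
    have "L2_on {0<..<R} (\<lambda>r. \<bar>f r\<bar>)" if "L2_on {0<..<R} f" for f :: "real \<Rightarrow> real"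
      using borel_measurable_of_L2_on[OF that] by (intro L2_on_bound[OF _ that, where C=1]) auto
    then show "L2_on {0<..<R} (\<lambda>r. \<bar>w r\<bar> + \<bar>v r\<bar>)"
      using ac_onD(2)[OF h] ac_onD(2)[OF k] by (intro L2_on_add)
  qed auto
  have io: "?w integrable_on {a..b}" if "0 \<le> a" "b \<le> R" for a b
    by (rule L2_interval_integrable_on[OF L that])
  fix r assume r: "r \<in> {0..R}"
  have kR: "?k R = h R" using match(1) ab by auto
  have outer: "integral {a..b} ?w = h b - h a" if "0 \<le> a" "a \<le> b" "b \<le> R" "b \<le> \<alpha> \<or> \<beta> \<le> a" for a b
  proof -
    have "integral {a..b} ?w = integral {a..b} v"
      by (rule integral_spike[of "{\<alpha>, \<beta>}"]) (use that ab in auto)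
    then show ?thesis using ac_on_integral[OF h that(1-3)] by simp
  qed
  have inner: "integral {a..\<beta>} ?w = k \<beta> - k a" if "\<alpha> \<le> a" "a \<le> \<beta>" for a
  proof -
    have "integral {a..\<beta>} ?w = integral {a..\<beta>} w"
      by (rule integral_cong) (use that in auto)
    then show ?thesis using ac_on_integral[OF k, of a \<beta>] that ab by simp
  qed
  consider "r > \<beta>" | "\<alpha> \<le> r" "r \<le> \<beta>" | "r < \<alpha>" by linarith
  then show "?k r = ?k R - integral {r..R} ?w"
  proof cases
    case 1
    then show ?thesis using outer[of r R] r ab unfolding kR by simp
  next
    case 2
    have "integral {r..\<beta>} ?w + integral {\<beta>..R} ?w = integral {r..R} ?w"
      using 2 ab r by (intro Henstock_Kurzweil_Integration.integral_combine io) auto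
    then show ?thesis using inner[OF 2] outer[of \<beta> R] 2 ab match unfolding kR by simp
  next
    case 3
    have "integral {r..\<alpha>} ?w + integral {\<alpha>..\<beta>} ?w = integral {r..\<beta>} ?w"
      using 3 ab r by (intro Henstock_Kurzweil_Integration.integral_combine io) auto
    moreover have "integral {r..\<beta>} ?w + integral {\<beta>..R} ?w = integral {r..R} ?w"
      using 3 ab r by (intro Henstock_Kurzweil_Integration.integral_combine io) auto
    ultimately show ?thesis using inner[of \<alpha>] outer[of \<beta> R] outer[of r \<alpha>] 3 ab match r unfolding kR by auto
  qed
qed

lemma integral_pos_of_pos_on_interval:
  fixes f :: "real \<Rightarrow> real"
  assumes f: "integrable (lebesgue_on {0<..<R}) f" "AE x in lebesgue_on {0<..<R}. f x \<ge> 0"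
    and pos: "\<And>x. a < x \<Longrightarrow> x < b \<Longrightarrow> f x > 0" and ab: "0 \<le> a" "a < b" "b \<le> R"
  shows "(LINT x|lebesgue_on {0<..<R}. f x) > 0"
proof (rule ccontr)
  assume "\<not> ?thesis"
  then have "(LINT x|lebesgue_on {0<..<R}. f x) = 0" using integral_nonneg_AE[OF f(2)] by simp
  then have "AE x in lebesgue_on {0<..<R}. f x = 0" using integral_nonneg_eq_0_iff_AE[OF f] by simp
  then have "AE x in lebesgue. x \<in> {0<..<R} \<longrightarrow> f x = 0" by (subst (asm) AE_restrict_space_iff) auto
  then have "AE x in lebesgue. x \<notin> {a<..<b}"
    by eventually_elim (use pos ab in force)
  then have "negligible {a<..<b}" by (subst negligible_iff_null_sets, subst AE_iff_null_sets) auto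
  then show False using ab open_not_negligible[of "{a<..<b}"] by auto
qed

lemma first_zero:
  fixes f :: "real \<Rightarrow> real"
  assumes "continuous_on {c..d} f" "c \<le> d" "f c > 0" "f d \<le> 0"
  obtains z where "c < z" "z \<le> d" "f z = 0" "\<And>r. c \<le> r \<Longrightarrow> r < z \<Longrightarrow> f r > 0"
proof -
  let ?S = "{r \<in> {c..d}. f r \<le> 0}"
  have "closed ?S" using assms(1) by (intro continuous_on_closed_Collect_le) auto
  then have "compact ?S" using compact_Int_closed[of "{c..d}" ?S] by (simp add: Int_absorb1 inf.absorb2 subset_iff Int_def cong: conj_cong)
  moreover have "?S \<noteq> {}" using assms by auto
  ultimately obtain z where z: "z \<in> ?S" "\<And>r. r \<in> ?S \<Longrightarrow> z \<le> r"
    using compact_attains_inf[of ?S] by blast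
  have pos: "f r > 0" if "c \<le> r" "r < z" for r using z(2)[of r] z(1) that by force
  have cz: "c < z" using z(1) assms(3) by (cases "z = c") auto
  have "f z = 0"
  proof (rule ccontr)
    assume "f z \<noteq> 0"
    then have "f z < 0" using z(1) by auto
    then have "\<exists>x\<ge>c. x \<le> z \<and> f x = 0"
      using assms z(1) cz by (intro IVT2') (auto intro: continuous_on_subset)
    then obtain x where x: "c \<le> x" "x \<le> z" "f x = 0" by blast
    then show False using pos[of x] \<open>f z < 0\<close> by (cases "x = z") auto
  qed
  then show ?thesis using that[OF cz _ _ pos] z(1) by auto
qed

lemma last_zero:
  fixes f :: "real \<Rightarrow> real"
  assumes "continuous_on {c..d} f" "c \<le> d" "f d > 0" "f c \<le> 0"
  obtains z where "c \<le> z" "z < d" "f z = 0" "\<And>r. z < r \<Longrightarrow> r \<le> d \<Longrightarrow> f r > 0"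
proof -
  have "continuous_on {- d..- c} (\<lambda>x. f (- x))"
    by (rule continuous_on_compose2[OF assms(1)]) (auto intro: continuous_intros)
  from first_zero[OF this] assms obtain z where z: "- d < z" "z \<le> - c" "f (- z) = 0"
    "\<And>r. - d \<le> r \<Longrightarrow> r < z \<Longrightarrow> f (- r) > 0" by auto
  show ?thesis using that[of "- z"] z(1-3) z(4)[of "- _"] by auto
qed

text \<open>
  If \<open>\<bar>h\<bar>\<close> exceeded \<open>U\<close> somewhere, replacing \<open>h\<close> by \<open>\<plusminus> U\<close> on a component of \<open>{\<bar>h\<bar> > U}\<close> would lower
  the energy: this is Picone's inequality for the logarithmic derivative \<open>m / r\<close> of the
  supersolution \<open>U\<close>.
\<close>
lemma minimizer_le_supersolution:
  assumes R: "R > 0" and min: "is_arg_min (radial_energy R t) (\<lambda>g. g \<in> radial_class R) h"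
    and \<rho>: "0 < \<rho>" "\<rho> \<le> R"
    and U: "\<And>r. (U has_real_derivative U' r) (at r)" "continuous_on UNIV U'" "\<And>r. U r \<ge> 0"
    and m: "\<And>r. (m has_real_derivative m' r) (at r)" "continuous_on UNIV m'"
    and Um: "\<And>r. 0 < r \<Longrightarrow> r < \<rho> \<Longrightarrow> r * U' r = m r * U r"
    and super: "\<And>r. 0 < r \<Longrightarrow> r < \<rho> \<Longrightarrow> m r + r * m' r + (m r)\<^sup>2 < 6 + r\<^sup>2 * q r"
    and bulk: "\<And>r. 0 < r \<Longrightarrow> r < \<rho> \<Longrightarrow> U r \<le> \<bar>h r\<bar> \<Longrightarrow>
        q r / 2 * ((h r)\<^sup>2 - (U r)\<^sup>2) \<le> bulk t (h r) - bulk t (sgn (h r) * U r)"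
    and bdry: "\<bar>h \<rho>\<bar> \<le> U \<rho>" and r: "r \<in> {0..\<rho>}"
  shows "\<bar>h r\<bar> \<le> U r"
proof (rule ccontr)
  assume "\<not> \<bar>h r\<bar> \<le> U r"
  then have r0: "U r < \<bar>h r\<bar>" by simp
  let ?I = "{0<..<R}"
  have hc: "h \<in> W12 ?I" "continuous_on {0..R} h" "h R = 1"
    and hmin: "\<And>g. g \<in> radial_class R \<Longrightarrow> radial_energy R t h \<le> radial_energy R t g"
    using min by (auto simp: is_arg_min_def radial_class_def not_less)
  obtain v where v: "ac_on R h v" using W12_imp_ac_on[OF R hc(1,2)] .
  \<comment> \<open>The sign allows both cases \<open>h > U\<close> and \<open>h < - U\<close> to be
    treated at once; the competitor is \<open>s * U\<close>.\<close>
  define s where "s = sgn (h r)"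
  have s: "s = 1 \<or> s = -1" "s * s = 1" using r0 U(3)[of r] by (auto simp: s_def sgn_if)
  have sh: "s * h r = \<bar>h r\<bar>" by (simp add: s_def sgn_if)
  define f where "f x = s * h x - U x" for x
  have cU: "continuous_on S U" for S by (rule C1_derivD(3)[OF C1_deriv_realI[OF U(1,2)]])
  have cf: "continuous_on S f" if "S \<subseteq> {0..R}" for S
    unfolding f_def by (intro continuous_intros continuous_on_subset[OF hc(2) that] cU)
  have fr: "f r > 0" using r0 sh by (simp add: f_def)
  have f\<rho>: "f \<rho> \<le> 0" using bdry s by (auto simp: f_def)
  obtain \<beta> where b: "r < \<beta>" "\<beta> \<le> \<rho>" "f \<beta> = 0" "\<And>x. r \<le> x \<Longrightarrow> x < \<beta> \<Longrightarrow> f x > 0"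
    using first_zero[of r \<rho> f] cf[of "{r..\<rho>}"] r \<rho> fr f\<rho> by auto
  \<comment> \<open>The component of the set where \<open>f > 0\<close> may reach down to the
    origin; then \<open>\<alpha> = 0\<close> and the values there need not match.\<close>
  obtain \<alpha> where a: "0 \<le> \<alpha>" "\<alpha> \<le> r" "\<alpha> = 0 \<or> f \<alpha> = 0" "\<And>x. \<alpha> < x \<Longrightarrow> x \<le> r \<Longrightarrow> f x > 0"
  proof (cases "\<exists>c\<in>{0..r}. f c \<le> 0")
    case True
    then obtain c where c: "0 \<le> c" "c \<le> r" "f c \<le> 0" by auto
    obtain z where "c \<le> z" "z < r" "f z = 0" "\<And>x. z < x \<Longrightarrow> x \<le> r \<Longrightarrow> f x > 0"
      using last_zero[of c r f] cf[of "{c..r}"] c r \<rho> fr by auto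
    then show ?thesis using that[of z] c by auto
  next
    case False
    then show ?thesis using that[of 0] r by (auto simp: not_le)
  qed
  have fpos: "f x > 0" if "\<alpha> < x" "x < \<beta>" for x using a(4)[of x] b(4)[of x] that by linarith
  have ab: "\<alpha> < \<beta>" using a b by simp
  define k where "k x = (if x \<in> {\<alpha>..\<beta>} then s * U x else h x)" for x
  define w where "w x = (if x \<in> {\<alpha>..\<beta>} then s * U' x else v x)" for x
  have matchf: "s * U x = h x" if "f x = 0" for x
    using that s by (auto simp: f_def)
  have sU: "ac_on R (\<lambda>x. s * U x) (\<lambda>x. s * U' x)"
    by (rule ac_on_C1) (auto intro!: derivative_eq_intros U(1) continuous_intros U(2))
  have kw: "ac_on R k w"
    unfolding k_def[abs_def] w_def[abs_def]
    by (rule ac_on_splice[OF R v sU]) (use a(1,3) ab b(2,3) \<rho> matchf in auto)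
  have kR: "k R = 1" using matchf[OF b(3)] b(2) \<rho> hc(3) by (cases "\<beta> = R") (auto simp: k_def)
  have "k \<in> radial_class R"
    unfolding radial_class_def using ac_on_weak_partial(2)[OF R kw] ac_on_continuous[OF R kw] kR by simp
  from hmin[OF this] have le: "radial_energy R t h \<le> radial_energy R t k" .
  define e where "e h v x = 1 / 2 * (x * v x)\<^sup>2 + 3 * (h x)\<^sup>2 + x\<^sup>2 * bulk t (h x)" for h v :: "real \<Rightarrow> real" and x
  note eh = radial_energy_ac_on[OF R v, of t, folded e_def]
  note ek = radial_energy_ac_on[OF R kw, of t, folded e_def]
  have Uac: "ac_on R U U'" by (rule ac_on_C1[OF U(1,2)])
  \<comment> \<open>Picone's boundary weight. The derivative of \<open>?P\<close> times the
    difference of the squares of \<open>h\<close> and \<open>U\<close> integrates to 0 over the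
    component: the squares agree at \<open>\<beta>\<close>, and at \<open>\<alpha>\<close> they
    agree or the weight vanishes because \<open>\<alpha> = 0\<close>.\<close>
  let ?P = "\<lambda>x. x * m x" and ?P' = "\<lambda>x. m x + x * m' x"
  have dP: "(?P has_real_derivative ?P' x) (at x)" for x
    by (auto intro!: derivative_eq_intros m(1))
  have cP: "continuous_on UNIV ?P'"
    by (intro continuous_intros m(2) C1_derivD(3)[OF C1_deriv_realI[OF m]])
  have \<alpha>\<beta>: "0 \<le> \<alpha>" "\<alpha> \<le> \<beta>" "\<beta> \<le> R" using a b ab \<rho> by auto
  note bh = ac_on_by_parts[OF R v \<alpha>\<beta> dP cP] and bU = ac_on_by_parts[OF R Uac \<alpha>\<beta> dP cP]
  define G where "G h v x = indicator {\<alpha>..\<beta>} x * (2 * ?P x * h x * v x + ?P' x * (h x)\<^sup>2)" for h v :: "real \<Rightarrow> real" and x :: real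
  note bh = bh[folded G_def] and bU = bU[folded G_def]
  have sq: "(h x)\<^sup>2 = (U x)\<^sup>2" if "f x = 0" for x
    using matchf[OF that] s by (metis mult_1 power2_eq_square power_mult_distrib)
  have G0: "(LINT x|lebesgue_on ?I. G h v x - G U U' x) = 0"
    using bh bU sq[OF b(3)] a(3) sq[of \<alpha>] by auto
  \<comment> \<open>Twice the energy difference minus a term of integral 0. Its integral is
    nonpositive by minimality, while its integrand turns out to be positive on the
    component.\<close>
  define \<Delta> where "\<Delta> x = 2 * (e h v x - e k w x) - (G h v x - G U U' x)" for x
  have i\<Delta>: "integrable (lebesgue_on ?I) \<Delta>" unfolding \<Delta>_def using eh(1) ek(1) bh(1) bU(1) by simp
  have I\<Delta>: "(LINT x|lebesgue_on ?I. \<Delta> x) \<le> 0"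
  proof -
    have "(LINT x|lebesgue_on ?I. \<Delta> x) = 2 * (radial_energy R t h - radial_energy R t k)"
      unfolding \<Delta>_def using eh ek bh(1) bU(1) G0 by simp
    then show ?thesis using le by simp
  qed
  have \<Delta>pos: "\<Delta> x > 0" if x: "\<alpha> < x" "x < \<beta>" for x
  proof -
    have x0: "0 < x" "x < \<rho>" using x a b by auto
    have fx: "s * h x > U x" using fpos[OF x] by (simp add: f_def)
    then have shx: "s * h x > 0" using U(3)[of x] by linarith
    then have habs: "\<bar>h x\<bar> = s * h x" "sgn (h x) = s" using s(1) by auto
    have h2: "(h x)\<^sup>2 = (s * h x)\<^sup>2" using s by (auto simp: power2_eq_square)
    have gt: "(h x)\<^sup>2 - (U x)\<^sup>2 > 0"
      unfolding h2 using fx U(3)[of x] by (simp add: power_strict_mono)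
    have e1: "e k w x = 1 / 2 * (m x * U x)\<^sup>2 + 3 * (U x)\<^sup>2 + x\<^sup>2 * bulk t (s * U x)"
    proof -
      have "(x * (s * U' x))\<^sup>2 = (m x * U x)\<^sup>2"
        using s Um[OF x0] by (auto simp: mult.left_commute power_mult_distrib)
      moreover have "(s * U x)\<^sup>2 = (U x)\<^sup>2" using s by auto
      ultimately show ?thesis using x by (simp add: e_def k_def w_def)
    qed
    have e2: "G h v x - G U U' x = 2 * (m x * h x) * (x * v x) - 2 * (m x * U x)\<^sup>2
        + (m x + x * m' x) * ((h x)\<^sup>2 - (U x)\<^sup>2)"
    proof -
      have "2 * (x * m x) * U x * U' x = 2 * (m x * U x) * (x * U' x)" by simp
      also have "\<dots> = 2 * (m x * U x)\<^sup>2" unfolding Um[OF x0] by (simp add: power2_eq_square)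
      finally show ?thesis using x by (simp add: G_def algebra_simps)
    qed
    have sqn: "0 \<le> (x * v x - m x * h x)\<^sup>2" by simp
    have q: "x\<^sup>2 * (q x * ((h x)\<^sup>2 - (U x)\<^sup>2)) \<le> x\<^sup>2 * (2 * (bulk t (h x) - bulk t (s * U x)))"
      using bulk[OF x0] fx habs by (intro mult_left_mono) auto
    have strict: "(m x + x * m' x + (m x)\<^sup>2) * ((h x)\<^sup>2 - (U x)\<^sup>2) < (6 + x\<^sup>2 * q x) * ((h x)\<^sup>2 - (U x)\<^sup>2)"
      by (rule mult_strict_right_mono[OF super[OF x0] gt])
    \<comment> \<open>The mixed term of the weight completes the square of
      \<open>x * v x - m x * h x\<close>; everything else is multiplied by the difference of the
      squares of \<open>h\<close> and \<open>U\<close>, or bounded below by it through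
      \<open>q\<close>.\<close>
    have "\<Delta> x = (x * v x - m x * h x)\<^sup>2 + x\<^sup>2 * (2 * (bulk t (h x) - bulk t (s * U x)))
        + 6 * ((h x)\<^sup>2 - (U x)\<^sup>2) - (m x + x * m' x + (m x)\<^sup>2) * ((h x)\<^sup>2 - (U x)\<^sup>2)"
      unfolding \<Delta>_def e1 e2 by (simp add: e_def power2_eq_square algebra_simps)
    moreover have "(6 + x\<^sup>2 * q x) * ((h x)\<^sup>2 - (U x)\<^sup>2)
        = 6 * ((h x)\<^sup>2 - (U x)\<^sup>2) + x\<^sup>2 * (q x * ((h x)\<^sup>2 - (U x)\<^sup>2))"
      by (simp add: algebra_simps)
    ultimately show ?thesis using sqn q strict by linarith
  qed
  have \<Delta>0: "\<Delta> x = 0" if "x \<notin> {\<alpha>..\<beta>}" for x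
    using that by (auto simp: \<Delta>_def e_def G_def k_def w_def)
  have "AE x in lebesgue. x \<noteq> \<alpha>" "AE x in lebesgue. x \<noteq> \<beta>" by (auto intro: AE_completion AE_lborel_singleton)
  then have "AE x in lebesgue. x \<in> ?I \<longrightarrow> \<Delta> x \<ge> 0"
  proof eventually_elim
    case (elim x)
    show ?case
    proof (cases "\<alpha> < x \<and> x < \<beta>")
      case True
      then show ?thesis using \<Delta>pos[of x] by simp
    next
      case False
      then have "x \<notin> {\<alpha>..\<beta>}" using elim by auto
      then show ?thesis using \<Delta>0 by simp
    qed
  qed
  then have nnAE: "AE x in lebesgue_on ?I. \<Delta> x \<ge> 0" by (subst AE_restrict_space_iff) auto
  have "(LINT x|lebesgue_on ?I. \<Delta> x) > 0"
    by (rule integral_pos_of_pos_on_interval[where a=\<alpha> and b=\<beta>, OF i\<Delta> nnAE \<Delta>pos]) (use a(1) ab b(2) \<rho> in auto)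
  then show False using I\<Delta> by simp
qed

section \<open>Estimates for the coefficients and the bulk potential\<close>

text \<open>\<open>h_plus t\<close> is a root of \<open>2 * x^2 = 3 * x + t\<close>, so the quartic
  coefficient is an affine function of the cubic one, and smallness of \<open>h_plus t / t\<close>
  controls both.\<close>

lemma landau_coefficients:
  assumes "t > 1"
  shows "h_plus t / t > 0" "4 * ((h_plus t)\<^sup>2 / (2 * t)) = 3 * (h_plus t / t) + 1"
proof -
  have s: "(sqrt (9 + 8 * t))\<^sup>2 = 9 + 8 * t" using assms by simp
  have p2: "2 * (h_plus t)\<^sup>2 = 3 * h_plus t + t"
    unfolding h_plus_def using s by (simp add: power2_eq_square field_simps)
  have "sqrt (9 + 8 * t) \<ge> 0" using assms by simp
  then show "h_plus t / t > 0" using assms by (simp add: h_plus_def add_pos_nonneg)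
  show "4 * ((h_plus t)\<^sup>2 / (2 * t)) = 3 * (h_plus t / t) + 1" using p2 assms by (simp add: field_simps)
qed

lemma landau_coefficient_le:
  assumes "t \<ge> 200" shows "h_plus t / t \<le> 0.054"
proof -
  \<comment> \<open>The bound 0.054 is the value at \<open>t = 200\<close> rounded up. Here 0.216 is
    4 times 0.054, and the product is the square of \<open>0.216 * t - 3\<close> minus
    \<open>9 + 8 * t\<close>; it is nonnegative from about \<open>t = 199.3\<close> on.\<close>
  have "0 \<le> t * (0.046656 * t - 9.296)" using assms by (intro mult_nonneg_nonneg) auto
  then have "9 + 8 * t \<le> (0.216 * t - 3)\<^sup>2" by (simp add: power2_eq_square algebra_simps)
  then have "sqrt (9 + 8 * t) \<le> 0.216 * t - 3" using assms by (intro real_le_lsqrt) auto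
  then show ?thesis using assms by (simp add: h_plus_def divide_le_eq)
qed

text \<open>Only the cubic term feels the sign of \<open>y\<close>; taking its worst sign reduces
  everything to \<open>\<bar>y\<bar>\<close>.\<close>

lemma bulk_diff:
  assumes t: "t > 1" and y: "y \<noteq> 0"
  shows "bulk t y - bulk t (sgn y * U) \<ge> - (\<bar>y\<bar>\<^sup>2 - U\<^sup>2) / 2 - h_plus t / t * \<bar>\<bar>y\<bar> ^ 3 - U ^ 3\<bar>
      + (h_plus t)\<^sup>2 / (2 * t) * (\<bar>y\<bar> ^ 4 - U ^ 4)"
proof -
  define a b where "a = h_plus t / t" and "b = (h_plus t)\<^sup>2 / (2 * t)"
  have a: "a > 0" using landau_coefficients[OF t] by (simp add: a_def)
  have e: "(sgn y * U)\<^sup>2 = U\<^sup>2" "(sgn y * U) ^ 3 = sgn y * U ^ 3" "(sgn y * U) ^ 4 = U ^ 4"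
    "y ^ 3 = sgn y * \<bar>y\<bar> ^ 3" "\<bar>y\<bar> ^ 4 = y ^ 4"
    using y by (auto simp: sgn_if power_mult_distrib)
  have "bulk t y - bulk t (sgn y * U) = - (y\<^sup>2 - U\<^sup>2) / 2 - a * (sgn y * (\<bar>y\<bar> ^ 3 - U ^ 3)) + b * (y ^ 4 - U ^ 4)"
    unfolding bulk_def a_def[symmetric] b_def[symmetric] e(1-4) by (simp add: algebra_simps diff_divide_distrib add_divide_distrib)
  moreover have "a * (sgn y * (\<bar>y\<bar> ^ 3 - U ^ 3)) \<le> a * \<bar>\<bar>y\<bar> ^ 3 - U ^ 3\<bar>"
    using a y by (intro mult_left_mono) (auto simp: sgn_if)
  ultimately show ?thesis unfolding a_def[symmetric] b_def[symmetric] e(5) by simp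
qed

text \<open>The constant 1 with \<open>m = 0\<close> and \<open>q = 0\<close>: the strict inequality
  becomes \<open>0 < 6\<close>, and the bulk condition holds because the potential is nonnegative
  and vanishes at 1.\<close>

lemma minimizer_le_1:
  assumes R: "R > 0" and t: "t > 1" and min: "is_arg_min (radial_energy R t) (\<lambda>g. g \<in> radial_class R) h"
    and r: "r \<in> {0..R}"
  shows "\<bar>h r\<bar> \<le> 1"
proof (rule minimizer_le_supersolution[OF R min R order_refl, where U="\<lambda>_. 1" and U'="\<lambda>_. 0" and m="\<lambda>_. 0" and m'="\<lambda>_. 0" and q="\<lambda>_. 0"])
  fix x assume y: "1 \<le> \<bar>h x\<bar>"
  have "h x \<noteq> 0" using y by auto
  from bulk_diff[OF t this, of 1]
  have "bulk t (h x) - bulk t (sgn (h x) * 1) \<ge> bulk t \<bar>h x\<bar> - bulk t 1"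
    using y by (simp add: bulk_def diff_divide_distrib algebra_simps)
  then show "0 / 2 * ((h x)\<^sup>2 - 1\<^sup>2) \<le> bulk t (h x) - bulk t (sgn (h x) * 1)"
    using bulk_nonneg[OF t, of "\<bar>h x\<bar>"] by (simp add: bulk_one)
next
  show "\<bar>h R\<bar> \<le> 1" using min by (auto simp: is_arg_min_def radial_class_def)
qed (use r in auto)

text \<open>For \<open>a = 0\<close> and \<open>b = 1 / 4\<close> the difference is half of
  \<open>y^2 - U^2\<close> times \<open>(y^2 + U^2) / 2 - 1\<close>, which gives the bound with
  factor 1 in place of 1.1. The extra 0.1 pays for the cubic term, whose coefficient is at most
  0.054.\<close>

lemma bulk_diff_small:
  assumes t: "t \<ge> 200" and U: "0 \<le> U" "U \<le> \<bar>y\<bar>" "\<bar>y\<bar> \<le> 1"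
  shows "- 1.1 * (1 - U\<^sup>2) / 2 * (y\<^sup>2 - U\<^sup>2) \<le> bulk t y - bulk t (sgn y * U)"
proof (cases "y = 0")
  case True then show ?thesis using U by simp
next
  case False
  define a b z d where "a = h_plus t / t" and "b = (h_plus t)\<^sup>2 / (2 * t)" and "z = \<bar>y\<bar>" and "d = z - U"
  have a: "0 \<le> a" "a \<le> 0.054" "4 * b = 3 * a + 1"
    using landau_coefficients[of t] landau_coefficient_le[OF t] t by (auto simp: a_def b_def)
  have z: "z = U + d" "d \<ge> 0" "U \<le> 1" using U by (auto simp: d_def z_def)
  have "U ^ 3 \<le> z ^ 3" using U by (intro power_mono) (auto simp: z_def)
  then have diff: "bulk t y - bulk t (sgn y * U) \<ge> - (z\<^sup>2 - U\<^sup>2) / 2 - a * (z ^ 3 - U ^ 3) + b * (z ^ 4 - U ^ 4)"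
    using bulk_diff[OF _ False, of t U] t by (simp add: a_def b_def z_def)
  \<comment> \<open>What remains after the slack is divided by \<open>d * (2 * U + d) / 2\<close>,
    up to a nonnegative rest that appears in the factorization at the end.\<close>
  define K where "K = 0.1 * (1 - U\<^sup>2) - 3 * a * U * (1 - U) + (1 + 3 * a) * (U * d + d\<^sup>2 / 2) - 2 * a * d"
  have k1: "a * (U * (1 - U)) \<le> 0.054 * (U * (1 - U))" using a U z by (intro mult_right_mono) auto
  have k2: "a * d \<le> 0.054 * d" using a z by (intro mult_right_mono) auto
  have k3: "0 \<le> a * (U * d + d\<^sup>2 / 2)" using a z U by simp
  have K1: "K \<ge> 0.1 * (1 - U\<^sup>2) - 0.162 * (U * (1 - U)) + (U * d + d\<^sup>2 / 2) - 0.108 * d"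
  proof -
    have "K = 0.1 * (1 - U\<^sup>2) - 3 * (a * (U * (1 - U))) + (U * d + d\<^sup>2 / 2) + 3 * (a * (U * d + d\<^sup>2 / 2)) - 2 * (a * d)"
      unfolding K_def by (simp add: field_simps)
    then show ?thesis using k1 k2 k3 by linarith
  qed
  have K2: "0.1 * (1 - U\<^sup>2) - 0.162 * (U * (1 - U)) = (1 - U) * (0.1 - 0.062 * U)"
    by (simp add: power2_eq_square field_simps)
  have K3: "(1 - U) * (0.1 - 0.062 * U) \<ge> (1 - U) * 0.038" using z by (intro mult_left_mono) auto
  have "(1 - U) * 0.038 + (U * d + d\<^sup>2 / 2) - 0.108 * d \<ge> 0"
  \<comment> \<open>For larger \<open>U\<close> the linear loss \<open>0.108 * d\<close> is absorbed
    by \<open>U * d\<close>; for smaller \<open>U\<close> it costs at most 0.005832 after completing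
    the square, while the first term is at least 0.03.\<close>
  proof (cases "U \<ge> 0.108")
    case True
    then have "0.108 * d \<le> U * d" using z by (intro mult_right_mono) auto
    moreover have "0 \<le> (1 - U) * 0.038" "0 \<le> d\<^sup>2 / 2" using z by auto
    ultimately show ?thesis by linarith
  next
    case False
    have "0 \<le> (d - 0.108)\<^sup>2" by simp
    then have "d\<^sup>2 / 2 - 0.108 * d \<ge> - 0.005832" by (simp add: power2_eq_square algebra_simps)
    moreover have "U * d \<ge> 0" using U z by simp
    moreover have "(1 - U) * 0.038 \<ge> 0.03" using False by simp
    moreover have "A + (B + C) - E \<ge> 0" if "C - E \<ge> - 0.005832" "B \<ge> 0" "A \<ge> 0.03" for A B C E :: real
      using that by simp
    ultimately show ?thesis by blast
  qed
  then have K0: "K \<ge> 0" using K1 K2 K3 by linarith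
  have b: "b = (1 + 3 * a) / 4" using a by simp
  have "- (z\<^sup>2 - U\<^sup>2) / 2 - a * (z ^ 3 - U ^ 3) + b * (z ^ 4 - U ^ 4) + 1.1 * (1 - U\<^sup>2) / 2 * (z\<^sup>2 - U\<^sup>2)
      = d * ((2 * U + d) * K / 2 + a * (U * d / 2))"
    unfolding b z(1) K_def by (simp add: field_simps power2_eq_square power3_eq_cube power4_eq_xxxx)
  also have "\<dots> \<ge> 0" using K0 a U z by simp
  finally show ?thesis using diff by (simp add: z_def)
qed

lemma profile_bound:
  assumes R: "R \<ge> 12" and t: "t \<ge> 200" and min: "is_arg_min (radial_energy R t) (\<lambda>g. g \<in> radial_class R) h"
    and r: "r \<in> {0..12}"
  shows "(h r)\<^sup>2 \<le> 1.05 * r ^ 4 / (r ^ 4 + 6 * r\<^sup>2 + 36)"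
proof -
  define D :: "real \<Rightarrow> real" where "D r = r ^ 4 + 6 * r\<^sup>2 + 36" for r
  have D: "D r > 0" for r unfolding D_def by (intro add_nonneg_pos add_nonneg_nonneg) auto
  \<comment> \<open>The factor 1.05 lifts \<open>U\<close> just above 1 at 12, which gives the
    boundary condition of the comparison.\<close>
  define \<kappa> :: real where "\<kappa> = sqrt 1.05"
  have \<kappa>: "\<kappa>\<^sup>2 = 1.05" "\<kappa> > 0" by (simp_all add: \<kappa>_def)
  define U where "U r = \<kappa> * r\<^sup>2 / sqrt (D r)" for r
  define U' where "U' r = \<kappa> * (6 * r ^ 3 + 72 * r) / (D r * sqrt (D r))" for r
  \<comment> \<open>The logarithmic derivative \<open>r * U' / U\<close>, extended smoothly to 0,
    where it has the value 2.\<close>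
  define m where "m r = (6 * r\<^sup>2 + 72) / D r" for r
  define m' where "m' r = (12 * r * D r - (6 * r\<^sup>2 + 72) * (4 * r ^ 3 + 12 * r)) / (D r)\<^sup>2" for r
  have dD: "(D has_real_derivative 4 * r ^ 3 + 12 * r) (at r)" for r
    unfolding D_def[abs_def] by (auto intro!: derivative_eq_intros)
  have cD: "continuous_on UNIV D" unfolding D_def[abs_def] by (intro continuous_intros)
  have U2: "(U r)\<^sup>2 = 1.05 * r ^ 4 / D r" for r
    unfolding \<kappa>(1)[symmetric] using D[of r] by (simp add: U_def power_divide power_mult_distrib)
  have U0: "U r \<ge> 0" for r using D[of r] \<kappa> by (simp add: U_def)
  have dU: "(U has_real_derivative U' r) (at r)" for r
  proof -
    have "((\<lambda>r. sqrt (D r)) has_real_derivative (4 * r ^ 3 + 12 * r) * (inverse (sqrt (D r)) / 2)) (at r)"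
      by (rule DERIV_cong[OF DERIV_chain2[OF DERIV_real_sqrt[OF D] dD]]) simp
    moreover have "((\<lambda>r. \<kappa> * r\<^sup>2) has_real_derivative \<kappa> * (2 * r)) (at r)" by (auto intro!: derivative_eq_intros)
    ultimately have "((\<lambda>r. \<kappa> * r\<^sup>2 / sqrt (D r)) has_real_derivative
       (\<kappa> * (2 * r) * sqrt (D r) - \<kappa> * r\<^sup>2 * ((4 * r ^ 3 + 12 * r) * (inverse (sqrt (D r)) / 2))) / (sqrt (D r) * sqrt (D r))) (at r)"
      using D[of r] by (intro DERIV_divide) auto
    moreover have "(\<kappa> * (2 * r) * sqrt (D r) - \<kappa> * r\<^sup>2 * ((4 * r ^ 3 + 12 * r) * (inverse (sqrt (D r)) / 2))) / (sqrt (D r) * sqrt (D r)) = U' r"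
    proof -
      define S where "S = sqrt (D r)"
      have S: "S > 0" "S * S = D r" using D[of r] by (auto simp: S_def)
      have "\<kappa> * (2 * r) * S - \<kappa> * r\<^sup>2 * ((4 * r ^ 3 + 12 * r) * (inverse S / 2))
          = \<kappa> * (2 * r * (S * S) - r\<^sup>2 * (2 * r ^ 3 + 6 * r)) / S"
        using S(1) by (simp add: field_simps)
      also have "2 * r * (S * S) - r\<^sup>2 * (2 * r ^ 3 + 6 * r) = 6 * r ^ 3 + 72 * r"
        unfolding S(2) D_def by (simp add: algebra_simps power2_eq_square power3_eq_cube power4_eq_xxxx)
      finally show ?thesis unfolding U'_def S_def[symmetric] S(2)[symmetric] using S(1) by simp
    qed
    ultimately show ?thesis by (simp add: U_def[abs_def])
  qed
  have cU': "continuous_on UNIV U'"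
    unfolding U'_def using D by (intro continuous_intros cD) (auto simp: less_le)
  have dm: "(m has_real_derivative m' r) (at r)" for r
  proof -
    have "((\<lambda>r. 6 * r\<^sup>2 + 72) has_real_derivative 12 * r) (at r)" by (auto intro!: derivative_eq_intros)
    from DERIV_divide[OF this dD] D[of r] show ?thesis
      by (simp add: m_def[abs_def] m'_def power2_eq_square)
  qed
  have cm': "continuous_on UNIV m'"
    unfolding m'_def using D by (intro continuous_intros cD) (auto simp: less_le)
  have "\<bar>h r\<bar> \<le> U r"
  proof (rule minimizer_le_supersolution[OF _ min _ _ dU cU' _ dm cm', where \<rho>=12 and q="\<lambda>r. - 1.1 * (1 - (U r)\<^sup>2)"])
    show "U x \<ge> 0" for x by (rule U0)
    show "x * U' x = m x * U x" for x
      by (simp add: U_def U'_def m_def power2_eq_square power3_eq_cube algebra_simps add_divide_distrib)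
    show "m x + x * m' x + (m x)\<^sup>2 < 6 + x\<^sup>2 * (- 1.1 * (1 - (U x)\<^sup>2))" if "0 < x" for x
    proof -
      \<comment> \<open>Multiplied by the square of \<open>D\<close>, the claim becomes a polynomial
        inequality in \<open>y\<close>. Its constant term cancels, since \<open>m = 2\<close> at 0
        gives \<open>m + m^2 = 6\<close>.\<close>
      define y where "y = x\<^sup>2"
      have y: "y > 0" using that by (simp add: y_def)
      have x4: "x ^ 4 = y\<^sup>2" by (simp add: y_def)
      have Dy: "D x = y\<^sup>2 + 6 * y + 36" by (simp add: D_def y_def)
      \<comment> \<open>The cubic coefficient is the only negative one; completing the square in
        these three terms absorbs it.\<close>
      have "0.055 * y ^ 4 - 0.27 * y ^ 3 + 0.78 * y\<^sup>2 = y\<^sup>2 * (0.055 * (y - 27 / 11)\<^sup>2 + (0.78 - 0.055 * (27 / 11)\<^sup>2))"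
        by (simp add: power2_eq_square power3_eq_cube power4_eq_xxxx algebra_simps)
      also have "\<dots> \<ge> 0" by (intro mult_nonneg_nonneg add_nonneg_nonneg) (auto simp: power2_eq_square)
      finally have pos: "y * (86.4 + 316.8 * y + 0.78 * y\<^sup>2 - 0.27 * y ^ 3 + 0.055 * y ^ 4) > 0"
        using y by (intro mult_pos_pos) auto
      have m1: "x * m' x = (12 * y * D x - (6 * y + 72) * (4 * y\<^sup>2 + 12 * y)) / (D x)\<^sup>2"
        by (simp add: m'_def y_def field_simps power2_eq_square power3_eq_cube)
      have "6 + x\<^sup>2 * (- 1.1 * (1 - (U x)\<^sup>2)) - (m x + x * m' x + (m x)\<^sup>2)
          = (6 * (D x)\<^sup>2 - 1.1 * y * (D x - 1.05 * y\<^sup>2) * D x - (6 * y + 72) * D x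
             - (12 * y * D x - (6 * y + 72) * (4 * y\<^sup>2 + 12 * y)) - (6 * y + 72)\<^sup>2) / (D x)\<^sup>2"
        unfolding m1 U2 m_def x4 y_def[symmetric] using D[of x]
        by (simp add: field_simps power2_eq_square)
      also have "6 * (D x)\<^sup>2 - 1.1 * y * (D x - 1.05 * y\<^sup>2) * D x - (6 * y + 72) * D x
             - (12 * y * D x - (6 * y + 72) * (4 * y\<^sup>2 + 12 * y)) - (6 * y + 72)\<^sup>2
          = y * (86.4 + 316.8 * y + 0.78 * y\<^sup>2 - 0.27 * y ^ 3 + 0.055 * y ^ 4)"
        unfolding Dy by (simp add: power2_eq_square power3_eq_cube power4_eq_xxxx field_simps)
      also have "y * (86.4 + 316.8 * y + 0.78 * y\<^sup>2 - 0.27 * y ^ 3 + 0.055 * y ^ 4) / (D x)\<^sup>2 > 0"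
        using pos D[of x] by simp
      finally show ?thesis by simp
    qed
    show "- 1.1 * (1 - (U x)\<^sup>2) / 2 * ((h x)\<^sup>2 - (U x)\<^sup>2) \<le> bulk t (h x) - bulk t (sgn (h x) * U x)"
      if "0 < x" "x < 12" "U x \<le> \<bar>h x\<bar>" for x
      by (rule bulk_diff_small[OF t U0 that(3)], rule minimizer_le_1[OF _ _ min]) (use R t that in auto)
    \<comment> \<open>Numerically, \<open>1.05 * 12 ^ 4 = 21772.8\<close> against
      \<open>D 12 = 21636\<close>.\<close>
    have "1\<^sup>2 \<le> (U 12)\<^sup>2" unfolding U2 D_def by simp
    then have "1 \<le> U 12" by (rule power2_le_imp_le[OF _ U0])
    moreover have "\<bar>h 12\<bar> \<le> 1" by (rule minimizer_le_1[OF _ _ min]) (use R t in auto)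
    ultimately show "\<bar>h 12\<bar> \<le> U 12" by simp
  qed (use R r in auto)
  then have "\<bar>h r\<bar>\<^sup>2 \<le> (U r)\<^sup>2" by (intro power_mono) auto
  then show ?thesis unfolding U2 D_def by simp
qed

section \<open>The hedgehog and its perturbation\<close>

lemma trace_symmetric:
  fixes Q :: "real^3^3"
  assumes "Q $ 2 $ 1 = Q $ 1 $ 2" "Q $ 3 $ 1 = Q $ 1 $ 3" "Q $ 3 $ 2 = Q $ 2 $ 3"
  shows "trace (Q ** Q) = (Q $ 1 $ 1)\<^sup>2 + (Q $ 2 $ 2)\<^sup>2 + (Q $ 3 $ 3)\<^sup>2
      + 2 * ((Q $ 1 $ 2)\<^sup>2 + (Q $ 1 $ 3)\<^sup>2 + (Q $ 2 $ 3)\<^sup>2)"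
    "trace (Q ** Q ** Q) = (Q $ 1 $ 1) ^ 3 + (Q $ 2 $ 2) ^ 3 + (Q $ 3 $ 3) ^ 3
      + 3 * (Q $ 1 $ 1 * ((Q $ 1 $ 2)\<^sup>2 + (Q $ 1 $ 3)\<^sup>2) + Q $ 2 $ 2 * ((Q $ 1 $ 2)\<^sup>2 + (Q $ 2 $ 3)\<^sup>2)
        + Q $ 3 $ 3 * ((Q $ 1 $ 3)\<^sup>2 + (Q $ 2 $ 3)\<^sup>2)) + 6 * (Q $ 1 $ 2 * Q $ 1 $ 3 * Q $ 2 $ 3)"
  unfolding trace_def matrix_matrix_mult_def
  by (simp_all add: sum_3 assms power2_eq_square power3_eq_cube algebra_simps)

text \<open>The components of \<open>n\<close> enter both traces only through their squares. Once
  the first square is eliminated by the unit length, the second cancels and only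
  \<open>n $ 3\<close> survives.\<close>

lemma trace_uniaxial_sum:
  fixes n :: "real^3" and \<eta> \<gamma> :: real
  assumes n: "(n $ 1)\<^sup>2 + (n $ 2)\<^sup>2 + (n $ 3)\<^sup>2 = 1"
  defines "Q \<equiv> \<eta> *\<^sub>R (outer n n - (1 / 3) *\<^sub>R mat 1) + \<gamma> *\<^sub>R (outer z_axis z_axis - (1 / 3) *\<^sub>R mat 1)"
  shows "trace (Q ** Q) = 2 / 3 * \<eta>\<^sup>2 + 2 * \<eta> * \<gamma> * ((n $ 3)\<^sup>2 - 1 / 3) + 2 / 3 * \<gamma>\<^sup>2"
    "trace (Q ** Q ** Q) = 2 / 9 * \<eta> ^ 3 + (\<eta>\<^sup>2 * \<gamma> + \<eta> * \<gamma>\<^sup>2) * ((n $ 3)\<^sup>2 - 1 / 3) + 2 / 9 * \<gamma> ^ 3"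
proof -
  define X Y Z where "X = (n $ 1)\<^sup>2" and "Y = (n $ 2)\<^sup>2" and "Z = (n $ 3)\<^sup>2"
  have X: "X = 1 - Y - Z" using n by (simp add: X_def Y_def Z_def)
  have e: "Q $ 1 $ 1 = \<eta> * (X - 1 / 3) - \<gamma> / 3" "Q $ 2 $ 2 = \<eta> * (Y - 1 / 3) - \<gamma> / 3"
    "Q $ 3 $ 3 = \<eta> * (Z - 1 / 3) + \<gamma> * (2 / 3)" "Q $ 1 $ 2 = \<eta> * (n $ 1 * n $ 2)"
    "Q $ 1 $ 3 = \<eta> * (n $ 1 * n $ 3)" "Q $ 2 $ 3 = \<eta> * (n $ 2 * n $ 3)"
    by (simp_all add: Q_def outer_def mat_def z_axis_def vector_3 X_def Y_def Z_def power2_eq_square)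
  have sym: "Q $ 2 $ 1 = Q $ 1 $ 2" "Q $ 3 $ 1 = Q $ 1 $ 3" "Q $ 3 $ 2 = Q $ 2 $ 3"
    by (simp_all add: Q_def outer_def mat_def z_axis_def vector_3)
  have d: "(\<eta> * (n $ 1 * n $ 2))\<^sup>2 = \<eta>\<^sup>2 * (X * Y)" "(\<eta> * (n $ 1 * n $ 3))\<^sup>2 = \<eta>\<^sup>2 * (X * Z)"
    "(\<eta> * (n $ 2 * n $ 3))\<^sup>2 = \<eta>\<^sup>2 * (Y * Z)"
    "\<eta> * (n $ 1 * n $ 2) * (\<eta> * (n $ 1 * n $ 3)) * (\<eta> * (n $ 2 * n $ 3)) = \<eta> ^ 3 * (X * Y * Z)"
    by (simp_all add: X_def Y_def Z_def power2_eq_square power3_eq_cube algebra_simps)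
  show "trace (Q ** Q) = 2 / 3 * \<eta>\<^sup>2 + 2 * \<eta> * \<gamma> * ((n $ 3)\<^sup>2 - 1 / 3) + 2 / 3 * \<gamma>\<^sup>2"
    unfolding trace_symmetric(1)[OF sym] e d Z_def[symmetric] X
    by (simp add: power2_eq_square field_simps)
  show "trace (Q ** Q ** Q) = 2 / 9 * \<eta> ^ 3 + (\<eta>\<^sup>2 * \<gamma> + \<eta> * \<gamma>\<^sup>2) * ((n $ 3)\<^sup>2 - 1 / 3) + 2 / 9 * \<gamma> ^ 3"
    unfolding trace_symmetric(2)[OF sym] e d Z_def[symmetric] X
    by (simp add: power2_eq_square power3_eq_cube field_simps)
qed


text \<open>The factor makes this a unit tensor away from the origin: for a unit vector n the tensor
  n n - I/3 has squared norm 2/3.\<close>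

definition director_field :: "real^3 \<Rightarrow> real^3^3" where
  "director_field x = sqrt (3 / 2) *\<^sub>R ((1 / (norm x)\<^sup>2) *\<^sub>R outer x x - (1 / 3) *\<^sub>R mat 1)"

definition director_deriv :: "real^3 \<Rightarrow> real^3 \<Rightarrow> real^3^3" where
  "director_deriv x d = sqrt (3 / 2) *\<^sub>R ((1 / (norm x)\<^sup>2) *\<^sub>R (outer x d + outer d x)
     - (2 * (x \<bullet> d) / (norm x) ^ 4) *\<^sub>R outer x x)"

definition z_tensor :: "real^3^3" where
  "z_tensor = outer z_axis z_axis - (1 / 3) *\<^sub>R mat 1"

lemma hedgehog_eq: "hedgehog h x = h (norm x) *\<^sub>R director_field x"
  by (simp add: hedgehog_def director_field_def)

lemma norm_outer: "norm (outer x y) = norm x * norm y"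
proof -
  have "norm (outer x y) = sqrt (\<Sum>i\<in>UNIV. (\<bar>x $ i\<bar> * norm y)\<^sup>2)"
  proof -
    have "outer x y $ i = x $ i *\<^sub>R y" for i by (simp add: outer_def vec_eq_iff)
    then show ?thesis by (simp add: norm_vec_def[of "outer x y"] L2_set_def)
  qed
  also have "\<dots> = sqrt ((norm y)\<^sup>2 * (\<Sum>i\<in>UNIV. (x $ i)\<^sup>2))"
    by (simp add: power_mult_distrib sum_distrib_left mult.commute)
  also have "\<dots> = norm x * norm y" by (simp add: real_sqrt_mult norm_vec_def[of x] L2_set_def)
  finally show ?thesis .
qed

lemma bounded_bilinear_outer: "bounded_bilinear outer"
proof
  show "\<exists>K. \<forall>x y. norm (outer x y) \<le> norm x * norm y * K" by (rule exI[of _ 1]) (simp add: norm_outer)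
qed (simp_all add: outer_def vec_eq_iff algebra_simps)

lemma director_field_angular: "\<exists>C. angular_field director_field director_deriv C"
proof -
  \<comment> \<open>The two parts of the derivative contribute \<open>2 / norm x\<close> each, and
    the field itself is bounded by 1 plus a third of the norm of the identity, up to the common
    factor.\<close>
  define C where "C = sqrt (3 / 2) * (4 + norm (mat 1 :: real^3^3))"
  have s: "sqrt (3 / 2) \<ge> (0 :: real)" by simp
  have der: "(director_field has_derivative director_deriv x) (at x)" if x: "x \<noteq> 0" for x
  proof -
    have nz: "x \<bullet> x \<noteq> 0" using x by simp
    have "((\<lambda>s :: real. 1 / s) has_derivative (*) (- (1 / (x \<bullet> x)\<^sup>2))) (at (x \<bullet> x))"
      unfolding has_field_derivative_def[symmetric]
      using nz by (auto intro!: derivative_eq_intros simp: power2_eq_square)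
    moreover have "((\<lambda>x :: real^3. x \<bullet> x) has_derivative (\<lambda>d. 2 * (x \<bullet> d))) (at x)"
      by (auto intro!: derivative_eq_intros simp: inner_commute)
    ultimately have 1: "((\<lambda>x :: real^3. 1 / (x \<bullet> x)) has_derivative (\<lambda>d. - (1 / (x \<bullet> x)\<^sup>2) * (2 * (x \<bullet> d)))) (at x)"
      by (rule has_derivative_compose[rotated])
    have 2: "((\<lambda>x. outer x x) has_derivative (\<lambda>d. outer x d + outer d x)) (at x)"
      by (rule bounded_bilinear.FDERIV[OF bounded_bilinear_outer has_derivative_ident has_derivative_ident])
    have "((\<lambda>x. sqrt (3 / 2) *\<^sub>R ((1 / (x \<bullet> x)) *\<^sub>R outer x x - (1 / 3) *\<^sub>R mat 1)) has_derivative
      (\<lambda>d. sqrt (3 / 2) *\<^sub>R (((1 / (x \<bullet> x)) *\<^sub>R (outer x d + outer d x)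
        + (- (1 / (x \<bullet> x)\<^sup>2) * (2 * (x \<bullet> d))) *\<^sub>R outer x x) - 0))) (at x)"
      by (intro has_derivative_scaleR_right has_derivative_diff has_derivative_scaleR[OF 1 2] has_derivative_const)
    moreover have "(norm x) ^ 4 = (x \<bullet> x)\<^sup>2" for x :: "real^3"
      by (simp add: power2_norm_eq_inner[symmetric] flip: power_mult)
    ultimately show ?thesis
      by (simp add: director_field_def[abs_def] director_deriv_def[abs_def] power2_norm_eq_inner)
  qed
  have bd: "norm (director_field x) \<le> C" if x: "x \<noteq> 0" for x
  proof -
    have "norm ((1 / (norm x)\<^sup>2) *\<^sub>R outer x x - (1 / 3) *\<^sub>R (mat 1 :: real^3^3))
        \<le> norm ((1 / (norm x)\<^sup>2) *\<^sub>R outer x x) + norm ((1 / 3) *\<^sub>R (mat 1 :: real^3^3))"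
      by (rule norm_triangle_ineq4)
    also have "\<dots> = 1 + norm (mat 1 :: real^3^3) / 3" using x by (simp add: norm_outer power2_eq_square)
    also have "\<dots> \<le> 4 + norm (mat 1 :: real^3^3)" by simp
    finally show ?thesis unfolding director_field_def C_def norm_scaleR abs_of_nonneg[OF s]
      by (intro mult_left_mono s)
  qed
  have bD: "norm (director_deriv x b) \<le> C / norm x" if x: "x \<noteq> 0" and b: "b \<in> Basis" for x b
  proof -
    have nb: "norm b = 1" using b by simp
    have "norm ((1 / (norm x)\<^sup>2) *\<^sub>R (outer x b + outer b x) - (2 * (x \<bullet> b) / (norm x) ^ 4) *\<^sub>R outer x x)
       \<le> (1 / (norm x)\<^sup>2) * norm (outer x b + outer b x) + \<bar>2 * (x \<bullet> b) / (norm x) ^ 4\<bar> * norm (outer x x)"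
      by (rule order_trans[OF norm_triangle_ineq4]) simp
    also have "\<dots> \<le> (1 / (norm x)\<^sup>2) * (2 * norm x) + (2 * norm x / (norm x) ^ 4) * (norm x)\<^sup>2"
    proof (intro add_mono mult_mono)
      show "norm (outer x b + outer b x) \<le> 2 * norm x"
        using norm_triangle_ineq[of "outer x b" "outer b x"] by (simp add: norm_outer nb)
      show "\<bar>2 * (x \<bullet> b) / (norm x) ^ 4\<bar> \<le> 2 * norm x / (norm x) ^ 4"
        using Cauchy_Schwarz_ineq2[of x b] nb by (simp add: abs_mult divide_right_mono)
    qed (auto simp: norm_outer power2_eq_square)
    also have "\<dots> = 4 / norm x" using x by (simp add: power2_eq_square power4_eq_xxxx)
    also have "\<dots> \<le> (4 + norm (mat 1 :: real^3^3)) / norm x" by (intro divide_right_mono) auto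
    finally show ?thesis unfolding director_deriv_def C_def norm_scaleR abs_of_nonneg[OF s] times_divide_eq_right[symmetric]
      by (intro mult_left_mono s)
  qed
  have "continuous_on (- {0}) (\<lambda>x. director_deriv x b)" for b
    unfolding director_deriv_def
    by (intro continuous_intros bounded_bilinear.continuous_on[OF bounded_bilinear_outer]) auto
  then have "angular_field director_field director_deriv C"
    unfolding angular_field_def using der bd bD by blast
  then show ?thesis ..
qed

lemma constant_angular: "angular_field (\<lambda>_. Z) (\<lambda>_ _. 0) (norm Z)"
  by (simp add: angular_field_def)

text \<open>Euler's relation: the director is homogeneous of degree 0, hence constant along rays.
  Contracting its gradient with \<open>x\<close> therefore removes the tangential part from the
  gradient cross term.\<close>

lemma director_deriv_radial: "x \<noteq> 0 \<Longrightarrow> director_deriv x x = 0"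
  by (simp add: director_deriv_def vec_eq_iff outer_def power2_norm_eq_inner[symmetric] power2_eq_square
      power4_eq_xxxx)

lemma director_deriv_sum:
  assumes x: "x \<noteq> 0" shows "(\<Sum>k\<in>UNIV. x $ k *\<^sub>R director_deriv x (axis k 1)) = 0"
proof -
  obtain C where "angular_field director_field director_deriv C" using director_field_angular ..
  then have l: "linear (director_deriv x)"
    using angular_fieldD(1) x has_derivative_linear by blast
  have "(\<Sum>k\<in>UNIV. x $ k *\<^sub>R director_deriv x (axis k 1)) = director_deriv x (\<Sum>k\<in>UNIV. x $ k *\<^sub>R axis k 1)"
    by (simp add: linear_sum[OF l] linear_cmul[OF l])
  also have "(\<Sum>k\<in>UNIV. x $ k *\<^sub>R axis k 1) = x"
    using basis_expansion[of x] by (simp add: scalar_mult_eq_scaleR)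
  finally show ?thesis using director_deriv_radial[OF x] by simp
qed

lemma director_sym_traceless: "x \<noteq> 0 \<Longrightarrow> c *\<^sub>R director_field x \<in> sym_traceless"
proof -
  assume x: "x \<noteq> 0"
  have nn: "(norm x)\<^sup>2 = (x $ 1)\<^sup>2 + (x $ 2)\<^sup>2 + (x $ 3)\<^sup>2" unfolding norm_vec3 by simp
  have q: "((x $ 1)\<^sup>2 + (x $ 2)\<^sup>2 + (x $ 3)\<^sup>2) / (norm x)\<^sup>2 = 1" unfolding nn[symmetric] using x by simp
  have "trace (c *\<^sub>R director_field x)
      = c * sqrt (3 / 2) * (((x $ 1)\<^sup>2 + (x $ 2)\<^sup>2 + (x $ 3)\<^sup>2) / (norm x)\<^sup>2 - 1)"
    by (simp add: director_field_def outer_def trace_def sum_3 mat_def power2_eq_square algebra_simps add_divide_distrib)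
  then have "trace (c *\<^sub>R director_field x) = 0" unfolding q by simp
  moreover have "transpose (c *\<^sub>R director_field x) = c *\<^sub>R director_field x"
    by (simp add: director_field_def outer_def transpose_def mat_def vec_eq_iff mult.commute)
  ultimately show ?thesis by (simp add: sym_traceless_def)
qed

lemma z_tensor_sym_traceless: "c *\<^sub>R z_tensor \<in> sym_traceless"
  by (simp add: sym_traceless_def z_tensor_def outer_def transpose_def trace_def sum_3 mat_def vec_eq_iff
      z_axis_def vector_3 forall_3 algebra_simps)

lemma z_tensor_inner:
  assumes "x \<noteq> 0"
  shows "z_tensor \<bullet> z_tensor = 2 / 3" "director_field x \<bullet> z_tensor = sqrt (3 / 2) * ((x $ 3 / norm x)\<^sup>2 - 1 / 3)"
proof -
  show "z_tensor \<bullet> z_tensor = 2 / 3"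
    by (simp add: z_tensor_def outer_def inner_vec_def sum_3 mat_def z_axis_def vector_3)
  have nn: "(norm x)\<^sup>2 = (x $ 1)\<^sup>2 + (x $ 2)\<^sup>2 + (x $ 3)\<^sup>2" unfolding norm_vec3 by simp
  have "((1 / (norm x)\<^sup>2) *\<^sub>R outer x x - (1 / 3) *\<^sub>R mat 1) \<bullet> z_tensor
      = (x $ 3)\<^sup>2 / (norm x)\<^sup>2 - ((x $ 1)\<^sup>2 + (x $ 2)\<^sup>2 + (x $ 3)\<^sup>2) / (norm x)\<^sup>2 / 3"
    by (simp add: z_tensor_def outer_def inner_vec_def sum_3 mat_def z_axis_def vector_3 power2_eq_square
        add_divide_distrib field_simps)
  also have "\<dots> = (x $ 3 / norm x)\<^sup>2 - 1 / 3"
    unfolding nn[symmetric] using assms by (simp add: power_divide)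
  finally show "director_field x \<bullet> z_tensor = sqrt (3 / 2) * ((x $ 3 / norm x)\<^sup>2 - 1 / 3)"
    by (simp add: director_field_def)
qed


section \<open>The Landau--de Gennes energy of the perturbed hedgehog\<close>

text \<open>The gradient is a separate argument \<open>P\<close>, so that explicit weak derivatives
  can replace the chosen ones inside the integral.\<close>

definition ldg_density :: "real \<Rightarrow> (3 \<Rightarrow> real^3^3) \<Rightarrow> real^3^3 \<Rightarrow> real" where
  "ldg_density t P Q = 1 / 2 * (\<Sum>i\<in>UNIV. \<Sum>j\<in>UNIV. \<Sum>k\<in>UNIV. (P k $ i $ j)\<^sup>2)
     - 1 / 2 * trace (Q ** Q) - sqrt 6 * h_plus t / t * trace (Q ** Q ** Q)
     + (h_plus t)\<^sup>2 / (2 * t) * (trace (Q ** Q))\<^sup>2 + C_const t"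

lemma LdG_energy_eq:
  "LdG_energy R t Q = (LINT x|lebesgue_on (ball 0 R). ldg_density t (\<lambda>k. weak_partial (ball 0 R) Q (axis k 1) x) (Q x))"
  by (simp add: LdG_energy_def ldg_density_def)

lemma borel_measurable_vec_nth_comp [measurable (raw)]:
  fixes f :: "'a \<Rightarrow> ('b::euclidean_space)^'n"
  assumes "f \<in> borel_measurable M" shows "(\<lambda>x. f x $ i) \<in> borel_measurable M"
  by (rule borel_measurable_continuous_on[OF _ assms]) (intro continuous_intros)

lemma ldg_density_measurable:
  assumes [measurable]: "\<And>k. P k \<in> borel_measurable M" "Q \<in> borel_measurable M"
  shows "(\<lambda>x. ldg_density t (\<lambda>k. P k x) (Q x)) \<in> borel_measurable M"
  unfolding ldg_density_def trace_def matrix_matrix_mult_def by (simp, measurable)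

lemma LdG_energy_weak_partial:
  assumes R: "R > 0" and Q: "Q \<in> W12 (ball 0 R)"
    and P: "\<And>k. L2_on (ball 0 R) (P k)" "\<And>k. is_weak_partial (ball 0 R) Q (axis k 1) (P k)"
  shows "LdG_energy R t Q = (LINT x|lebesgue_on (ball 0 R). ldg_density t (\<lambda>k. P k x) (Q x))"
  unfolding LdG_energy_eq
proof (rule integral_cong_AE)
  let ?B = "ball (0 :: real^3) R"
  have ax: "axis k 1 \<in> (Basis :: (real^3) set)" for k by (simp add: axis_in_Basis_iff)
  have Qm: "Q \<in> borel_measurable (lebesgue_on ?B)" using Q by (auto simp: W12_def dest: borel_measurable_of_L2_on)
  show "(\<lambda>x. ldg_density t (\<lambda>k. weak_partial ?B Q (axis k 1) x) (Q x)) \<in> borel_measurable (lebesgue_on ?B)"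
    by (intro ldg_density_measurable Qm borel_measurable_of_L2_on[OF W12_weak_partial(1)[OF Q ax]])
  show "(\<lambda>x. ldg_density t (\<lambda>k. P k x) (Q x)) \<in> borel_measurable (lebesgue_on ?B)"
    by (intro ldg_density_measurable Qm borel_measurable_of_L2_on[OF P(1)])
  have "AE x in lebesgue_on ?B. \<forall>k\<in>UNIV. weak_partial ?B Q (axis k 1) x = P k x"
    by (intro AE_finite_allI) (auto intro: weak_partial_AE_eq[OF R P])
  then show "AE x in lebesgue_on ?B. ldg_density t (\<lambda>k. weak_partial ?B Q (axis k 1) x) (Q x)
      = ldg_density t (\<lambda>k. P k x) (Q x)"
    by eventually_elim simp
qed

lemma ldg_density_gradient: "(\<Sum>i\<in>UNIV. \<Sum>j\<in>UNIV. \<Sum>k\<in>UNIV. (P k $ i $ j)\<^sup>2) = (\<Sum>k\<in>UNIV. P k \<bullet> P k)"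
  for P :: "3 \<Rightarrow> real^3^3"
  by (simp add: inner_vec_def sum_3 power2_eq_square)

text \<open>In terms of n n - I/3 the coefficient of the director is
  \<open>sqrt (3 / 2) * \<eta>\<close>. All angular dependence outside the gradient is collected in
  powers of \<open>K\<close>, ready for averaging over spheres.\<close>

lemma ldg_density_perturbed:
  assumes x: "x \<noteq> 0"
  defines "K \<equiv> (x $ 3 / norm x)\<^sup>2 - 1 / 3"
  shows "ldg_density t P (\<eta> *\<^sub>R director_field x + \<gamma> *\<^sub>R z_tensor) = 1 / 2 * (\<Sum>k\<in>UNIV. P k \<bullet> P k)
    - 1 / 2 * (\<eta>\<^sup>2 + 2 * (sqrt (3 / 2) * \<eta>) * \<gamma> * K + 2 / 3 * \<gamma>\<^sup>2)
    - sqrt 6 * h_plus t / t * (2 / 9 * (sqrt (3 / 2) * \<eta>) ^ 3 + ((sqrt (3 / 2) * \<eta>)\<^sup>2 * \<gamma> + sqrt (3 / 2) * \<eta> * \<gamma>\<^sup>2) * K + 2 / 9 * \<gamma> ^ 3)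
    + (h_plus t)\<^sup>2 / (2 * t) * (\<eta>\<^sup>2 + 2 * (sqrt (3 / 2) * \<eta>) * \<gamma> * K + 2 / 3 * \<gamma>\<^sup>2)\<^sup>2 + C_const t"
proof -
  define n where "n = (1 / norm x) *\<^sub>R x"
  have nn: "(norm x)\<^sup>2 = (x $ 1)\<^sup>2 + (x $ 2)\<^sup>2 + (x $ 3)\<^sup>2" unfolding norm_vec3 by simp
  have n: "(n $ 1)\<^sup>2 + (n $ 2)\<^sup>2 + (n $ 3)\<^sup>2 = 1"
  proof -
    have "(n $ 1)\<^sup>2 + (n $ 2)\<^sup>2 + (n $ 3)\<^sup>2 = ((x $ 1)\<^sup>2 + (x $ 2)\<^sup>2 + (x $ 3)\<^sup>2) / (norm x)\<^sup>2"
      by (simp add: n_def power_divide add_divide_distrib)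
    then show ?thesis unfolding nn[symmetric] using x by simp
  qed
  have Q: "\<eta> *\<^sub>R director_field x + \<gamma> *\<^sub>R z_tensor = (sqrt (3 / 2) * \<eta>) *\<^sub>R (outer n n - (1 / 3) *\<^sub>R mat 1)
      + \<gamma> *\<^sub>R (outer z_axis z_axis - (1 / 3) *\<^sub>R mat 1)"
  proof -
    have "outer n n = (1 / (norm x)\<^sup>2) *\<^sub>R outer x x"
      by (simp add: n_def outer_def vec_eq_iff power2_eq_square)
    then show ?thesis by (simp add: director_field_def z_tensor_def mult.commute)
  qed
  have K: "(n $ 3)\<^sup>2 - 1 / 3 = K" by (simp add: K_def n_def)
  have s: "2 / 3 * (sqrt (3 / 2) * \<eta>)\<^sup>2 = \<eta>\<^sup>2" by (simp add: power_mult_distrib)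
  show ?thesis
    unfolding ldg_density_def ldg_density_gradient Q trace_uniaxial_sum[OF n] K s ..
qed

section \<open>Sums of Sobolev functions\<close>

lemma is_weak_partial_add:
  fixes u w :: "'a::euclidean_space \<Rightarrow> 'b::euclidean_space"
  assumes S: "S \<in> lmeasurable" and b: "b \<in> Basis"
    and L: "L2_on S u" "L2_on S w" "L2_on S v" "L2_on S z"
    and wp: "is_weak_partial S u b v" "is_weak_partial S w b z"
  shows "is_weak_partial S (\<lambda>x. u x + w x) b (\<lambda>x. v x + z x)"
  unfolding is_weak_partial_def
proof
  fix \<phi> :: "'a \<Rightarrow> real" assume p: "\<phi> \<in> C1c S"
  note i = integrable_scaleR_L2[OF L2_on_C1c(1)[OF p S]] integrable_scaleR_L2[OF L2_on_C1c(2)[OF p S b]]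
  show "(LINT x|lebesgue_on S. frechet_derivative \<phi> (at x) b *\<^sub>R (u x + w x)) = - (LINT x|lebesgue_on S. \<phi> x *\<^sub>R (v x + z x))"
    using wp[unfolded is_weak_partial_def, rule_format, OF p] i[OF L(1)] i[OF L(2)] i[OF L(3)] i[OF L(4)]
      i(2)[OF L(1)] i(2)[OF L(2)]
    by (simp add: scaleR_add_right)
qed

lemma C1c_add:
  assumes "f \<in> C1c S" "g \<in> C1c S"
  shows "(\<lambda>x. f x + g x) \<in> C1c S"
    "frechet_derivative (\<lambda>x. f x + g x) (at x) = (\<lambda>d. frechet_derivative f (at x) d + frechet_derivative g (at x) d)"
proof -
  obtain K where K: "compact K" "K \<subseteq> S" "\<And>x. x \<notin> K \<Longrightarrow> f x = 0" and f: "C1_deriv f (\<lambda>x. frechet_derivative f (at x))"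
    using assms(1) by (elim C1cE) auto
  obtain L where L: "compact L" "L \<subseteq> S" "\<And>x. x \<notin> L \<Longrightarrow> g x = 0" and g: "C1_deriv g (\<lambda>x. frechet_derivative g (at x))"
    using assms(2) by (elim C1cE) auto
  note C = C1_deriv_add[OF f g]
  show "(\<lambda>x. f x + g x) \<in> C1c S"
    by (rule C1cI[OF C compact_Un[OF K(1) L(1)]]) (use K L in auto)
  show "frechet_derivative (\<lambda>x. f x + g x) (at x) = (\<lambda>d. frechet_derivative f (at x) d + frechet_derivative g (at x) d)"
    by (rule C1_derivD(4)[OF C])
qed

lemma W12_add:
  fixes u w :: "'a::euclidean_space \<Rightarrow> 'b::euclidean_space"
  assumes "S \<in> lmeasurable" "u \<in> W12 S" "w \<in> W12 S" shows "(\<lambda>x. u x + w x) \<in> W12 S"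
proof -
  have L: "L2_on S u" "L2_on S w" using assms by (auto simp: W12_def)
  have "L2_on S (\<lambda>x. weak_partial S u b x + weak_partial S w b x) \<and>
      is_weak_partial S (\<lambda>x. u x + w x) b (\<lambda>x. weak_partial S u b x + weak_partial S w b x)" if b: "b \<in> Basis" for b
    using W12_weak_partial[OF assms(2) b] W12_weak_partial[OF assms(3) b]
    by (intro conjI L2_on_add is_weak_partial_add assms(1) b L)
  then show ?thesis unfolding W12_def using L2_on_add[OF L] by blast
qed

lemma W12_0_add:
  fixes u w :: "'a::euclidean_space \<Rightarrow> 'b::euclidean_space"
  assumes \<rho>: "\<rho> > 0" and uw: "u \<in> W12_0 (ball c \<rho>)" "w \<in> W12_0 (ball c \<rho>)"
  shows "(\<lambda>x. u x + w x) \<in> W12_0 (ball c \<rho>)"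
proof -
  let ?B = "ball c \<rho>"
  have B: "?B \<in> lmeasurable" by auto
  have ex: "\<exists>\<phi>. (\<forall>n. \<phi> n \<in> C1c ?B) \<and> L2_lim ?B \<phi> u \<and>
      (\<forall>b\<in>Basis. L2_lim ?B (\<lambda>n x. frechet_derivative (\<phi> n) (at x) b) (weak_partial ?B u b))"
    if u: "u \<in> W12_0 ?B" for u :: "'a \<Rightarrow> 'b"
  proof -
    have W: "u \<in> W12 ?B" using u by (auto simp: W12_0_def)
    then have Lu: "L2_on ?B u" by (auto simp: W12_def)
    obtain \<phi> where p: "\<And>n. \<phi> n \<in> C1c ?B" "(\<lambda>n. LINT x|lebesgue_on ?B. (norm (u x - \<phi> n x))\<^sup>2) \<longlonglongrightarrow> 0"
      "\<And>b. b \<in> Basis \<Longrightarrow> (\<lambda>n. LINT x|lebesgue_on ?B.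
          (norm (weak_partial ?B u b x - frechet_derivative (\<phi> n) (at x) b))\<^sup>2) \<longlonglongrightarrow> 0"
      using u unfolding W12_0_def by blast
    have "L2_lim ?B \<phi> u"
      unfolding L2_lim_def using p(2) L2_on_C1c(1)[OF p(1) B] Lu by (simp add: norm_minus_commute)
    moreover have "L2_lim ?B (\<lambda>n x. frechet_derivative (\<phi> n) (at x) b) (weak_partial ?B u b)" if b: "b \<in> Basis" for b
      unfolding L2_lim_def using p(3)[OF b] L2_on_C1c(2)[OF p(1) B b] W12_weak_partial(1)[OF W b]
      by (simp add: norm_minus_commute)
    ultimately show ?thesis using p(1) by blast
  qed
  obtain \<phi> where p: "\<And>n. \<phi> n \<in> C1c ?B" "L2_lim ?B \<phi> u"
    "\<And>b. b \<in> Basis \<Longrightarrow> L2_lim ?B (\<lambda>n x. frechet_derivative (\<phi> n) (at x) b) (weak_partial ?B u b)"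
    using ex[OF uw(1)] by blast
  obtain \<psi> where q: "\<And>n. \<psi> n \<in> C1c ?B" "L2_lim ?B \<psi> w"
    "\<And>b. b \<in> Basis \<Longrightarrow> L2_lim ?B (\<lambda>n x. frechet_derivative (\<psi> n) (at x) b) (weak_partial ?B w b)"
    using ex[OF uw(2)] by blast
  have W: "u \<in> W12 ?B" "w \<in> W12 ?B" using uw by (auto simp: W12_0_def)
  show ?thesis
  proof (rule W12_0I[OF \<rho> C1c_add(1)[OF p(1) q(1)] L2_lim_add[OF p(2) q(2)]])
    fix b :: 'a assume b: "b \<in> Basis"
    show "L2_lim ?B (\<lambda>n x. frechet_derivative (\<lambda>x. \<phi> n x + \<psi> n x) (at x) b) (\<lambda>x. weak_partial ?B u b x + weak_partial ?B w b x)"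
      unfolding C1c_add(2)[OF p(1) q(1)] by (rule L2_lim_add[OF p(3)[OF b] q(3)[OF b]])
    show "is_weak_partial ?B (\<lambda>x. u x + w x) b (\<lambda>x. weak_partial ?B u b x + weak_partial ?B w b x)"
      using W12_weak_partial[OF W(1) b] W12_weak_partial[OF W(2) b] L2_limD(2)[OF p(2)] L2_limD(2)[OF q(2)]
      by (intro is_weak_partial_add B b)
  qed
qed


lemma radial_integrable_of_L2:
  fixes f :: "real \<Rightarrow> real"
  assumes "f \<in> borel_measurable borel" "L2_on {0<..<R} f"
  shows "integrable (lebesgue_on (ball (0 :: real^3) R)) (\<lambda>x. f (norm x))"
  by (rule L2_on_imp_integrable[OF L2_on_radial[OF assms]]) auto

text \<open>
  All terms that are odd in the perturbation carry a factor \<open>\<lambda>x. (x\<^sub>3 / r)\<^sup>2 - 1 / 3\<close> of vanishing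
  angular mean, so no Euler-Lagrange equation is needed. The number \<open>28 / 15\<close> is \<open>4 / 3\<close> plus
  \<open>6\<close> times the angular mean \<open>4 / 45\<close> of the square of this factor.
\<close>
lemma ldg_energy_difference:
  fixes t :: real
  assumes R: "R > 0" and h: "ac_on R h v" and g: "ac_on R g w" and M: "\<And>r. \<bar>w r\<bar> \<le> M"
  defines "F \<equiv> \<lambda>r. (w r)\<^sup>2 / 3 - (g r)\<^sup>2 / 3 - 2 * sqrt 6 / 9 * (h_plus t / t) * (g r) ^ 3
      + (h_plus t)\<^sup>2 / (2 * t) * (28 / 15 * (h r)\<^sup>2 * (g r)\<^sup>2 + 4 / 9 * (g r) ^ 4)"
  shows "integrable (lebesgue_on {0<..<R}) (\<lambda>r. r\<^sup>2 * F r)"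
    "LdG_energy R t (\<lambda>x. hedgehog h x + g (norm x) *\<^sub>R z_tensor) - LdG_energy R t (hedgehog h)
      = 4 * pi * (LINT r|lebesgue_on {0<..<R}. r\<^sup>2 * F r)"
proof -
  let ?I = "{0<..<R}" and ?B = "ball (0 :: real^3) R"
  let ?M = "lebesgue_on ?B"
  have B: "?B \<in> lmeasurable" by auto
  define a b s where "a = h_plus t / t" and "b = (h_plus t)\<^sup>2 / (2 * t)" and "s = sqrt (3 / 2)"
  have s2: "s\<^sup>2 = 3 / 2" by (simp add: s_def)
  note ch = ac_on_continuous[OF R h] and cg = ac_on_continuous[OF R g]
  \<comment> \<open>Continuous extensions of the profiles to the whole line by clamping the
    argument; they are Borel measurable, whereas \<open>h\<close> and \<open>g\<close> are
    controlled only between 0 and \<open>R\<close>.\<close>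
  define H G where "H r = h (max 0 (min R r))" and "G r = g (max 0 (min R r))" for r
  have cont: "continuous_on UNIV H" "continuous_on UNIV G"
    unfolding H_def G_def using R by (auto intro!: continuous_on_compose2[OF ch] continuous_on_compose2[OF cg] continuous_intros)
  have HG: "H r = h r" "G r = g r" if "0 \<le> r" "r \<le> R" for r using that by (simp_all add: H_def G_def)
  have [measurable]: "H \<in> borel_measurable borel" "G \<in> borel_measurable borel"
    "v \<in> borel_measurable borel" "w \<in> borel_measurable borel"
    using cont ac_onD(1)[OF h] ac_onD(1)[OF g] by (auto intro: borel_measurable_continuous_onI)
  have cL: "L2_on ?I f" if "continuous_on UNIV f" for f :: "real \<Rightarrow> real"
    by (rule L2_on_continuous_closed_interval) (use that continuous_on_subset in blast)
  \<comment> \<open>The bound on \<open>w\<close> keeps its product with \<open>v\<close> in L2, and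
    this product is the radial part of the gradient cross term.\<close>
  have wL: "L2_on ?I (\<lambda>r. z r * w r)" if "L2_on ?I z" for z
  proof (rule L2_on_bound[OF _ that, where C=M])
    show "(\<lambda>r. z r * w r) \<in> borel_measurable (lebesgue_on ?I)"
      using borel_measurable_of_L2_on[OF that] borel_measurable_lebesgue_onI[OF \<open>w \<in> borel_measurable borel\<close>]
      by measurable
    show "AE r in lebesgue_on ?I. norm (z r * w r) \<le> M * norm (z r)"
      using M by (intro AE_I2) (simp add: abs_mult mult.commute mult_right_mono)
  qed
  \<comment> \<open>\<open>f0\<close>, \<open>f1\<close> and \<open>f2\<close> are the coefficients
    of 1, \<open>K x\<close> and the square of \<open>K x\<close> in the difference of the two
    densities.\<close>
  define f0 where "f0 r = (w r)\<^sup>2 / 3 + (- (G r)\<^sup>2 / 3 - 2 * sqrt 6 / 9 * a * (G r) ^ 3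
      + b * (4 / 9 * (G r) ^ 4 + 4 / 3 * (H r)\<^sup>2 * (G r)\<^sup>2))" for r
  define f1 where "f1 r = s * (v r * w r) + (- s * H r * G r - sqrt 6 * a * (s\<^sup>2 * (H r)\<^sup>2 * G r + s * H r * (G r)\<^sup>2)
      + b * (4 * s * (H r) ^ 3 * G r + 8 / 3 * s * H r * (G r) ^ 3))" for r
  define f2 where "f2 r = 6 * b * (H r)\<^sup>2 * (G r)\<^sup>2" for r
  have m: "f0 \<in> borel_measurable borel" "f1 \<in> borel_measurable borel" "f2 \<in> borel_measurable borel"
    unfolding f0_def f1_def f2_def by measurable
  have L: "L2_on ?I f0" "L2_on ?I f1" "L2_on ?I f2"
  proof -
    have "L2_on ?I (\<lambda>r. (w r)\<^sup>2 / 3)"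
      using L2_on_scaleR[OF wL[OF ac_onD(2)[OF g]], of "1 / 3"] by (simp add: power2_eq_square)
    then show "L2_on ?I f0" unfolding f0_def
      by (rule L2_on_add[OF _ cL]) (intro continuous_intros cont, simp)
    have "L2_on ?I (\<lambda>r. s * (v r * w r))"
      using L2_on_scaleR[OF wL[OF ac_onD(2)[OF h]], of s] by simp
    then show "L2_on ?I f1" unfolding f1_def
      by (rule L2_on_add[OF _ cL]) (intro continuous_intros cont)
    show "L2_on ?I f2" unfolding f2_def by (intro cL continuous_intros cont)
  qed
  note i0 = radial_integrable_of_L2[OF m(1) L(1)] and i1 = radial_integrable_of_L2[OF m(2) L(2)]
    and i2 = radial_integrable_of_L2[OF m(3) L(3)]
  note mo1 = angular_moments[OF m(2) i1] and mo2 = angular_moments[OF m(3) i2]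
  define K where "K x = (x $ 3 / norm x)\<^sup>2 - 1 / 3" for x :: "real^3"
  have K1: "integrable ?M (\<lambda>x. f1 (norm x) * K x)" "(LINT x|?M. f1 (norm x) * K x) = 0"
  proof -
    have e: "f1 (norm x) * K x = f1 (norm x) * (x $ 3 / norm x)\<^sup>2 - f1 (norm x) / 3" for x
      by (simp add: K_def algebra_simps)
    show "integrable ?M (\<lambda>x. f1 (norm x) * K x)" "(LINT x|?M. f1 (norm x) * K x) = 0"
      unfolding e using mo1(1,2) i1 by simp_all
  qed
  have K2: "integrable ?M (\<lambda>x. f2 (norm x) * (K x)\<^sup>2)"
    "(LINT x|?M. f2 (norm x) * (K x)\<^sup>2) = 4 / 45 * (LINT x|?M. f2 (norm x))"
  proof -
    \<comment> \<open>The angular mean of the square is 1/5 - 2/9 + 1/9 = 4/45.\<close>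
    have e: "f2 (norm x) * (K x)\<^sup>2 = f2 (norm x) * (x $ 3 / norm x) ^ 4
        - 2 / 3 * (f2 (norm x) * (x $ 3 / norm x)\<^sup>2) + f2 (norm x) / 9" for x
    proof -
      have k2: "(K x)\<^sup>2 = (x $ 3 / norm x) ^ 4 - 2 / 3 * (x $ 3 / norm x)\<^sup>2 + 1 / 9"
      proof -
        have "(c\<^sup>2 - 1 / 3)\<^sup>2 = c ^ 4 - 2 / 3 * c\<^sup>2 + 1 / 9" for c :: real
          by (simp add: power2_eq_square power4_eq_xxxx field_simps)
        then show ?thesis unfolding K_def .
      qed
      show ?thesis unfolding k2 by (simp add: algebra_simps)
    qed
    show "integrable ?M (\<lambda>x. f2 (norm x) * (K x)\<^sup>2)"
      unfolding e using mo2(1,3) i2 by simp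
    show "(LINT x|?M. f2 (norm x) * (K x)\<^sup>2) = 4 / 45 * (LINT x|?M. f2 (norm x))"
      unfolding e using mo2 i2 by simp
  qed
  obtain C where Y: "angular_field director_field director_deriv C" using director_field_angular ..
  have ax: "axis k 1 \<in> (Basis :: (real^3) set)" for k by (simp add: axis_in_Basis_iff)
  note rh = radial_field_W12[OF R h Y] and rg = radial_field_W12[OF R g constant_angular[of z_tensor]]
  define P where "P k = radial_partial h v director_field director_deriv (axis k 1)" for k :: 3
  define S where "S k = radial_partial g w (\<lambda>_. z_tensor) (\<lambda>_ _. 0) (axis k 1)" for k :: 3
  have Hdef: "hedgehog h = (\<lambda>x. h (norm x) *\<^sub>R director_field x)" by (simp add: fun_eq_iff hedgehog_eq)
  let ?H = "\<lambda>x. h (norm x) *\<^sub>R director_field x" and ?G = "\<lambda>x. g (norm x) *\<^sub>R z_tensor"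
  have W: "?H \<in> W12 ?B" "?G \<in> W12 ?B" by (rule rh(3)) (rule rg(3))
  have LHG: "L2_on ?B ?H" "L2_on ?B ?G" using W by (auto simp: W12_def)
  have LP: "L2_on ?B (P k)" "is_weak_partial ?B ?H (axis k 1) (P k)"
    "L2_on ?B (S k)" "is_weak_partial ?B ?G (axis k 1) (S k)" for k
    unfolding P_def S_def by (rule rh(1,2)[OF ax] rg(1,2)[OF ax])+
  let ?d1 = "\<lambda>x. ldg_density t (\<lambda>k. P k x) (?H x)"
  let ?d2 = "\<lambda>x. ldg_density t (\<lambda>k. P k x + S k x) (?H x + ?G x)"
  have E1: "LdG_energy R t (hedgehog h) = (LINT x|?M. ?d1 x)"
    unfolding Hdef by (rule LdG_energy_weak_partial[OF R W(1) LP(1,2)])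
  have E2: "LdG_energy R t (\<lambda>x. hedgehog h x + ?G x) = (LINT x|?M. ?d2 x)"
    unfolding Hdef
    by (rule LdG_energy_weak_partial[OF R W12_add[OF B W]])
      (intro L2_on_add is_weak_partial_add B ax LP LHG)+
  have md: "?d1 \<in> borel_measurable ?M" "?d2 \<in> borel_measurable ?M"
    by (intro ldg_density_measurable borel_measurable_add borel_measurable_of_L2_on[OF LP(1)]
        borel_measurable_of_L2_on[OF LP(3)] borel_measurable_of_L2_on[OF LHG(1)] borel_measurable_of_L2_on[OF LHG(2)])+
  \<comment> \<open>Integrability of the unperturbed density, and with it of the perturbed one, is
    what turns the difference of the energies into the integral of the difference.\<close>
  have id1: "integrable ?M ?d1"
  proof -
    define c where "c r = - 1 / 2 * (H r)\<^sup>2 - sqrt 6 * h_plus t / t * (2 / 9 * (s * H r) ^ 3)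
      + (h_plus t)\<^sup>2 / (2 * t) * ((H r)\<^sup>2)\<^sup>2 + C_const t" for r
    have cc: "continuous_on UNIV c" unfolding c_def by (intro continuous_intros cont)
    have ic: "integrable ?M (\<lambda>x. c (norm x))"
      by (rule radial_integrable_of_L2[OF borel_measurable_continuous_onI[OF cc] cL[OF cc]])
    have "integrable ?M (\<lambda>x. 1 / 2 * (\<Sum>k\<in>UNIV. P k x \<bullet> P k x) + c (norm x))"
      using ic integrable_of_L2_on[OF LP(1)] by (simp add: power2_norm_eq_inner)
    then show ?thesis
    proof (rule integrable_cong_AE_imp[OF _ md(1)])
      show "AE x in ?M. 1 / 2 * (\<Sum>k\<in>UNIV. P k x \<bullet> P k x) + c (norm x) = ?d1 x"
        using AE_ball_nonzero
      proof eventually_elim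
        case (elim x)
        then have "H (norm x) = h (norm x)" using HG by simp
        then show ?case using ldg_density_perturbed[of x t "\<lambda>k. P k x" "h (norm x)" 0] elim by (simp add: c_def s_def)
      qed
    qed
  qed
  have diff: "AE x in ?M. ?d2 x - ?d1 x = f0 (norm x) + f1 (norm x) * K x + f2 (norm x) * (K x)\<^sup>2"
    using AE_ball_nonzero
  proof eventually_elim
    case (elim x)
    then have x: "x \<noteq> 0" and e: "H (norm x) = h (norm x)" "G (norm x) = g (norm x)" using HG by auto
    define r \<eta> \<gamma> \<nu> \<omega> where "r = norm x" and "\<eta> = h (norm x)" and "\<gamma> = g (norm x)" and "\<nu> = v (norm x)" and "\<omega> = w (norm x)"
    have r: "r > 0" using x by (simp add: r_def)
    have xk: "x \<bullet> axis k 1 = x $ k" for k by (simp add: inner_axis)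
    have S: "S k x = (\<omega> * (x $ k / r)) *\<^sub>R z_tensor" for k
      by (simp add: S_def radial_partial_def xk \<omega>_def r_def)
    have sum1: "(\<Sum>k\<in>UNIV. (x $ k / r)\<^sup>2) = 1"
    proof -
      have "(norm x)\<^sup>2 = (x $ 1)\<^sup>2 + (x $ 2)\<^sup>2 + (x $ 3)\<^sup>2" unfolding norm_vec3 by simp
      then have "r\<^sup>2 = (\<Sum>k\<in>UNIV. (x $ k)\<^sup>2)" by (simp add: r_def sum_3)
      then have r2: "(\<Sum>k\<in>UNIV. (x $ k)\<^sup>2) = r\<^sup>2" ..
      have "(\<Sum>k\<in>UNIV. (x $ k / r)\<^sup>2) = (\<Sum>k\<in>UNIV. (x $ k)\<^sup>2) / r\<^sup>2"
        by (simp only: power_divide sum_divide_distrib)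
      then show ?thesis unfolding r2 using r by simp
    qed
    have SS: "(\<Sum>k\<in>UNIV. S k x \<bullet> S k x) = 2 / 3 * \<omega>\<^sup>2"
    proof -
      have "S k x \<bullet> S k x = 2 / 3 * \<omega>\<^sup>2 * (x $ k / r)\<^sup>2" for k
        unfolding S by (simp add: z_tensor_inner(1)[OF x] power2_eq_square ac_simps)
      then have "(\<Sum>k\<in>UNIV. S k x \<bullet> S k x) = 2 / 3 * \<omega>\<^sup>2 * (\<Sum>k\<in>UNIV. (x $ k / r)\<^sup>2)"
        by (simp only: sum_distrib_left)
      then show ?thesis unfolding sum1 by simp
    qed
    \<comment> \<open>Each \<open>S k x\<close> is proportional to \<open>x $ k\<close>, so the
      cross term only sees the radial derivative of the hedgehog; the derivative of the director
      drops out by Euler's relation.\<close>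
    have PS: "(\<Sum>k\<in>UNIV. P k x \<bullet> S k x) = s * \<nu> * \<omega> * K x"
    proof -
      have P: "(\<Sum>k\<in>UNIV. (x $ k / r) *\<^sub>R P k x) = \<nu> *\<^sub>R director_field x"
      proof -
        have "(x $ k / r) *\<^sub>R P k x = (x $ k / r)\<^sup>2 *\<^sub>R (\<nu> *\<^sub>R director_field x)
            + (\<eta> / r) *\<^sub>R (x $ k *\<^sub>R director_deriv x (axis k 1))" for k
          by (simp add: P_def radial_partial_def xk \<nu>_def \<eta>_def r_def scaleR_add_right power2_eq_square mult.commute)
        then have "(\<Sum>k\<in>UNIV. (x $ k / r) *\<^sub>R P k x) = (\<Sum>k\<in>UNIV. (x $ k / r)\<^sup>2) *\<^sub>R (\<nu> *\<^sub>R director_field x)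
            + (\<eta> / r) *\<^sub>R (\<Sum>k\<in>UNIV. x $ k *\<^sub>R director_deriv x (axis k 1))"
          by (simp only: sum.distrib scaleR_sum_left scaleR_sum_right)
        then show ?thesis unfolding sum1 director_deriv_sum[OF x] by simp
      qed
      have "(\<Sum>k\<in>UNIV. P k x \<bullet> S k x) = \<omega> * ((\<Sum>k\<in>UNIV. (x $ k / r) *\<^sub>R P k x) \<bullet> z_tensor)"
        unfolding S by (simp add: inner_sum_left sum_distrib_left mult.assoc)
      then show ?thesis unfolding P by (simp add: z_tensor_inner(2)[OF x] K_def s_def)
    qed
    have quad: "(\<Sum>k\<in>UNIV. (P k x + S k x) \<bullet> (P k x + S k x))
        = (\<Sum>k\<in>UNIV. P k x \<bullet> P k x) + 2 * (s * \<nu> * \<omega> * K x) + 2 / 3 * \<omega>\<^sup>2"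
    proof -
      have "(P k x + S k x) \<bullet> (P k x + S k x) = P k x \<bullet> P k x + 2 * (P k x \<bullet> S k x) + S k x \<bullet> S k x" for k
        by (simp add: inner_add_left inner_add_right inner_commute)
      then have "(\<Sum>k\<in>UNIV. (P k x + S k x) \<bullet> (P k x + S k x))
          = (\<Sum>k\<in>UNIV. P k x \<bullet> P k x) + 2 * (\<Sum>k\<in>UNIV. P k x \<bullet> S k x) + (\<Sum>k\<in>UNIV. S k x \<bullet> S k x)"
        by (simp only: sum.distrib sum_distrib_left)
      then show ?thesis unfolding PS SS .
    qed
    have fs: "f0 (norm x) = \<omega>\<^sup>2 / 3 + (- \<gamma>\<^sup>2 / 3 - 2 * sqrt 6 / 9 * a * \<gamma> ^ 3 + b * (4 / 9 * \<gamma> ^ 4 + 4 / 3 * \<eta>\<^sup>2 * \<gamma>\<^sup>2))"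
      "f1 (norm x) = s * (\<nu> * \<omega>) + (- s * \<eta> * \<gamma> - sqrt 6 * a * (s\<^sup>2 * \<eta>\<^sup>2 * \<gamma> + s * \<eta> * \<gamma>\<^sup>2)
        + b * (4 * s * \<eta> ^ 3 * \<gamma> + 8 / 3 * s * \<eta> * \<gamma> ^ 3))"
      "f2 (norm x) = 6 * b * \<eta>\<^sup>2 * \<gamma>\<^sup>2"
      by (simp_all add: f0_def f1_def f2_def e \<eta>_def \<gamma>_def \<nu>_def \<omega>_def)
    have b6: "6 * b * \<eta>\<^sup>2 * \<gamma>\<^sup>2 = b * (4 * s\<^sup>2 * \<eta>\<^sup>2 * \<gamma>\<^sup>2)" by (simp add: s2)
    have d1: "?d1 x = 1 / 2 * (\<Sum>k\<in>UNIV. P k x \<bullet> P k x) - 1 / 2 * \<eta>\<^sup>2 - sqrt 6 * a * (2 / 9 * (s * \<eta>) ^ 3)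
        + b * (\<eta>\<^sup>2)\<^sup>2 + C_const t"
      using ldg_density_perturbed[OF x, of t "\<lambda>k. P k x" \<eta> 0] by (simp add: a_def b_def s_def \<eta>_def)
    have d2: "?d2 x = 1 / 2 * ((\<Sum>k\<in>UNIV. P k x \<bullet> P k x) + 2 * (s * \<nu> * \<omega> * K x) + 2 / 3 * \<omega>\<^sup>2)
      - 1 / 2 * (\<eta>\<^sup>2 + 2 * (s * \<eta>) * \<gamma> * K x + 2 / 3 * \<gamma>\<^sup>2)
      - sqrt 6 * a * (2 / 9 * (s * \<eta>) ^ 3 + ((s * \<eta>)\<^sup>2 * \<gamma> + s * \<eta> * \<gamma>\<^sup>2) * K x + 2 / 9 * \<gamma> ^ 3)
      + b * (\<eta>\<^sup>2 + 2 * (s * \<eta>) * \<gamma> * K x + 2 / 3 * \<gamma>\<^sup>2)\<^sup>2 + C_const t"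
      using ldg_density_perturbed[OF x, of t "\<lambda>k. P k x + S k x" \<eta> \<gamma>] unfolding quad
      by (simp add: a_def b_def s_def \<eta>_def \<gamma>_def K_def)
    show ?case
      unfolding d1 d2 fs b6
      by (simp add: power2_eq_square power3_eq_cube power4_eq_xxxx field_simps)
  qed
  have ifs: "integrable ?M (\<lambda>x. f0 (norm x) + f1 (norm x) * K x + f2 (norm x) * (K x)\<^sup>2)"
    using i0 K1(1) K2(1) by simp
  have idiff: "integrable ?M (\<lambda>x. ?d2 x - ?d1 x)"
    by (rule integrable_cong_AE_imp[OF ifs]) (use md diff in \<open>auto elim: eventually_mono\<close>)
  have id2: "integrable ?M ?d2"
    using Bochner_Integration.integrable_add[OF idiff id1] by simp
  have "LdG_energy R t (\<lambda>x. hedgehog h x + ?G x) - LdG_energy R t (hedgehog h) = (LINT x|?M. ?d2 x - ?d1 x)"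
    unfolding E1 E2 using id1 id2 by simp
  also have "\<dots> = (LINT x|?M. f0 (norm x) + f1 (norm x) * K x + f2 (norm x) * (K x)\<^sup>2)"
    by (rule integral_cong_AE) (use idiff ifs diff in auto)
  also have "\<dots> = (LINT x|?M. f0 (norm x)) + 4 / 45 * (LINT x|?M. f2 (norm x))"
    using i0 K1 K2 by simp
  also have "\<dots> = (LINT x|?M. f0 (norm x) + 4 / 45 * f2 (norm x))" using i0 i2 by simp
  also have "\<dots> = 4 * pi * (LINT r|lebesgue_on ?I. r\<^sup>2 * (f0 r + 4 / 45 * f2 r))"
    using m by (intro radial_integral(2)) auto
  also have eqF: "(LINT r|lebesgue_on ?I. r\<^sup>2 * (f0 r + 4 / 45 * f2 r)) = (LINT r|lebesgue_on ?I. r\<^sup>2 * F r)"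
    by (rule Bochner_Integration.integral_cong[OF refl])
      (auto simp: F_def f0_def f2_def HG a_def b_def algebra_simps)
  finally show "LdG_energy R t (\<lambda>x. hedgehog h x + g (norm x) *\<^sub>R z_tensor) - LdG_energy R t (hedgehog h)
      = 4 * pi * (LINT r|lebesgue_on {0<..<R}. r\<^sup>2 * F r)" .
  have "integrable ?M (\<lambda>x. f0 (norm x) + 4 / 45 * f2 (norm x))" using i0 i2 by simp
  then have "integrable (lebesgue_on ?I) (\<lambda>r. r\<^sup>2 * (f0 r + 4 / 45 * f2 r))"
    using radial_integral(1)[of "\<lambda>r. f0 r + 4 / 45 * f2 r" R] m by auto
  then show "integrable (lebesgue_on {0<..<R}) (\<lambda>r. r\<^sup>2 * F r)"
    by (rule Bochner_Integration.integrable_cong[THEN iffD1, rotated -1])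
      (auto simp: F_def f0_def f2_def HG a_def b_def algebra_simps)
qed


text \<open>The difference from the boundary datum is the director field with profile
  \<open>h - 1\<close>, which vanishes at \<open>R\<close>; hence it lies in
  \<open>W12_0\<close>.\<close>

lemma hedgehog_admissible:
  assumes R: "R > 0" and h: "ac_on R h v" "h R = 1"
  shows "hedgehog h \<in> W12 (ball 0 R)" "AE x in lebesgue_on (ball 0 R). hedgehog h x \<in> sym_traceless"
    "(\<lambda>x. hedgehog h x - hedgehog (\<lambda>_. 1) x) \<in> W12_0 (ball 0 R)" "hedgehog h \<in> Q_class R"
proof -
  obtain C where Y: "angular_field director_field director_deriv C" using director_field_angular ..
  show 1: "hedgehog h \<in> W12 (ball 0 R)"
    using radial_field_W12(3)[OF R h(1) Y] by (simp add: hedgehog_eq[abs_def])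
  show 2: "AE x in lebesgue_on (ball 0 R). hedgehog h x \<in> sym_traceless"
    using AE_ball_nonzero by eventually_elim (simp add: hedgehog_eq director_sym_traceless)
  have "ac_on R (\<lambda>r. h r - 1) v"
    unfolding ac_on_def
  proof (intro conjI ballI ac_onD(1,2)[OF h(1)])
    show "h r - 1 = h R - 1 - integral {r..R} v" if "r \<in> {0..R}" for r
      using ac_onD(3)[OF h(1), of r] that by (simp only: atLeastAtMost_iff)
  qed
  from radial_field_W12(4)[OF R this Y] h(2)
  show 3: "(\<lambda>x. hedgehog h x - hedgehog (\<lambda>_. 1) x) \<in> W12_0 (ball 0 R)"
    by (simp add: hedgehog_eq scaleR_diff_left)
  show "hedgehog h \<in> Q_class R" using 1 2 3 by (simp add: Q_class_def)
qed

lemma perturbed_hedgehog_admissible: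
  assumes R: "R > 0" and h: "ac_on R h v" "h R = 1" and g: "ac_on R g w" "g R = 0"
  shows "(\<lambda>x. hedgehog h x + g (norm x) *\<^sub>R z_tensor) \<in> Q_class R"
proof -
  note H = hedgehog_admissible[OF R h] and G = radial_field_W12(3,4)[OF R g(1) constant_angular[of z_tensor]]
  have "(\<lambda>x. hedgehog h x + g (norm x) *\<^sub>R z_tensor) \<in> W12 (ball 0 R)"
    by (rule W12_add[OF _ H(1) G(1)]) auto
  moreover have "AE x in lebesgue_on (ball 0 R). hedgehog h x + g (norm x) *\<^sub>R z_tensor \<in> sym_traceless"
    using H(2)
  proof eventually_elim
    case (elim x)
    then show ?case using z_tensor_sym_traceless[of "g (norm x)"]
      by (simp add: sym_traceless_def transpose_def trace_def vec_eq_iff sum.distrib)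
  qed
  moreover have "(\<lambda>x. hedgehog h x + g (norm x) *\<^sub>R z_tensor - hedgehog (\<lambda>_. 1) x) \<in> W12_0 (ball 0 R)"
    using W12_0_add[OF R H(3) G(2)[OF g(2)]] by (simp add: algebra_simps)
  ultimately show ?thesis by (simp add: Q_class_def)
qed

section \<open>Instability of the hedgehog\<close>

definition bump :: "real \<Rightarrow> real" where
  "bump r = (if r \<in> {0..10} then 1 / (r\<^sup>2 + 12)\<^sup>2 * (1 - r / 10) else 0)"

definition bump_deriv :: "real \<Rightarrow> real" where
  "bump_deriv r = (if r \<in> {0..10} then - (r\<^sup>2 + 12 + 4 * r * (10 - r)) / (10 * (r\<^sup>2 + 12) ^ 3) else 0)"

lemma Q_hat_eq: "Q_hat 10 h x = hedgehog h x + bump (norm x) *\<^sub>R z_tensor"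
  by (simp add: Q_hat_def bump_def z_tensor_def)

lemma bump_ac_on:
  assumes R: "R \<ge> 12" shows "ac_on R bump bump_deriv" "\<exists>M. \<forall>r. \<bar>bump_deriv r\<bar> \<le> M"
proof -
  have X: "r\<^sup>2 + 12 > 0" for r :: real by (intro add_nonneg_pos) auto
  let ?w = "\<lambda>r :: real. - (r\<^sup>2 + 12 + 4 * r * (10 - r)) / (10 * (r\<^sup>2 + 12) ^ 3)"
  have d: "((\<lambda>r :: real. 1 / (r\<^sup>2 + 12)\<^sup>2 * (1 - r / 10)) has_real_derivative ?w r) (at r)" for r
  proof -
    define x where "x = r\<^sup>2 + 12"
    have x: "x > 0" using X by (simp add: x_def)
    have "((\<lambda>r :: real. (1 - r / 10) / (r\<^sup>2 + 12)\<^sup>2) has_real_derivative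
      (- (1 / 10) * x\<^sup>2 - (1 - r / 10) * (2 * x * (2 * r))) / (x\<^sup>2 * x\<^sup>2)) (at r)"
      unfolding x_def using X[of r] by (intro DERIV_divide) (auto intro!: derivative_eq_intros)
    moreover have "(- (1 / 10) * x\<^sup>2 - (1 - r / 10) * (2 * x * (2 * r))) / (x\<^sup>2 * x\<^sup>2) = - (x + 4 * r * (10 - r)) / (10 * x ^ 3)"
      using x by (simp add: field_simps power2_eq_square power3_eq_cube)
    ultimately show ?thesis by (simp add: x_def)
  qed
  have c: "continuous_on UNIV ?w" using X by (intro continuous_intros) (auto simp: less_le)
  have z: "ac_on R (\<lambda>_. 0) (\<lambda>_. 0)" by (rule ac_on_C1) auto
  show "ac_on R bump bump_deriv"
    unfolding bump_def[abs_def] bump_deriv_def[abs_def]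
    by (rule ac_on_splice[OF _ z ac_on_C1[OF d c]]) (use R in auto)
  have "bounded (?w ` {0..10})"
    by (intro compact_imp_bounded compact_continuous_image continuous_on_subset[OF c]) auto
  then obtain M where M: "\<And>y. y \<in> ?w ` {0..10} \<Longrightarrow> norm y \<le> M" unfolding bounded_iff by blast
  have "\<bar>bump_deriv r\<bar> \<le> max M 0" for r
  proof (cases "r \<in> {0..10}")
    case True
    have "norm (?w r) \<le> M" by (rule M) (rule imageI[OF True])
    then have "\<bar>?w r\<bar> \<le> M" unfolding real_norm_def .
    then show ?thesis unfolding bump_deriv_def if_P[OF True] by linarith
  next
    case False
    then show ?thesis unfolding bump_deriv_def if_not_P[OF False] by simp
  qed
  then show "\<exists>M. \<forall>r. \<bar>bump_deriv r\<bar> \<le> M" by blast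
qed

text \<open>In the Bernstein bases of \<open>{0..4}\<close> and \<open>{4..10}\<close> all coefficients are positive.\<close>
lemma certificate_polynomial_pos:
  fixes r :: real
  assumes "0 \<le> r" "r \<le> 10"
  shows "33177600 - 74200320 * r + 135254016 * r ^ 2 - 28981440 * r ^ 3 + 2053872 * r ^ 4 - 624720 * r ^ 5
    - 21564 * r ^ 6 + 239400 * r ^ 7 - 91170 * r ^ 8 + 14220 * r ^ 9 - 711 * r ^ 10 > 0" (is "?P > 0")
proof (cases "r \<le> 4")
  case True
  define w where "w = 4 - r"
  have w: "w \<ge> 0" using True by (simp add: w_def)
  \<comment> \<open>The relation \<open>r + w = 4\<close> homogenizes the polynomial to degree 10 in
    \<open>r\<close> and \<open>w\<close>, which makes positivity visible term by term.\<close>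
  have "4 ^ 10 * ?P = 33177600 * w ^ 10 + 34974720 * r * w ^ 9 + 985844736 * r ^ 2 * w ^ 8
      + 8754167808 * r ^ 3 * w ^ 7 + 30171893760 * r ^ 4 * w ^ 6 + 55715371008 * r ^ 5 * w ^ 5
      + 60736382976 * r ^ 6 * w ^ 4 + 43006894080 * r ^ 7 * w ^ 3 + 19202740224 * r ^ 8 * w ^ 2
      + 5137112064 * r ^ 9 * w + 772942848 * r ^ 10"
    unfolding w_def by algebra
  moreover have "\<dots> > 0"
  proof (cases "r = 0")
    case True then show ?thesis by (simp add: w_def)
  next
    case False
    then show ?thesis using assms w by (intro add_nonneg_pos add_nonneg_nonneg) auto
  qed
  ultimately show ?thesis by simp
next
  case False
  define s where "s = r - 4"
  define w where "w = 6 - s"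
  have s: "s > 0" and w: "w \<ge> 0" using False assms by (simp_all add: s_def w_def)
  have r: "r = s + 4" by (simp add: s_def)
  have "6 ^ 10 * ?P = 772942848 * w ^ 10 + 11617903104 * s * w ^ 9 + 87218809344 * s ^ 2 * w ^ 8
      + 434467560960 * s ^ 3 * w ^ 7 + 1555319644416 * s ^ 4 * w ^ 6 + 4039070427648 * s ^ 5 * w ^ 5
      + 7457605608960 * s ^ 6 * w ^ 4 + 9355461677568 * s ^ 7 * w ^ 3 + 7293684600576 * s ^ 8 * w ^ 2
      + 2904313344000 * s ^ 9 * w + 307337856000 * s ^ 10"
    unfolding w_def r by algebra
  moreover have "\<dots> > 0"
    using s w by (intro add_nonneg_pos add_nonneg_nonneg) auto
  ultimately show ?thesis by simp
qed

text \<open>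
  The right-hand side is the derivative of \<open>- 37 * (10 - r) * r ^ 3 / (300 * (r\<^sup>2 + 12) ^ 5)\<close>, which
  vanishes at both ends of \<open>{0..10}\<close>; the primitive was found by fitting.
\<close>
lemma bump_energy_density_less:
  fixes r :: real
  assumes r: "0 < r" "r \<le> 10"
  shows "r\<^sup>2 * ((bump_deriv r)\<^sup>2 / 3 + (bump r)\<^sup>2 * (- 0.333 + 0.57 * r ^ 4 / (r ^ 4 + 6 * r\<^sup>2 + 36)))
    < - 37 * ((30 * r\<^sup>2 - 4 * r ^ 3) * (r\<^sup>2 + 12) - 10 * r ^ 4 * (10 - r)) / (300 * (r\<^sup>2 + 12) ^ 6)"
proof -
  define X D q where "X = r\<^sup>2 + 12" and "D = r ^ 4 + 6 * r\<^sup>2 + 36" and "q = X + 4 * r * (10 - r)"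
  have X: "X > 0" and D: "D > 0" unfolding X_def D_def by (intro add_nonneg_pos add_nonneg_nonneg; simp)+
  have g: "bump r = (10 - r) / (10 * X\<^sup>2)" and w: "bump_deriv r = - q / (10 * X ^ 3)"
    using r by (simp_all add: bump_def bump_deriv_def X_def q_def field_simps)
  define u where "u = - 0.333 * D + 0.57 * r ^ 4"
  have u: "- 0.333 + 0.57 * r ^ 4 / D = u / D" using D by (simp add: u_def field_simps)
  \<comment> \<open>The claim after division by r^2 and multiplication by
    \<open>300 * X ^ 6 * D\<close>; the factor 1000 makes the coefficients integers.\<close>
  have "1000 * (D * (- 37 * ((30 - 4 * r) * X - 10 * r\<^sup>2 * (10 - r)) - q\<^sup>2) - 3 * (10 - r)\<^sup>2 * X\<^sup>2 * u)
    = 33177600 - 74200320 * r + 135254016 * r ^ 2 - 28981440 * r ^ 3 + 2053872 * r ^ 4 - 624720 * r ^ 5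
    - 21564 * r ^ 6 + 239400 * r ^ 7 - 91170 * r ^ 8 + 14220 * r ^ 9 - 711 * r ^ 10"
  proof -
    have "1000 * u = - 333 * D + 570 * r ^ 4" by (simp add: u_def)
    then show ?thesis unfolding q_def X_def D_def by algebra
  qed
  also have "\<dots> > 0" using certificate_polynomial_pos[of r] r by simp
  finally have "q\<^sup>2 * D + 3 * (10 - r)\<^sup>2 * X\<^sup>2 * u < - 37 * ((30 - 4 * r) * X - 10 * r\<^sup>2 * (10 - r)) * D"
    by (simp add: algebra_simps)
  then have "q\<^sup>2 + 3 * (10 - r)\<^sup>2 * X\<^sup>2 * (u / D) < - 37 * ((30 - 4 * r) * X - 10 * r\<^sup>2 * (10 - r))"
    using D by (simp add: field_simps)
  then have l: "r\<^sup>2 / (300 * X ^ 6) * (q\<^sup>2 + 3 * (10 - r)\<^sup>2 * X\<^sup>2 * (u / D))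
      < r\<^sup>2 / (300 * X ^ 6) * (- 37 * ((30 - 4 * r) * X - 10 * r\<^sup>2 * (10 - r)))"
    using X r by (intro mult_strict_left_mono) auto
  have e1: "r\<^sup>2 * ((bump_deriv r)\<^sup>2 / 3 + (bump r)\<^sup>2 * (u / D))
      = r\<^sup>2 / (300 * X ^ 6) * (q\<^sup>2 + 3 * (10 - r)\<^sup>2 * X\<^sup>2 * (u / D))"
  proof -
    have "(bump_deriv r)\<^sup>2 / 3 = q\<^sup>2 / (300 * X ^ 6)" unfolding w by (simp add: power_divide power_mult_distrib flip: power_mult)
    moreover have "(bump r)\<^sup>2 = 3 * (10 - r)\<^sup>2 * X\<^sup>2 / (300 * X ^ 6)"
      unfolding g using X by (simp add: power_divide power_mult_distrib field_simps flip: power_mult power_add)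
    ultimately show ?thesis by (simp add: algebra_simps add_divide_distrib)
  qed
  have e2: "r\<^sup>2 / (300 * X ^ 6) * (- 37 * ((30 - 4 * r) * X - 10 * r\<^sup>2 * (10 - r)))
      = - 37 * ((30 * r\<^sup>2 - 4 * r ^ 3) * X - 10 * r ^ 4 * (10 - r)) / (300 * X ^ 6)"
  proof -
    have "r\<^sup>2 * (- 37 * ((30 - 4 * r) * X - 10 * r\<^sup>2 * (10 - r)))
        = - 37 * ((30 * r\<^sup>2 - 4 * r ^ 3) * X - 10 * r ^ 4 * (10 - r))" by algebra
    then show ?thesis by (simp only: times_divide_eq_left)
  qed
  show ?thesis unfolding X_def[symmetric] D_def[symmetric] u e1 e2[symmetric] by (rule l)
qed

lemma Q_hat_lower_energy:
  assumes R: "R \<ge> 12" and t: "t \<ge> 200" and min: "is_arg_min (radial_energy R t) (\<lambda>g. g \<in> radial_class R) h"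
  shows "hedgehog h \<in> Q_class R" "Q_hat 10 h \<in> Q_class R"
    "LdG_energy R t (Q_hat 10 h) < LdG_energy R t (hedgehog h)"
proof -
  let ?I = "{0<..<R}"
  have R0: "R > 0" using R by simp
  have hc: "h \<in> W12 ?I" "continuous_on {0..R} h" "h R = 1"
    using min by (auto simp: is_arg_min_def radial_class_def)
  obtain v where v: "ac_on R h v" using W12_imp_ac_on[OF R0 hc(1,2)] .
  obtain M where M: "\<And>r. \<bar>bump_deriv r\<bar> \<le> M" using bump_ac_on(2)[OF R] by blast
  note g = bump_ac_on(1)[OF R]
  have Q: "Q_hat 10 h = (\<lambda>x. hedgehog h x + bump (norm x) *\<^sub>R z_tensor)" by (simp add: fun_eq_iff Q_hat_eq)
  show "hedgehog h \<in> Q_class R" by (rule hedgehog_admissible[OF R0 v hc(3)])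
  show "Q_hat 10 h \<in> Q_class R"
    unfolding Q by (rule perturbed_hedgehog_admissible[OF R0 v hc(3) g]) (use R in \<open>simp add: bump_def\<close>)
  define a b where "a = h_plus t / t" and "b = (h_plus t)\<^sup>2 / (2 * t)"
  \<comment> \<open>The bound on \<open>b\<close> is \<open>(1 + 3 * 0.054) / 4\<close>.\<close>
  have ab: "0 < a" "0 \<le> b" "b \<le> 0.2905"
    using landau_coefficients[of t] landau_coefficient_le[OF t] t by (auto simp: a_def b_def)
  define F where "F r = (bump_deriv r)\<^sup>2 / 3 - (bump r)\<^sup>2 / 3 - 2 * sqrt 6 / 9 * a * (bump r) ^ 3
      + b * (28 / 15 * (h r)\<^sup>2 * (bump r)\<^sup>2 + 4 / 9 * (bump r) ^ 4)" for r
  note diff = ldg_energy_difference[OF R0 v g M, of t, folded a_def b_def, folded F_def]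
  define W' where "W' r = - 37 * ((30 * r\<^sup>2 - 4 * r ^ 3) * (r\<^sup>2 + 12) - 10 * r ^ 4 * (10 - r)) / (300 * (r\<^sup>2 + 12) ^ 6)" for r :: real
  have X: "r\<^sup>2 + 12 > 0" for r :: real by (intro add_nonneg_pos) auto
  have W: "((\<lambda>r. - 37 * ((10 - r) * r ^ 3) / (300 * (r\<^sup>2 + 12) ^ 5)) has_real_derivative W' r) (at r)" for r
  proof -
    define x where "x = r\<^sup>2 + 12"
    have x: "x > 0" using X by (simp add: x_def)
    have "((\<lambda>r. - 37 * ((10 - r) * r ^ 3) / (300 * (r\<^sup>2 + 12) ^ 5)) has_real_derivative
      (- 37 * (30 * r\<^sup>2 - 4 * r ^ 3) * (300 * x ^ 5) - - 37 * ((10 - r) * r ^ 3) * (300 * (5 * x ^ 4 * (2 * r))))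
        / ((300 * x ^ 5) * (300 * x ^ 5))) (at r)"
      unfolding x_def using X[of r]
      by (intro DERIV_divide) (auto intro!: derivative_eq_intros simp: algebra_simps power2_eq_square power3_eq_cube)
    moreover have "(- 37 * (30 * r\<^sup>2 - 4 * r ^ 3) * (300 * x ^ 5) - - 37 * ((10 - r) * r ^ 3) * (300 * (5 * x ^ 4 * (2 * r))))
        / ((300 * x ^ 5) * (300 * x ^ 5)) = - 37 * ((30 * r\<^sup>2 - 4 * r ^ 3) * x - 10 * r ^ 4 * (10 - r)) / (300 * x ^ 6)"
    proof -
      have e1: "- 37 * (30 * r\<^sup>2 - 4 * r ^ 3) * (300 * x ^ 5) - - 37 * ((10 - r) * r ^ 3) * (300 * (5 * x ^ 4 * (2 * r)))
          = (- 37 * ((30 * r\<^sup>2 - 4 * r ^ 3) * x - 10 * r ^ 4 * (10 - r))) * (300 * x ^ 4)" by algebra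
      have e2: "(300 * x ^ 5) * (300 * x ^ 5) = (300 * x ^ 6) * (300 * x ^ 4)" by algebra
      have "300 * x ^ 4 \<noteq> 0" using x by simp
      then show ?thesis unfolding e1 e2 by (rule nonzero_mult_divide_mult_cancel_right)
    qed
    ultimately show ?thesis by (simp add: W'_def x_def)
  qed
  have cW: "continuous_on UNIV W'" unfolding W'_def using X by (intro continuous_intros) (auto simp: less_le)
  \<comment> \<open>Applied to the constant 1, integration by parts reduces to the fundamental
    theorem for the explicit primitive, which vanishes at 0 and at 10.\<close>
  have one: "ac_on R (\<lambda>_. 1) (\<lambda>_. 0)" by (rule ac_on_C1) auto
  have iW: "integrable (lebesgue_on ?I) (\<lambda>r. indicator {0..10} r * W' r)"
    "(LINT r|lebesgue_on ?I. indicator {0..10} r * W' r) = 0"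
    using ac_on_by_parts[OF R0 one _ _ _ W cW, of 0 10] R by simp_all
  have less: "r\<^sup>2 * F r < W' r" if r: "0 < r" "r \<le> 10" for r
  proof -
    define D where "D = r ^ 4 + 6 * r\<^sup>2 + 36"
    have D: "D > 0" unfolding D_def by (intro add_nonneg_pos add_nonneg_nonneg) auto
    have g0: "bump r \<ge> 0" "bump r \<le> 1 / 144"
    proof -
      show "bump r \<ge> 0" using r by (simp add: bump_def)
      have "(12 :: real)\<^sup>2 \<le> (r\<^sup>2 + 12)\<^sup>2" by (intro power_mono) auto
      then have "1 / (r\<^sup>2 + 12)\<^sup>2 \<le> 1 / 144" by (intro divide_left_mono) auto
      then have "1 / (r\<^sup>2 + 12)\<^sup>2 * (1 - r / 10) \<le> 1 / 144 * 1" using r by (intro mult_mono) auto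
      then show "bump r \<le> 1 / 144" using r by (simp add: bump_def)
    qed
    have h2: "(h r)\<^sup>2 \<le> 1.05 * r ^ 4 / D" unfolding D_def using profile_bound[OF R t min, of r] r by simp
    \<comment> \<open>Since the bump is nonnegative, the cubic term lowers the energy and may be
      dropped.\<close>
    have A: "0 \<le> 2 * sqrt 6 / 9 * a * (bump r) ^ 3" using ab g0 by simp
    \<comment> \<open>The product of 0.2905, 1.05 and 28/15 is 0.56938, rounded up to 0.57.\<close>
    have B: "b * (28 / 15 * (h r)\<^sup>2 * (bump r)\<^sup>2) \<le> 0.57 * r ^ 4 / D * (bump r)\<^sup>2"
    proof -
      have "b * (h r)\<^sup>2 \<le> 0.2905 * (1.05 * r ^ 4 / D)" using ab h2 by (intro mult_mono) auto
      then have "b * (h r)\<^sup>2 * (28 / 15) \<le> 0.56938 * (r ^ 4 / D)" by simp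
      also have "\<dots> \<le> 0.57 * (r ^ 4 / D)" using D by (intro mult_right_mono) auto
      finally have "b * (h r)\<^sup>2 * (28 / 15) * (bump r)\<^sup>2 \<le> 0.57 * (r ^ 4 / D) * (bump r)\<^sup>2"
        by (intro mult_right_mono) auto
      then show ?thesis by (simp add: algebra_simps)
    qed
    \<comment> \<open>The bump is at most 1/144, so its quartic term is tiny; it is hidden in the
      rounding of - 1/3 to - 0.333.\<close>
    have C: "b * (4 / 9 * (bump r) ^ 4) \<le> 0.0003 * (bump r)\<^sup>2"
    proof -
      have "(bump r)\<^sup>2 \<le> (1 / 144)\<^sup>2" using g0 by (intro power_mono) auto
      then have "b * (4 / 9) * (bump r)\<^sup>2 \<le> 0.2905 * (4 / 9) * (1 / 144)\<^sup>2"
        using ab by (intro mult_mono) auto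
      also have "\<dots> \<le> 0.0003" by (simp add: power2_eq_square)
      finally have "b * (4 / 9) * (bump r)\<^sup>2 * (bump r)\<^sup>2 \<le> 0.0003 * (bump r)\<^sup>2" by (intro mult_right_mono) auto
      then show ?thesis by (simp add: algebra_simps flip: power_add)
    qed
    have E: "- (1 / 3) * (bump r)\<^sup>2 + 0.0003 * (bump r)\<^sup>2 \<le> - 0.333 * (bump r)\<^sup>2"
    proof -
      have "(- (1 / 3) + 0.0003) * (bump r)\<^sup>2 \<le> - 0.333 * (bump r)\<^sup>2" by (intro mult_right_mono) auto
      then show ?thesis by (simp add: algebra_simps)
    qed
    have "F r \<le> (bump_deriv r)\<^sup>2 / 3 + (bump r)\<^sup>2 * (- 0.333 + 0.57 * r ^ 4 / D)"
    proof -
      have "F r = (bump_deriv r)\<^sup>2 / 3 + - (1 / 3) * (bump r)\<^sup>2 - 2 * sqrt 6 / 9 * a * (bump r) ^ 3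
          + b * (28 / 15 * (h r)\<^sup>2 * (bump r)\<^sup>2) + b * (4 / 9 * (bump r) ^ 4)"
        by (simp add: F_def distrib_left)
      moreover have "(bump r)\<^sup>2 * (- 0.333 + 0.57 * r ^ 4 / D) = - 0.333 * (bump r)\<^sup>2 + 0.57 * r ^ 4 / D * (bump r)\<^sup>2"
        by (simp only: distrib_left mult.commute)
      ultimately show ?thesis using A B C E by linarith
    qed
    then have "r\<^sup>2 * F r \<le> r\<^sup>2 * ((bump_deriv r)\<^sup>2 / 3 + (bump r)\<^sup>2 * (- 0.333 + 0.57 * r ^ 4 / D))"
      by (intro mult_left_mono) auto
    also have "\<dots> < W' r" using bump_energy_density_less[OF r] unfolding D_def W'_def .
    finally show ?thesis .
  qed
  have "(LINT r|lebesgue_on ?I. indicator {0..10} r * W' r - r\<^sup>2 * F r) > 0"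
  proof (rule integral_pos_of_pos_on_interval[where a=0 and b=10])
    show "integrable (lebesgue_on ?I) (\<lambda>r. indicator {0..10} r * W' r - r\<^sup>2 * F r)"
      using iW(1) diff(1) by simp
    show "0 < indicator {0..10} r * W' r - r\<^sup>2 * F r" if "0 < r" "r < 10" for r
      using less[of r] that by simp
    show "AE r in lebesgue_on ?I. 0 \<le> indicator {0..10} r * W' r - r\<^sup>2 * F r"
    proof (intro AE_I2)
      fix r assume "r \<in> space (lebesgue_on ?I)"
      then have r: "0 < r" by (simp add: space_restrict_space)
      show "0 \<le> indicator {0..10} r * W' r - r\<^sup>2 * F r"
      proof (cases "r \<le> 10")
        case True
        then show ?thesis using less[OF r] r by simp
      next
        case False
        then show ?thesis by (simp add: F_def bump_def bump_deriv_def)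
      qed
    qed
  qed (use R in auto)
  then have "(LINT r|lebesgue_on ?I. r\<^sup>2 * F r) < 0" using iW diff(1) by simp
  then have "4 * pi * (LINT r|lebesgue_on ?I. r\<^sup>2 * F r) < 0" by (simp add: mult_pos_neg)
  then show "LdG_energy R t (Q_hat 10 h) < LdG_energy R t (hedgehog h)"
    using diff(2) unfolding Q by linarith
qed

theorem proposition3p2:
  shows "(\<exists>R0>0. \<exists>t0>1. \<forall>R\<ge>R0. \<forall>t\<ge>t0. \<forall>h.
            is_arg_min (radial_energy R t) (\<lambda>g. g \<in> radial_class R) h \<longrightarrow>
              hedgehog h \<in> Q_class R \<and>
              \<not> is_arg_min (LdG_energy R t) (\<lambda>Q. Q \<in> Q_class R) (hedgehog h))
       \<and> (\<exists>R0\<ge>10. \<forall>R\<ge>R0. \<forall>h.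
            is_arg_min (radial_energy R 200) (\<lambda>g. g \<in> radial_class R) h \<longrightarrow>
              Q_hat 10 h \<in> Q_class R \<and>
              LdG_energy R 200 (Q_hat 10 h) < LdG_energy R 200 (hedgehog h))"
proof
  have "hedgehog h \<in> Q_class R \<and> \<not> is_arg_min (LdG_energy R t) (\<lambda>Q. Q \<in> Q_class R) (hedgehog h)"
    if "R \<ge> 12" "t \<ge> 200" "is_arg_min (radial_energy R t) (\<lambda>g. g \<in> radial_class R) h" for R t h
    using Q_hat_lower_energy[OF that] by (auto simp: is_arg_min_def)
  then show "\<exists>R0>0. \<exists>t0>1. \<forall>R\<ge>R0. \<forall>t\<ge>t0. \<forall>h.
      is_arg_min (radial_energy R t) (\<lambda>g. g \<in> radial_class R) h \<longrightarrow>
        hedgehog h \<in> Q_class R \<and>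
        \<not> is_arg_min (LdG_energy R t) (\<lambda>Q. Q \<in> Q_class R) (hedgehog h)"
    by - (rule exI[of _ 12], rule conjI, simp, rule exI[of _ 200], rule conjI, simp, blast)
  show "\<exists>R0\<ge>10. \<forall>R\<ge>R0. \<forall>h.
      is_arg_min (radial_energy R 200) (\<lambda>g. g \<in> radial_class R) h \<longrightarrow>
        Q_hat 10 h \<in> Q_class R \<and>
        LdG_energy R 200 (Q_hat 10 h) < LdG_energy R 200 (hedgehog h)"
    using Q_hat_lower_energy(2,3)[of _ 200] by (intro exI[of _ "12 :: real"]) simp
qed

end
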